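(* Let $\boldsymbol{q}_h^-\in[L^2(\Omega)]^2$ and $\lambda_h^-\in L^2(\Gamma_S)$ be given data at time $t_n$ on a space-time slab $\mathcal{E}^n$. If the stabilization parameter $\tau$ is positive, then there exists a unique solution $(\boldsymbol{q}_h,v_h,\lambda_h)\in\boldsymbol{V}_h\times W_h\times M_h$ of the space-time HDG problem: for all $(\boldsymbol{r}_h,w_h,\mu_h)\in\boldsymbol{V}_h\times W_h\times M_h$, $$-(\boldsymbol{q}_h,f_n\partial_t\boldsymbol{r}_h)_{\mathcal{T}^n}-(\boldsymbol{q}_h,\boldsymbol{r}_hf_n')_{\mathcal{T}^n}+\langle\boldsymbol{q}_h,\boldsymbol{r}_hf_n\rangle_{\mathcal{F}_\Omega^n(t_{n+1})}+(v_h,f_n\nabla\cdot\boldsymbol{r}_h)_{\mathcal{T}^n}-\langle\lambda_h,\boldsymbol{r}_h\cdot\boldsymbol{n}f_n\rangle_{\mathcal{F}_{\mathcal{Q}}^n}=\langle\boldsymbol{q}_h^-,\boldsymbol{r}_hf_n\rangle_{\mathcal{F}_\Omega^n(t_n)},$$ $$-(w_h,f_n\nabla\cdot\boldsymbol{q}_h)_{\mathcal{T}^n}+\langle\tau(v_h-\lambda_h),w_hf_n\rangle_{\mathcal{F}_{\mathcal{Q}}^n}=0,$$ $$\langle\boldsymbol{q}_h\cdot\boldsymbol{n}-\tau(v_h-\lambda_h),\mu_hf_n\rangle_{\mathcal{F}_{\mathcal{Q}}^n}-\langle\lambda_h,f_n\partial_t\mu_h\rangle_{\mathcal{F}_{\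mathcal{S}}^n}-\langle\lambda_h,\mu_hf_n'\rangle_{\mathcal{F}_{\mathcal{S}}^n}+\langle\!\langle\lambda_h,\mu_hf_n\rangle\!\rangle_{\partial\mathcal{E}_{\mathcal{S}}^n(t_{n+1})}=\langle\!\langle\lambda_h^-,\mu_hf_n\rangle\!\rangle_{\partial\mathcal{E}_{\mathcal{S}}^n(t_n)}.$$
   Context: Domain: $\Omega=\{(x_1,x_2)\in\mathbb{R}^2: -H+b(x_1)<x_2<0,\ L<x_1<R\}$, with $b>0$ piecewise linear, $b<H$, $b(L)=b(R)$. Its boundary consists of the free surface $\Gamma_S$ ($x_2=0$), the bottom $\Gamma_N$ ($x_2=-H+b(x_1)$), and the lateral sides $\Gamma_P$ ($x_1=L$ and $x_1=R$), which are identified periodically. Mesh: $\mathcal{T}$ is a conforming triangulation of $\Omega$ (no hanging nodes, compatible with the periodic identification). $0=t_0<\dots<t_N=T$ with constant step $\Delta t=t_{n+1}-t_n$, $I_n=(t_n,t_{n+1})$. The slab is $\mathcal{E}^n=\Omega\times I_n$ and $\mathcal{T}^n=\{\mathcal{K}=K\times I_n: K\in\mathcal{T}\}$. Points are $(x_0,x_1,x_2)$ with $x_0=t$; $\nabla$ and $\nabla\cdot$ are spatial. For $\mathcal{K}=K\times I_n$, $\mathcal{Q}_{\mathcal{K}}=\partial K\times I_n$ is the lateral boundary (three faces $\mathcal{F}=e\times I_n$, $e$ an edge of $K$) with outward unit spatial normal $\boldsymbol{n}$. $\mathcal{F}_{\mathcal{Q}}^n$ is the set of all lateral faces of the mesh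 (interior and boundary; periodically matching faces are identified) and $\Gamma_{\mathcal{Q}}^n$ their union; $\mathcal{F}_{\mathcal{S}}^n$ is the set of faces lying on $\Gamma_S\times I_n$. Spaces: with $p\ge 0$ the polynomial degree, $P_p(D)$ the polynomials of total degree at most $p$ on $D$, and $Q_p(\mathcal{F})$ the tensor-product polynomials of degree $p$ on the quadrilateral face $\mathcal{F}$, $W_h=\{w\in L^2(\mathcal{E}^n): w|_{\mathcal{K}}\in P_p(K)\otimes P_p(I_n)\ \forall\mathcal{K}\in\mathcal{T}^n\}$, $\boldsymbol{V}_h=\{\boldsymbol{v}\in[L^2(\mathcal{E}^n)]^2:\boldsymbol{v}|_{\mathcal{K}}\in[P_p(K)\otimes P_p(I_n)]^2\ \forall\mathcal{K}\in\mathcal{T}^n\}$, $M_h=\{\mu\in L^2(\Gamma_{\mathcal{Q}}^n):\mu|_{\mathcal{F}}\in Q_p(\mathcal{F})\ \forall\mathcal{F}\in\mathcal{F}_{\mathcal{Q}}^n\}$. Inner products: $(v,w)_{\mathcal{T}^n}=\sum_{\mathcal{K}}\int_{\mathcal{K}}vw$; $\langle v,w\rangle_{\mathcal{F}_{\mathcal{Q}}^n}=\sum_{\mathcal{K}}\int_{\mathcal{Q}_{\mathcal{K}}}vw$ (so interior faces are counted once from each side); $\langle v,w\rangle_{\mathcal{F}_\Omega^n(t_m)}=\sum_K\int_{K\times\{t_m\}}vw$, $m\in\{n,n+1\}$; $\langle v,w\rangle_{\mathcal{F}_{\mathcal{S}}^n}=\sum_{\mathcal{F}\in\mathcal{F}_{\mathcal{S}}^n}\int_{\mathcal{F}}vw$;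 $\langle\!\langle v,w\rangle\!\rangle_{\partial\mathcal{E}_{\mathcal{S}}^n(t_m)}=\sum_e\int_evw$ over the mesh edges $e$ of $\Gamma_S\times\{t_m\}$. Products of vector functions are dot products; traces are taken from inside the slab $\mathcal{E}^n$ (except for the given data). Weight: $f_n(t)=e^{-\alpha(t-t_n)}$ with $\alpha>0$ constant; $f_n'$ is its time derivative. The stabilization parameter $\tau$ is a constant on each $\mathcal{Q}_{\mathcal{K}}$. *)

theory Defs
  imports "HOL-Analysis.Analysis"
begin

type_synonym plane = "real \<times> real"
type_synonym spacetime = "real \<times> plane"  \<comment> \<open>points (x0, (x1, x2)) with x0 the time\<close>

section \<open>Domain and mesh\<close>

text \<open>The affine pieces live on closed, overlapping intervals, so the function is continuous.\<close>

definition piecewise_linear_on :: "real \<Rightarrow> real \<Rightarrow> (real \<Rightarrow> real) \<Rightarrow> bool" where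
  "piecewise_linear_on L R b \<longleftrightarrow>
     (\<exists>(m::nat) (s::nat \<Rightarrow> real). s 0 = L \<and> s m = R \<and> (\<forall>i<m. s i < s (Suc i)) \<and>
        (\<forall>i<m. \<exists>c d. \<forall>x\<in>{s i..s (Suc i)}. b x = c * x + d))"

definition water_domain :: "real \<Rightarrow> real \<Rightarrow> real \<Rightarrow> (real \<Rightarrow> real) \<Rightarrow> plane set" where
  "water_domain L R H b = {(x1, x2). L < x1 \<and> x1 < R \<and> - H + b x1 < x2 \<and> x2 < 0}"

definition free_surface :: "real \<Rightarrow> real \<Rightarrow> plane set" where
  "free_surface L R = {L<..<R} \<times> {0}"

definition edges :: "plane set \<Rightarrow> plane set set" where
  "edges K = {e. e edge_of K}"

definition mesh_edges :: "plane set set \<Rightarrow> plane set set" where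
  "mesh_edges \<T> = (\<Union>K\<in>\<T>. edges K)"

definition surface_edges :: "plane set set \<Rightarrow> plane set set" where
  "surface_edges \<T> = {e \<in> mesh_edges \<T>. e \<subseteq> {x. snd x = 0}}"

definition vertical_edges :: "plane set set \<Rightarrow> real \<Rightarrow> plane set set" where
  "vertical_edges \<T> c = {e \<in> mesh_edges \<T>. e \<subseteq> {x. fst x = c}}"

text \<open>Mesh elements are closed triangles. The library notion of a triangulation requires any two
  elements to meet in a common face (possibly empty), which excludes hanging nodes. The last
  clause is compatibility with the identification of the sides x1 = L and x1 = R.\<close>

definition periodic_mesh :: "real \<Rightarrow> real \<Rightarrow> plane set \<Rightarrow> plane set set \<Rightarrow> bool" where
  "periodic_mesh L R \<Omega> \<T> \<longleftrightarrow>
     triangulation \<T> \<and> (\<forall>K\<in>\<T>. 2 simplex K) \<and> \<Union>\<T> = closure \<Omega> \<and>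
     (\<lambda>e. (\<lambda>x. x + (R - L, 0)) ` e) ` vertical_edges \<T> L = vertical_edges \<T> R"

definition outward_normal :: "plane set \<Rightarrow> plane set \<Rightarrow> plane" where
  "outward_normal K e = (THE \<nu>. norm \<nu> = 1 \<and> (\<forall>x\<in>e. \<forall>y\<in>e. \<nu> \<bullet> (x - y) = 0) \<and>
                                 (\<forall>x\<in>K. \<forall>y\<in>e. \<nu> \<bullet> (x - y) \<le> 0))"

text \<open>Arc length on a segment, as the image of Lebesgue measure under a unit-speed
  parametrization; it does not depend on which end point is chosen as a.\<close>

definition arc_length :: "plane set \<Rightarrow> plane measure" where
  "arc_length e = (case SOME ab. e = closed_segment (fst ab) (snd ab) of (a, b) \<Rightarrow>
     distr (restrict_space lborel {0..dist a b}) borel (\<lambda>s. a + s *\<^sub>R sgn (b - a)))"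

text \<open>Surface measure on a lateral face is the restriction to \<open>I \<times> e\<close> of the following.\<close>

definition face_measure :: "plane set \<Rightarrow> spacetime measure" where
  "face_measure e = lborel \<Otimes>\<^sub>M arc_length e"

section \<open>Function spaces\<close>

text \<open>Elements of L2 are represented by Borel functions; equality in L2 is
  equality almost everywhere. Values outside A are irrelevant.\<close>

definition L2_on :: "'a measure \<Rightarrow> 'a set \<Rightarrow> ('a \<Rightarrow> real) set" where
  "L2_on M A = {f. set_borel_measurable M A f \<and> set_integrable M A (\<lambda>x. (f x)\<^sup>2)}"

definition vec_space :: "('a \<Rightarrow> real) set \<Rightarrow> ('a \<Rightarrow> plane) set" where
  "vec_space S = {v. (\<lambda>x. fst (v x)) \<in> S \<and> (\<lambda>x. snd (v x)) \<in> S}"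

definition ae_eq_on :: "'a measure \<Rightarrow> 'a set \<Rightarrow> ('a \<Rightarrow> 'b) \<Rightarrow> ('a \<Rightarrow> 'b) \<Rightarrow> bool" where
  "ae_eq_on M A f g \<longleftrightarrow> (AE x in M. x \<in> A \<longrightarrow> f x = g x)"

text \<open>The space \<open>P\<^sub>p(K) \<otimes> P\<^sub>p(I)\<close>, as polynomials on all of space-time.\<close>

definition element_polys :: "nat \<Rightarrow> (spacetime \<Rightarrow> real) set" where
  "element_polys p = {g. \<exists>c. \<forall>t x y.
     g (t, x, y) = (\<Sum>k\<le>p. \<Sum>i\<le>p. \<Sum>j\<le>p - i. c k i j * t ^ k * x ^ i * y ^ j)}"

text \<open>The space \<open>Q\<^sub>p(I \<times> e)\<close>; values away from \<open>\<real> \<times> e\<close> are irrelevant.\<close>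

definition face_polys :: "nat \<Rightarrow> plane set \<Rightarrow> (spacetime \<Rightarrow> real) set" where
  "face_polys p e = {g. \<exists>a b c. e = closed_segment a b \<and> (\<forall>t. \<forall>s\<in>{0..1}.
     g (t, a + s *\<^sub>R (b - a)) = (\<Sum>k\<le>p. \<Sum>j\<le>p. c k j * t ^ k * s ^ j))}"

text \<open>Elements are integrated over their interiors, which differ from them by null sets and lie
  in \<open>\<Omega>\<close>.\<close>

definition W_space :: "nat \<Rightarrow> plane set \<Rightarrow> plane set set \<Rightarrow> real set \<Rightarrow> (spacetime \<Rightarrow> real) set" where
  "W_space p \<Omega> \<T> I = {w \<in> L2_on lborel (I \<times> \<Omega>).
     \<forall>K\<in>\<T>. \<exists>g\<in>element_polys p. ae_eq_on lborel (I \<times> interior K) w g}"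

definition V_space :: "nat \<Rightarrow> plane set \<Rightarrow> plane set set \<Rightarrow> real set \<Rightarrow> (spacetime \<Rightarrow> plane) set" where
  "V_space p \<Omega> \<T> I = vec_space (W_space p \<Omega> \<T> I)"

text \<open>The last clause says that a function on the skeleton takes the same values on periodically
  matching faces.\<close>

definition M_space :: "nat \<Rightarrow> real \<Rightarrow> real \<Rightarrow> plane set set \<Rightarrow> real set \<Rightarrow> (spacetime \<Rightarrow> real) set" where
  "M_space p L R \<T> I = {\<mu>.
     (\<forall>e\<in>mesh_edges \<T>. \<mu> \<in> L2_on (face_measure e) (I \<times> e) \<and>
        (\<exists>g\<in>face_polys p e. ae_eq_on (face_measure e) (I \<times> e) \<mu> g)) \<and>
     (\<forall>e\<in>vertical_edges \<T> L. ae_eq_on (face_measure e) (I \<times> e) (\<lambda>z. \<mu> (z + (0, R - L, 0))) \<mu>)}"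

text \<open>The polynomial representing a discrete function on one element (face). Traces of the
  function from inside that element, and its derivatives there, are those of this polynomial.\<close>

definition elem_rep :: "nat \<Rightarrow> real set \<Rightarrow> (spacetime \<Rightarrow> real) \<Rightarrow> plane set \<Rightarrow> spacetime \<Rightarrow> real" where
  "elem_rep p I w K = (SOME g. g \<in> element_polys p \<and> ae_eq_on lborel (I \<times> interior K) w g)"

definition elem_rep_vec :: "nat \<Rightarrow> real set \<Rightarrow> (spacetime \<Rightarrow> plane) \<Rightarrow> plane set \<Rightarrow> spacetime \<Rightarrow> plane" where
  "elem_rep_vec p I v K = (\<lambda>z. (elem_rep p I (\<lambda>z. fst (v z)) K z, elem_rep p I (\<lambda>z. snd (v z)) K z))"

definition face_rep :: "nat \<Rightarrow> real set \<Rightarrow> (spacetime \<Rightarrow> real) \<Rightarrow> plane set \<Rightarrow> spacetime \<Rightarrow> real" where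
  "face_rep p I \<mu> e = (SOME g. g \<in> face_polys p e \<and> ae_eq_on (face_measure e) (I \<times> e) \<mu> g)"

section \<open>Differential operators and inner products\<close>

definition dt :: "(spacetime \<Rightarrow> 'a::real_normed_vector) \<Rightarrow> spacetime \<Rightarrow> 'a" where
  "dt g = (\<lambda>(t, x). vector_derivative (\<lambda>s. g (s, x)) (at t))"

definition divergence :: "(spacetime \<Rightarrow> plane) \<Rightarrow> spacetime \<Rightarrow> real" where
  "divergence g = (\<lambda>(t, x1, x2). deriv (\<lambda>y. fst (g (t, y, x2))) x1 + deriv (\<lambda>y. snd (g (t, x1, y))) x2)"

definition weight :: "real \<Rightarrow> real \<Rightarrow> real \<Rightarrow> real" where
  "weight \<alpha> tn t = exp (- \<alpha> * (t - tn))"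

text \<open>The arguments are families indexed by the elements (and their edges).\<close>

definition ip_elements ::
  "plane set set \<Rightarrow> real set \<Rightarrow> (plane set \<Rightarrow> spacetime \<Rightarrow> 'a::real_inner) \<Rightarrow> (plane set \<Rightarrow> spacetime \<Rightarrow> 'a) \<Rightarrow> real" where
  "ip_elements \<T> I v w = (\<Sum>K\<in>\<T>. LINT z:I \<times> interior K|lborel. v K z \<bullet> w K z)"

definition ip_lateral ::
  "plane set set \<Rightarrow> real set \<Rightarrow> (plane set \<Rightarrow> plane set \<Rightarrow> spacetime \<Rightarrow> real) \<Rightarrow> (plane set \<Rightarrow> plane set \<Rightarrow> spacetime \<Rightarrow> real) \<Rightarrow> real" where
  "ip_lateral \<T> I v w =
     (\<Sum>K\<in>\<T>. \<Sum>e\<in>edges K. LINT z:I \<times> e|face_measure e. v K e z * w K e z)"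

definition ip_time ::
  "plane set set \<Rightarrow> real \<Rightarrow> (plane set \<Rightarrow> spacetime \<Rightarrow> 'a::real_inner) \<Rightarrow> (plane set \<Rightarrow> spacetime \<Rightarrow> 'a) \<Rightarrow> real" where
  "ip_time \<T> s v w = (\<Sum>K\<in>\<T>. LINT x:interior K|lborel. v K (s, x) \<bullet> w K (s, x))"

definition ip_surface ::
  "plane set set \<Rightarrow> real set \<Rightarrow> (plane set \<Rightarrow> spacetime \<Rightarrow> real) \<Rightarrow> (plane set \<Rightarrow> spacetime \<Rightarrow> real) \<Rightarrow> real" where
  "ip_surface \<T> I v w = (\<Sum>e\<in>surface_edges \<T>. LINT z:I \<times> e|face_measure e. v e z * w e z)"

definition ip_surface_time ::
  "plane set set \<Rightarrow> real \<Rightarrow> (plane set \<Rightarrow> spacetime \<Rightarrow> real) \<Rightarrow> (plane set \<Rightarrow> spacetime \<Rightarrow> real) \<Rightarrow> real" where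
  "ip_surface_time \<T> s v w = (\<Sum>e\<in>surface_edges \<T>. LINT x:e|arc_length e. v e (s, x) * w e (s, x))"

section \<open>The space-time HDG problem on one slab\<close>

definition hdg_equations ::
  "nat \<Rightarrow> plane set set \<Rightarrow> real \<Rightarrow> real \<Rightarrow> real \<Rightarrow> (plane set \<Rightarrow> real) \<Rightarrow> (plane \<Rightarrow> plane) \<Rightarrow> (plane \<Rightarrow> real)
   \<Rightarrow> (spacetime \<Rightarrow> plane) \<Rightarrow> (spacetime \<Rightarrow> real) \<Rightarrow> (spacetime \<Rightarrow> real)
   \<Rightarrow> (spacetime \<Rightarrow> plane) \<Rightarrow> (spacetime \<Rightarrow> real) \<Rightarrow> (spacetime \<Rightarrow> real) \<Rightarrow> bool" where
  "hdg_equations p \<T> t0 t1 \<alpha> \<tau> q0 l0 q v l r w \<mu> \<longleftrightarrow>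
   (let I = {t0<..<t1};
        f = (\<lambda>z. weight \<alpha> t0 (fst z));
        f' = (\<lambda>z. deriv (weight \<alpha> t0) (fst z));
        qK = elem_rep_vec p I q;
        vK = elem_rep p I v;
        rK = elem_rep_vec p I r;
        wK = elem_rep p I w;
        lF = face_rep p I l;
        \<mu>F = face_rep p I \<mu>
    in
      - ip_elements \<T> I qK (\<lambda>K z. f z *\<^sub>R dt (rK K) z)
      - ip_elements \<T> I qK (\<lambda>K z. f' z *\<^sub>R rK K z)
      + ip_time \<T> t1 qK (\<lambda>K z. f z *\<^sub>R rK K z)
      + ip_elements \<T> I vK (\<lambda>K z. f z * divergence (rK K) z)
      - ip_lateral \<T> I (\<lambda>K e. lF e) (\<lambda>K e z. (rK K z \<bullet> outward_normal K e) * f z)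
      = ip_time \<T> t0 (\<lambda>K z. q0 (snd z)) (\<lambda>K z. f z *\<^sub>R rK K z)
    \<and>
      - ip_elements \<T> I wK (\<lambda>K z. f z * divergence (qK K) z)
      + ip_lateral \<T> I (\<lambda>K e z. \<tau> K * (vK K z - lF e z)) (\<lambda>K e z. wK K z * f z)
      = 0
    \<and>
      ip_lateral \<T> I (\<lambda>K e z. qK K z \<bullet> outward_normal K e - \<tau> K * (vK K z - lF e z))
                     (\<lambda>K e z. \<mu>F e z * f z)
      - ip_surface \<T> I lF (\<lambda>e z. f z * dt (\<mu>F e) z)
      - ip_surface \<T> I lF (\<lambda>e z. \<mu>F e z * f' z)
      + ip_surface_time \<T> t1 lF (\<lambda>e z. \<mu>F e z * f z)
      = ip_surface_time \<T> t0 (\<lambda>e z. l0 (snd z)) (\<lambda>e z. \<mu>F e z * f z))"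

definition hdg_solution ::
  "nat \<Rightarrow> real \<Rightarrow> real \<Rightarrow> plane set \<Rightarrow> plane set set \<Rightarrow> real \<Rightarrow> real \<Rightarrow> real \<Rightarrow> (plane set \<Rightarrow> real)
   \<Rightarrow> (plane \<Rightarrow> plane) \<Rightarrow> (plane \<Rightarrow> real)
   \<Rightarrow> (spacetime \<Rightarrow> plane) \<Rightarrow> (spacetime \<Rightarrow> real) \<Rightarrow> (spacetime \<Rightarrow> real) \<Rightarrow> bool" where
  "hdg_solution p L R \<Omega> \<T> t0 t1 \<alpha> \<tau> q0 l0 q v l \<longleftrightarrow>
     q \<in> V_space p \<Omega> \<T> {t0<..<t1} \<and> v \<in> W_space p \<Omega> \<T> {t0<..<t1} \<and> l \<in> M_space p L R \<T> {t0<..<t1} \<and>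
     (\<forall>r\<in>V_space p \<Omega> \<T> {t0<..<t1}. \<forall>w\<in>W_space p \<Omega> \<T> {t0<..<t1}. \<forall>\<mu>\<in>M_space p L R \<T> {t0<..<t1}.
        hdg_equations p \<T> t0 t1 \<alpha> \<tau> q0 l0 q v l r w \<mu>)"

end

theory Submission
  imports Defs
begin

text \<open>Summing the three equations gives one bilinear form B on the discrete space. In
  \<open>B(x, x)\<close> the coupling of q with \<open>(v, \<lambda>)\<close> cancels by skew-symmetry, and since the
  weight decreases in time, integration by parts in time bounds \<open>B(x, x)\<close> from below by weighted
  squares of q, of \<open>\<lambda>\<close> on the free surface, and of \<open>v - \<lambda>\<close> on the lateral faces. If B
  annihilates x on one side, what remains is the coupling of \<open>(v, \<lambda>)\<close> with arbitrary test
  fields; by the divergence theorem on a triangle, testing with \<open>\<nabla>v\<close> shows that v is constant in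
  space on each element. It agrees with \<open>\<lambda>\<close> on all edges and vanishes at the free surface, hence
  vanishes everywhere, because the domain stays connected after removing finitely many points. The
  argument applies to the kernels on both sides of B, so uniqueness gives existence by finite
  dimensionality.\<close>

section \<open>Finite-dimensional variational problems\<close>

text \<open>Members of the discrete spaces are functions, not classes modulo null sets, so these
  spaces are infinite dimensional. The solvability argument therefore works with a bare set and an
  operation \<open>comb x c y\<close>, thought of as x + c y; finite dimensionality enters through
  finitely many functionals whose common kernel is annihilated by B. Pointwise work is done on
  polynomial representatives, for which vanishing almost everywhere on a nondegenerate slab or face
  implies vanishing identically there.

  With a constant weight, integration by parts in time would control only the squares at the two end
  times. The decay rate \<alpha> > 0 adds \<alpha>/2 times the integral of f h^2 over the whole
  slab, and this is what forces q, and \<lambda> on the free surface, to vanish.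

  No time derivative of v occurs in the equations, so the energy sees v only through v - \<lambda>.
  That is why the gradient test comes second: once v = \<lambda> on every face, the face term of the
  coupling is exactly the boundary term of the divergence theorem.\<close>

lemma functional_in_span:
  fixes comb :: "'a \<Rightarrow> real \<Rightarrow> 'a \<Rightarrow> 'a" and f :: "'i \<Rightarrow> 'a \<Rightarrow> real"
  assumes "finite J"
    and "\<And>x c y. x \<in> X \<Longrightarrow> y \<in> X \<Longrightarrow> comb x c y \<in> X"
    and "\<And>i x c y. i \<in> J \<Longrightarrow> x \<in> X \<Longrightarrow> y \<in> X \<Longrightarrow> f i (comb x c y) = f i x + c * f i y"
    and "\<And>x c y. x \<in> X \<Longrightarrow> y \<in> X \<Longrightarrow> g (comb x c y) = g x + c * g y"
    and "\<And>x. x \<in> X \<Longrightarrow> (\<forall>i\<in>J. f i x = 0) \<Longrightarrow> g x = 0"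
  shows "\<exists>c. \<forall>x\<in>X. g x = (\<Sum>i\<in>J. c i * f i x)"
  using assms
proof (induction J arbitrary: X g rule: finite_induct)
  case empty
  then show ?case by auto
next
  case (insert j J)
  \<comment> \<open>On the kernel of \<open>f j\<close> the functionals in \<open>J\<close> alone
    control \<open>g\<close>; outside it at most one further direction has to be matched.\<close>
  let ?X = "{x \<in> X. f j x = 0}"
  have "\<exists>c. \<forall>x\<in>?X. g x = (\<Sum>i\<in>J. c i * f i x)"
  proof (rule insert.IH)
    show "comb x c y \<in> ?X" if "x \<in> ?X" "y \<in> ?X" for x c y
      using that insert.prems(1,2) by simp
    show "f i (comb x c y) = f i x + c * f i y" if "i \<in> J" "x \<in> ?X" "y \<in> ?X" for i x c y
      using that insert.prems(2) by simp
    show "g (comb x c y) = g x + c * g y" if "x \<in> ?X" "y \<in> ?X" for x c y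
      using that insert.prems(3) by simp
    show "g x = 0" if "x \<in> ?X" "\<forall>i\<in>J. f i x = 0" for x
      using that insert.prems(4) by simp
  qed
  then obtain c where c: "\<And>x. x \<in> ?X \<Longrightarrow> g x = (\<Sum>i\<in>J. c i * f i x)" by blast
  show ?case
  proof (cases "\<exists>x0\<in>X. f j x0 \<noteq> 0")
    case False
    then have "\<forall>x\<in>X. g x = (\<Sum>i\<in>insert j J. c i * f i x)"
      using c insert.hyps by simp
    then show ?thesis by blast
  next
    case True
    then obtain x0 where x0: "x0 \<in> X" "f j x0 \<noteq> 0" by blast
    \<comment> \<open>The value of \<open>d\<close> is forced by the wanted identity at
      \<open>x0\<close>. Any other \<open>x\<close> is shifted along \<open>x0\<close> into the
      kernel of \<open>f j\<close>, where the induction hypothesis applies.\<close>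
    define d where "d = (g x0 - (\<Sum>i\<in>J. c i * f i x0)) / f j x0"
    have "g x = (\<Sum>i\<in>insert j J. (c(j := d)) i * f i x)" if x: "x \<in> X" for x
    proof -
      define k where "k = f j x / f j x0"
      have "f j (comb x (- k) x0) = 0"
        using insert.prems(2)[of j x x0 "-k"] x x0 by (simp add: k_def)
      then have "comb x (- k) x0 \<in> ?X" using insert.prems(1) x x0 by blast
      then have "g x - k * g x0 = (\<Sum>i\<in>J. c i * f i (comb x (- k) x0))"
        using c insert.prems(3)[OF x x0(1), of "-k"] by force
      also have "\<dots> = (\<Sum>i\<in>J. c i * f i x - k * (c i * f i x0))"
      proof (intro sum.cong refl)
        fix i assume "i \<in> J"
        then have *: "f i (comb x (- k) x0) = f i x - k * f i x0"
          using insert.prems(2)[of i x x0 "- k"] x x0(1) by simp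
        show "c i * f i (comb x (- k) x0) = c i * f i x - k * (c i * f i x0)"
          unfolding * by (simp add: algebra_simps)
      qed
      also have "\<dots> = (\<Sum>i\<in>J. c i * f i x) - k * (\<Sum>i\<in>J. c i * f i x0)"
        by (simp add: sum_subtractf sum_distrib_left)
      finally have "g x = (\<Sum>i\<in>J. c i * f i x) + d * f j x"
        using x0(2) by (simp add: k_def d_def field_simps)
      moreover have "(\<Sum>i\<in>J. (c(j := d)) i * f i x) = (\<Sum>i\<in>J. c i * f i x)"
        using insert.hyps by (intro sum.cong) auto
      ultimately show ?thesis using insert.hyps by simp
    qed
    then show ?thesis by blast
  qed
qed

text \<open>Stands in for the dual of the quotient of \<open>X\<close> by \<open>N\<close>. No
  vector space laws are assumed of \<open>comb\<close>, so elements are compared only through these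
  functionals.\<close>

definition functionals_vanishing :: "('a \<Rightarrow> real \<Rightarrow> 'a \<Rightarrow> 'a) \<Rightarrow> 'a set \<Rightarrow> 'a set \<Rightarrow> ('a \<Rightarrow> real) set" where
  "functionals_vanishing comb X N =
     {g. (\<forall>x\<in>X. \<forall>c. \<forall>y\<in>X. g (comb x c y) = g x + c * g y) \<and> (\<forall>x\<in>N. g x = 0)}"

text \<open>The quotient by the common kernel of finitely many functionals is finite dimensional:
  each functional that is nonzero somewhere on the current kernel contributes one vector. The
  coordinates \<open>c\<close> of \<open>x\<close> serve all \<open>g\<close> at once, which is what
  spanning means here.\<close>

lemma finite_spanning_list:
  fixes comb :: "'a \<Rightarrow> real \<Rightarrow> 'a \<Rightarrow> 'a" and \<phi> :: "'i \<Rightarrow> 'a \<Rightarrow> real"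
  assumes "finite J"
    and "\<And>x c y. x \<in> X \<Longrightarrow> y \<in> X \<Longrightarrow> comb x c y \<in> X"
    and "\<And>i x c y. i \<in> J \<Longrightarrow> x \<in> X \<Longrightarrow> y \<in> X \<Longrightarrow> \<phi> i (comb x c y) = \<phi> i x + c * \<phi> i y"
  shows "\<exists>(m::nat) (e::nat \<Rightarrow> 'a). (\<forall>k<m. e k \<in> X) \<and>
    (\<forall>x\<in>X. \<exists>c. \<forall>g\<in>functionals_vanishing comb X {x \<in> X. \<forall>i\<in>J. \<phi> i x = 0}. g x = (\<Sum>k<m. c k * g (e k)))"
  using assms
proof (induction J arbitrary: X rule: finite_induct)
  case empty
  then show ?case by (intro exI[of _ "0::nat"]) (auto simp: functionals_vanishing_def)
next
  case (insert j J)
  define Y where "Y = {x \<in> X. \<phi> j x = 0}"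
  define G where "G = functionals_vanishing comb X {x \<in> X. \<forall>i\<in>insert j J. \<phi> i x = 0}"
  define GY where "GY = functionals_vanishing comb Y {x \<in> Y. \<forall>i\<in>J. \<phi> i x = 0}"
  \<comment> \<open>The common kernel of \<open>insert j J\<close> in \<open>X\<close> is the common
    kernel of \<open>J\<close> in \<open>Y\<close>, so restricting to \<open>Y\<close> loses no
    condition.\<close>
  have G_sub: "G \<subseteq> GY"
    by (auto simp: G_def GY_def Y_def functionals_vanishing_def)
  have "\<exists>(m::nat) (e::nat \<Rightarrow> 'a). (\<forall>k<m. e k \<in> Y) \<and> (\<forall>x\<in>Y. \<exists>c. \<forall>g\<in>GY. g x = (\<Sum>k<m. c k * g (e k)))"
    unfolding GY_def
  proof (rule insert.IH)
    show "comb x c y \<in> Y" if "x \<in> Y" "y \<in> Y" for x c y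
      using that insert.prems(1)[of x y c] insert.prems(2)[of j x y c] by (simp add: Y_def)
    show "\<phi> i (comb x c y) = \<phi> i x + c * \<phi> i y" if "i \<in> J" "x \<in> Y" "y \<in> Y" for i x c y
      using that insert.prems(2)[of i x y c] by (simp add: Y_def)
  qed
  then obtain m :: nat and e :: "nat \<Rightarrow> 'a" where e: "\<forall>k<m. e k \<in> Y"
    and sp: "\<forall>x\<in>Y. \<exists>c. \<forall>g\<in>GY. g x = (\<Sum>k<m. c k * g (e k))" by (elim exE conjE)
  show ?case
    unfolding G_def[symmetric]
  proof (cases "\<exists>x0\<in>X. \<phi> j x0 \<noteq> 0")
    case False
    then have "Y = X" by (auto simp: Y_def)
    have "\<exists>c. \<forall>g\<in>G. g x = (\<Sum>k<m. c k * g (e k))" if "x \<in> X" for x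
      using sp that G_sub \<open>Y = X\<close> by (meson subsetD)
    then show "\<exists>(m::nat) e. (\<forall>k<m. e k \<in> X) \<and> (\<forall>x\<in>X. \<exists>c. \<forall>g\<in>G. g x = (\<Sum>k<m. c k * g (e k)))"
      using e \<open>Y = X\<close> by (intro exI[of _ m] exI[of _ e] conjI ballI) simp_all
  next
    case True
    then obtain x0 where x0: "x0 \<in> X" "\<phi> j x0 \<noteq> 0" by blast
    define e' where "e' = e(m := x0)"
    have "\<exists>c. \<forall>g\<in>G. g x = (\<Sum>k<Suc m. c k * g (e' k))" if x: "x \<in> X" for x
    proof -
      define k where "k = \<phi> j x / \<phi> j x0"
      have "\<phi> j (comb x (- k) x0) = 0"
        using insert.prems(2)[of j x x0 "-k"] x x0 by (simp add: k_def)
      then have "comb x (- k) x0 \<in> Y" using insert.prems(1) x x0 by (simp add: Y_def)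
      then obtain c where c: "\<forall>g\<in>GY. g (comb x (- k) x0) = (\<Sum>k<m. c k * g (e k))"
        using sp by meson
      have "g x = (\<Sum>i<Suc m. (c(m := k)) i * g (e' i))" if g: "g \<in> G" for g
      proof -
        have "g (comb x (- k) x0) = (\<Sum>k<m. c k * g (e k))"
          using g G_sub c by (meson subsetD)
        moreover have "g (comb x (- k) x0) = g x - k * g x0"
          using g x x0 by (simp add: G_def functionals_vanishing_def)
        ultimately show ?thesis by (simp add: e'_def)
      qed
      then show ?thesis by (intro exI[of _ "c(m := k)"] ballI)
    qed
    moreover have "\<forall>k<Suc m. e' k \<in> X" using e x0(1) by (simp add: less_Suc_eq e'_def Y_def)
    ultimately show "\<exists>(m::nat) e. (\<forall>k<m. e k \<in> X) \<and> (\<forall>x\<in>X. \<exists>c. \<forall>g\<in>G. g x = (\<Sum>k<m. c k * g (e k)))"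
      by (intro exI[of _ "Suc m"] exI[of _ e'] conjI ballI) simp_all
  qed
qed

text \<open>A Fredholm alternative for spaces that are finite dimensional only modulo functions
  vanishing almost everywhere: the functionals \<open>\<phi>\<close> separate the points up to
  elements on which B vanishes.\<close>

lemma variational_problem_solvable:
  fixes comb :: "'a \<Rightarrow> real \<Rightarrow> 'a \<Rightarrow> 'a" and \<phi> :: "'i \<Rightarrow> 'a \<Rightarrow> real"
    and B :: "'a \<Rightarrow> 'a \<Rightarrow> real"
  assumes "finite J"
    and closed: "\<And>x c y. x \<in> X \<Longrightarrow> y \<in> X \<Longrightarrow> comb x c y \<in> X"
    and \<phi>: "\<And>i x c y. i \<in> J \<Longrightarrow> x \<in> X \<Longrightarrow> y \<in> X \<Longrightarrow> \<phi> i (comb x c y) = \<phi> i x + c * \<phi> i y"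
    and Bl: "\<And>x c y z. x \<in> X \<Longrightarrow> y \<in> X \<Longrightarrow> z \<in> X \<Longrightarrow> B (comb x c y) z = B x z + c * B y z"
    and Br: "\<And>x c y z. x \<in> X \<Longrightarrow> y \<in> X \<Longrightarrow> z \<in> X \<Longrightarrow> B z (comb x c y) = B z x + c * B z y"
    and F: "\<And>x c y. x \<in> X \<Longrightarrow> y \<in> X \<Longrightarrow> F (comb x c y) = F x + c * F y"
    and sep: "\<And>x y. x \<in> X \<Longrightarrow> y \<in> X \<Longrightarrow> (\<forall>i\<in>J. \<phi> i x = 0) \<Longrightarrow> B x y = 0"
    and ker: "\<And>y. y \<in> X \<Longrightarrow> (\<forall>x\<in>X. B x y = 0) \<Longrightarrow> F y = 0"
    and zero: "z \<in> X" "\<And>y. y \<in> X \<Longrightarrow> B z y = 0"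
  shows "\<exists>x\<in>X. \<forall>y\<in>X. B x y = F y"
proof -
  have "\<exists>(m::nat) (e::nat \<Rightarrow> 'a). (\<forall>k<m. e k \<in> X) \<and>
    (\<forall>x\<in>X. \<exists>c. \<forall>g\<in>functionals_vanishing comb X {x \<in> X. \<forall>i\<in>J. \<phi> i x = 0}. g x = (\<Sum>k<m. c k * g (e k)))"
    by (rule finite_spanning_list[OF assms(1)]) (use closed \<phi> in auto)
  then obtain m :: nat and e :: "nat \<Rightarrow> 'a" where e: "\<forall>k<m. e k \<in> X"
    and sp: "\<forall>x\<in>X. \<exists>c. \<forall>g\<in>functionals_vanishing comb X {x \<in> X. \<forall>i\<in>J. \<phi> i x = 0}.
      g x = (\<Sum>k<m. c k * g (e k))"
    by (elim exE conjE)
  \<comment> \<open>If all \<open>B (e k)\<close> annihilate \<open>y\<close>, then so does every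
    \<open>B x\<close>, because the \<open>e k\<close> span; by \<open>ker\<close> also
    \<open>F y = 0\<close>. Hence \<open>F\<close> is a combination of the
    \<open>B (e k)\<close>.\<close>
  have "\<exists>d. \<forall>y\<in>X. F y = (\<Sum>k<m. d k * B (e k) y)"
  proof (rule functional_in_span[of "{..<m}" X comb "\<lambda>k. B (e k)" F])
    show "F y = 0" if y: "y \<in> X" and 0: "\<forall>k\<in>{..<m}. B (e k) y = 0" for y
    proof (rule ker[OF y], rule ballI)
      fix x assume "x \<in> X"
      with sp obtain c where
        c: "\<forall>g\<in>functionals_vanishing comb X {x \<in> X. \<forall>i\<in>J. \<phi> i x = 0}.
          g x = (\<Sum>k<m. c k * g (e k))" by meson
      have "(\<lambda>x. B x y) \<in> functionals_vanishing comb X {x \<in> X. \<forall>i\<in>J. \<phi> i x = 0}"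
        using Bl sep y by (simp add: functionals_vanishing_def)
      with c have "B x y = (\<Sum>k<m. c k * B (e k) y)" by (rule bspec)
      then show "B x y = 0" using 0 by simp
    qed
  qed (use closed Br F e in auto)
  then obtain d where d: "\<And>y. y \<in> X \<Longrightarrow> F y = (\<Sum>k<m. d k * B (e k) y)" by blast
  \<comment> \<open>The linear combination of the \<open>e k\<close> is assembled by iterating
    \<open>comb\<close>, with \<open>z\<close> in the role of the zero vector.\<close>
  have "n \<le> m \<Longrightarrow> \<exists>x\<in>X. \<forall>y\<in>X. B x y = (\<Sum>k<n. d k * B (e k) y)" for n
  proof (induction n)
    case 0
    then show ?case using zero by auto
  next
    case (Suc n)
    then obtain x where "x \<in> X" "\<forall>y\<in>X. B x y = (\<Sum>k<n. d k * B (e k) y)" by auto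
    then show ?case using Suc.prems e closed Bl
      by (intro bexI[of _ "comb x (d n) (e n)"]) auto
  qed
  then show ?thesis using d by force
qed

section \<open>Polynomial spaces\<close>

definition polyfn :: "nat \<Rightarrow> (real \<Rightarrow> real) \<Rightarrow> bool" where
  "polyfn p h \<longleftrightarrow> (\<exists>P. degree P \<le> p \<and> h = poly P)"

lemma polyfn_coeffs: "polyfn p h \<longleftrightarrow> (\<exists>c. \<forall>x. h x = (\<Sum>j\<le>p. c j * x ^ j))"
proof
  assume "polyfn p h"
  then obtain P where P: "degree P \<le> p" "h = poly P" by (auto simp: polyfn_def)
  then have "h x = (\<Sum>j\<le>p. coeff P j * x ^ j)" for x
    unfolding P(2) poly_altdef by (intro sum.mono_neutral_left) (auto simp: coeff_eq_0)
  then show "\<exists>c. \<forall>x. h x = (\<Sum>j\<le>p. c j * x ^ j)" by blast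
next
  assume "\<exists>c. \<forall>x. h x = (\<Sum>j\<le>p. c j * x ^ j)"
  then obtain c where c: "\<And>x. h x = (\<Sum>j\<le>p. c j * x ^ j)" by blast
  have "h = poly (\<Sum>j\<le>p. monom (c j) j)" by (auto simp: c poly_sum poly_monom)
  moreover have "degree (\<Sum>j\<le>p. monom (c j) j) \<le> p"
    by (intro degree_sum_le) (auto intro: order.trans[OF degree_monom_le])
  ultimately show "polyfn p h" unfolding polyfn_def by blast
qed

lemma polyfn_sum: "(\<And>i. i \<in> A \<Longrightarrow> polyfn p (h i)) \<Longrightarrow> polyfn p (\<lambda>x. \<Sum>i\<in>A. h i x)"
proof (induction A rule: infinite_finite_induct)
  case (insert a A)
  obtain P where P: "degree P \<le> p" "h a = poly P"
    using insert.prems[of a] by (auto simp: polyfn_def)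
  obtain Q where Q: "degree Q \<le> p" "(\<lambda>x. \<Sum>i\<in>A. h i x) = poly Q"
    using insert.IH insert.prems by (auto simp: polyfn_def)
  have "(\<lambda>x. \<Sum>i\<in>insert a A. h i x) = poly (P + Q)"
    using P(2) Q(2) insert.hyps by (simp add: fun_eq_iff)
  then show ?case unfolding polyfn_def using degree_add_le[OF P(1) Q(1)] by blast
qed (auto simp: polyfn_def fun_eq_iff intro!: exI[of _ 0])

lemma polyfn_cmult:
  assumes "polyfn p h"
  shows "polyfn p (\<lambda>x. a * h x)"
proof -
  obtain P where P: "degree P \<le> p" "h = poly P" using assms by (auto simp: polyfn_def)
  have "degree (smult a P) \<le> p" using P(1) degree_smult_le order.trans by blast
  moreover have "(\<lambda>x. a * h x) = poly (smult a P)" using P(2) by auto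
  ultimately show ?thesis unfolding polyfn_def by (intro exI[of _ "smult a P"] conjI)
qed

lemma polyfn_power:
  assumes "j \<le> p"
  shows "polyfn p (\<lambda>x. x ^ j)"
proof -
  have "degree (monom (1::real) j) \<le> p" using assms by (simp add: degree_monom_eq)
  moreover have "(\<lambda>x. x ^ j) = poly (monom (1::real) j)" by (auto simp: poly_monom)
  ultimately show ?thesis unfolding polyfn_def by (intro exI[of _ "monom 1 j"] conjI)
qed

lemma polyfn_reflect:
  assumes "polyfn p h"
  shows "polyfn p (\<lambda>s. h (1 - s))"
proof -
  obtain P where P: "degree P \<le> p" "h = poly P" using assms by (auto simp: polyfn_def)
  have "degree (pcompose P [:1, -1:]) \<le> p" using P(1) by (simp add: degree_pcompose)
  moreover have "(\<lambda>s. h (1 - s)) = poly (pcompose P [:1, -1:])" using P(2) by (auto simp: poly_pcompose)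
  ultimately show ?thesis unfolding polyfn_def by (intro exI[of _ "pcompose P [:1, -1:]"] conjI)
qed

text \<open>Root counting. Infinite sets need their own disjunct because their \<open>card\<close>
  is 0; that case serves the almost-everywhere arguments, the finite one serves sampling on p + 1
  points.\<close>

lemma polyfn_eq_0:
  assumes "polyfn p h" "\<And>x. x \<in> S \<Longrightarrow> h x = 0" "infinite S \<or> p < card S"
  shows "h = (\<lambda>x. 0)"
proof -
  obtain P where P: "degree P \<le> p" "h = poly P" using assms by (auto simp: polyfn_def)
  have "P = 0"
  proof (rule ccontr)
    assume "P \<noteq> 0"
    then have fin: "finite {x. poly P x = 0}" "card {x. poly P x = 0} \<le> degree P"
      by (auto intro: poly_roots_finite card_poly_roots_bound)
    have "S \<subseteq> {x. poly P x = 0}" using assms(2) P by auto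
    then have "finite S" "card S \<le> card {x. poly P x = 0}"
      using fin(1) by (auto intro: finite_subset card_mono)
    with fin(2) P(1) assms(3) show False by linarith
  qed
  then show ?thesis using P by auto
qed

section \<open>Polynomials on space-time elements\<close>

lemma element_polys_sections:
  assumes "g \<in> element_polys p"
  shows "polyfn p (\<lambda>t. g (t, x, y))" "polyfn p (\<lambda>x. g (t, x, y))" "polyfn p (\<lambda>y. g (t, x, y))"
proof -
  obtain c where c: "\<And>t x y. g (t, x, y) = (\<Sum>k\<le>p. \<Sum>i\<le>p. \<Sum>j\<le>p - i. c k i j * t ^ k * x ^ i * y ^ j)"
    using assms by (auto simp: element_polys_def)
  have "polyfn p (\<lambda>t. (c k i j * x ^ i * y ^ j) * t ^ k)" if "k \<le> p" for k i j
    using that by (intro polyfn_cmult polyfn_power)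
  then show "polyfn p (\<lambda>t. g (t, x, y))"
    unfolding c by (intro polyfn_sum) (simp add: mult_ac)
  have "polyfn p (\<lambda>x. (c k i j * t ^ k * y ^ j) * x ^ i)" if "i \<le> p" for k i j
    using that by (intro polyfn_cmult polyfn_power)
  then show "polyfn p (\<lambda>x. g (t, x, y))"
    unfolding c by (intro polyfn_sum) (simp add: mult_ac)
  have "polyfn p (\<lambda>y. (c k i j * t ^ k * x ^ i) * y ^ j)" if "j \<le> p" for k i j
    using that by (intro polyfn_cmult polyfn_power)
  then show "polyfn p (\<lambda>y. g (t, x, y))"
    unfolding c by (intro polyfn_sum) auto
qed

text \<open>Root counting in one variable at a time, from the innermost outwards. The zero sets may
  depend on the outer variables, since Fubini yields a different exceptional set on each
  section.\<close>

lemma element_polys_eq_0: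
  assumes g: "g \<in> element_polys p"
    and St: "infinite St \<or> p < card St"
    and Sx: "\<And>t. t \<in> St \<Longrightarrow> infinite (Sx t) \<or> p < card (Sx t)"
    and Sy: "\<And>t x. t \<in> St \<Longrightarrow> x \<in> Sx t \<Longrightarrow> infinite (Sy t x) \<or> p < card (Sy t x)"
    and 0: "\<And>t x y. t \<in> St \<Longrightarrow> x \<in> Sx t \<Longrightarrow> y \<in> Sy t x \<Longrightarrow> g (t, x, y) = 0"
  shows "g z = 0"
proof -
  note s = element_polys_sections[OF g]
  have 1: "g (t, x, y) = 0" if "t \<in> St" "x \<in> Sx t" for t x y
    using polyfn_eq_0[OF s(3), of "Sy t x" t x] 0 Sy that by (auto simp: fun_eq_iff)
  have 2: "g (t, x, y) = 0" if "t \<in> St" for t x y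
    using polyfn_eq_0[OF s(2), of "Sx t" t y] 1 Sx that by (auto simp: fun_eq_iff)
  have 3: "g (t, x, y) = 0" for t x y
    using polyfn_eq_0[OF s(1), of St x y] 2 St by (auto simp: fun_eq_iff)
  then show ?thesis by (cases z) auto
qed

lemma element_polys_monom:
  assumes "k \<le> p" "i + j \<le> p"
  shows "(\<lambda>(t, x, y). a * t ^ k * x ^ i * y ^ j) \<in> element_polys p"
proof -
  have "a * t ^ k * x ^ i * y ^ j =
    (\<Sum>k'\<le>p. \<Sum>i'\<le>p. \<Sum>j'\<le>p - i'. (if k' = k \<and> i' = i \<and> j' = j then a else 0) * t ^ k' * x ^ i' * y ^ j')"
    for t x y :: real
  proof -
    have inner: "(\<Sum>j'\<le>p - i'. (if k' = k \<and> i' = i \<and> j' = j then a else 0) * t ^ k' * x ^ i' * y ^ j') =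
      (if k' = k then if i' = i then a * t ^ k * x ^ i * y ^ j else 0 else 0)" for k' i'
    proof (cases "k' = k \<and> i' = i")
      case True
      have "j \<le> p - i" using assms by simp
      then have "(\<Sum>j'\<le>p - i. (if j' = j then a else 0) * t ^ k * x ^ i * y ^ j') = a * t ^ k * x ^ i * y ^ j"
        by (subst sum.remove[of _ j]) auto
      then show ?thesis using True by simp
    qed auto
    have "(\<Sum>i'\<le>p. \<Sum>j'\<le>p - i'. (if k' = k \<and> i' = i \<and> j' = j then a else 0) * t ^ k' * x ^ i' * y ^ j') =
      (if k' = k then a * t ^ k * x ^ i * y ^ j else 0)" for k'
      unfolding inner using assms by (cases "k' = k") simp_all
    then show ?thesis using assms by simp
  qed
  then show ?thesis unfolding element_polys_def
    by (intro CollectI exI[of _ "\<lambda>k' i' j'. if k' = k \<and> i' = i \<and> j' = j then a else 0"]) simp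
qed

lemma element_polys_add:
  assumes "g \<in> element_polys p" "h \<in> element_polys p"
  shows "(\<lambda>z. g z + a * h z) \<in> element_polys p"
proof -
  obtain c d where "\<And>t x y. g (t, x, y) = (\<Sum>k\<le>p. \<Sum>i\<le>p. \<Sum>j\<le>p - i. c k i j * t ^ k * x ^ i * y ^ j)"
    "\<And>t x y. h (t, x, y) = (\<Sum>k\<le>p. \<Sum>i\<le>p. \<Sum>j\<le>p - i. d k i j * t ^ k * x ^ i * y ^ j)"
    using assms by (auto simp: element_polys_def)
  then show ?thesis unfolding element_polys_def
    by (auto intro!: exI[of _ "\<lambda>k i j. c k i j + a * d k i j"]
        simp: sum.distrib sum_distrib_left algebra_simps)
qed

lemma element_polys_0: "(\<lambda>z. 0) \<in> element_polys p"
  unfolding element_polys_def by (auto intro!: exI[of _ "\<lambda>k i j. 0"])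

lemma element_polys_sum:
  "(\<And>i. i \<in> A \<Longrightarrow> h i \<in> element_polys p) \<Longrightarrow> (\<lambda>z. \<Sum>i\<in>A. h i z) \<in> element_polys p"
proof (induction A rule: infinite_finite_induct)
  case (insert a A)
  then show ?case using element_polys_add[of "h a" p "\<lambda>z. \<Sum>i\<in>A. h i z" 1] by simp
qed (auto simp: element_polys_0)

lemma element_polys_continuous: "g \<in> element_polys p \<Longrightarrow> continuous_on S g"
proof -
  assume "g \<in> element_polys p"
  then obtain c where c: "\<And>t x y. g (t, x, y) = (\<Sum>k\<le>p. \<Sum>i\<le>p. \<Sum>j\<le>p - i. c k i j * t ^ k * x ^ i * y ^ j)"
    by (auto simp: element_polys_def)
  then have "g = (\<lambda>z. \<Sum>k\<le>p. \<Sum>i\<le>p. \<Sum>j\<le>p - i. c k i j * fst z ^ k * fst (snd z) ^ i * snd (snd z) ^ j)"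
    by auto
  moreover have "continuous_on S \<dots>" by (intro continuous_intros)
  ultimately show ?thesis by simp
qed

lemma element_polys_time_derivative:
  assumes "g \<in> element_polys p"
  obtains g' where "continuous_on UNIV g'"
    "\<And>t x. ((\<lambda>s. g (s, x)) has_real_derivative g' (t, x)) (at t)"
proof -
  obtain c where c: "\<And>t x y. g (t, x, y) = (\<Sum>k\<le>p. \<Sum>i\<le>p. \<Sum>j\<le>p - i. c k i j * t ^ k * x ^ i * y ^ j)"
    using assms by (auto simp: element_polys_def)
  let ?g = "\<lambda>z. \<Sum>k\<le>p. \<Sum>i\<le>p. \<Sum>j\<le>p - i. c k i j * (real k * fst z ^ (k - 1)) * fst (snd z) ^ i * snd (snd z) ^ j"
  show thesis
  proof
    show "continuous_on UNIV ?g" by (intro continuous_intros)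
    show "((\<lambda>s. g (s, x)) has_real_derivative ?g (t, x)) (at t)" for t x
      by (cases x) (auto simp: c intro!: derivative_eq_intros sum.cong)
  qed
qed

text \<open>That the partial derivatives stay in the space is what later makes the gradient of v an
  admissible test field. The truncated exponents \<open>i - 1\<close> and \<open>j - 1\<close> are
  harmless at 0, where the factors \<open>real i\<close> and \<open>real j\<close> vanish.\<close>

lemma element_polys_gradient:
  assumes "g \<in> element_polys p"
  obtains g1 g2 where "g1 \<in> element_polys p" "g2 \<in> element_polys p"
    "\<And>t x. ((\<lambda>x. g (t, x)) has_derivative (\<lambda>v. g1 (t, x) * fst v + g2 (t, x) * snd v)) (at x)"
proof -
  obtain c where c: "\<And>t x y. g (t, x, y) = (\<Sum>k\<le>p. \<Sum>i\<le>p. \<Sum>j\<le>p - i. c k i j * t ^ k * x ^ i * y ^ j)"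
    using assms by (auto simp: element_polys_def)
  let ?g1 = "\<lambda>z. \<Sum>k\<le>p. \<Sum>i\<le>p. \<Sum>j\<le>p - i. (\<lambda>(t, x, y). (c k i j * real i) * t ^ k * x ^ (i - 1) * y ^ j) z"
  let ?g2 = "\<lambda>z. \<Sum>k\<le>p. \<Sum>i\<le>p. \<Sum>j\<le>p - i. (\<lambda>(t, x, y). (c k i j * real j) * t ^ k * x ^ i * y ^ (j - 1)) z"
  show thesis
  proof
    show "?g1 \<in> element_polys p" "?g2 \<in> element_polys p"
      by (intro element_polys_sum element_polys_monom; auto)+
    fix t x
    have g: "(\<lambda>x. g (t, x)) = (\<lambda>x. \<Sum>k\<le>p. \<Sum>i\<le>p. \<Sum>j\<le>p - i. c k i j * t ^ k * fst x ^ i * snd x ^ j)"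
      using c by (auto simp: fun_eq_iff)
    show "((\<lambda>x. g (t, x)) has_derivative (\<lambda>v. ?g1 (t, x) * fst v + ?g2 (t, x) * snd v)) (at x)"
      unfolding g
      by (rule has_derivative_eq_rhs, (rule derivative_intros)+)
        (simp add: fun_eq_iff sum.distrib sum_distrib_left sum_distrib_right case_prod_beta algebra_simps)
  qed
qed

section \<open>Polynomials on lateral faces\<close>

lemma face_polys_param:
  assumes g: "g \<in> face_polys p e" and e: "e = closed_segment a b"
  obtains c where "\<And>t s. 0 \<le> s \<Longrightarrow> s \<le> 1 \<Longrightarrow>
    g (t, a + s *\<^sub>R (b - a)) = (\<Sum>k\<le>p. \<Sum>j\<le>p. c k j * t ^ k * s ^ j)"
proof -
  obtain a' b' c where e': "e = closed_segment a' b'" and c: "\<And>t s. 0 \<le> s \<Longrightarrow> s \<le> 1 \<Longrightarrow>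
    g (t, a' + s *\<^sub>R (b' - a')) = (\<Sum>k\<le>p. \<Sum>j\<le>p. c k j * t ^ k * s ^ j)"
    using g by (auto simp: face_polys_def)
  have "{a, b} = {a', b'}" using e e' closed_segment_eq by metis
  then consider "a' = a" "b' = b" | "a' = b" "b' = a" by (auto simp: doubleton_eq_iff)
  then show thesis
  proof cases
    case 1
    then show thesis using c that by blast
  next
    \<comment> \<open>A segment determines its end points only up to order. Reversal replaces s by 1
      - s, which preserves the degree bound for each power of t.\<close>
    case 2
    have "\<forall>k. \<exists>d. \<forall>s. (\<Sum>j\<le>p. c k j * (1 - s) ^ j) = (\<Sum>j\<le>p. d j * s ^ j)"
    proof
      fix k
      have "polyfn p (\<lambda>s. \<Sum>j\<le>p. c k j * s ^ j)"
        unfolding polyfn_coeffs by (intro exI[of _ "c k"]) simp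
      from polyfn_reflect[OF this]
      show "\<exists>d. \<forall>s. (\<Sum>j\<le>p. c k j * (1 - s) ^ j) = (\<Sum>j\<le>p. d j * s ^ j)"
        unfolding polyfn_coeffs .
    qed
    from choice[OF this] obtain d where
      d: "\<forall>k s. (\<Sum>j\<le>p. c k j * (1 - s) ^ j) = (\<Sum>j\<le>p. d k j * s ^ j)" by (elim exE)
    have "g (t, a + s *\<^sub>R (b - a)) = (\<Sum>k\<le>p. \<Sum>j\<le>p. d k j * t ^ k * s ^ j)"
      if "0 \<le> s" "s \<le> 1" for t s
    proof -
      have "g (t, a + s *\<^sub>R (b - a)) = g (t, a' + (1 - s) *\<^sub>R (b' - a'))"
        using 2 by (simp add: algebra_simps)
      also have "\<dots> = (\<Sum>k\<le>p. t ^ k * (\<Sum>j\<le>p. c k j * (1 - s) ^ j))"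
        using that by (subst c) (auto simp: sum_distrib_left mult_ac)
      also have "\<dots> = (\<Sum>k\<le>p. \<Sum>j\<le>p. d k j * t ^ k * s ^ j)"
        by (simp add: d[rule_format]) (simp add: sum_distrib_left mult_ac)
      finally show ?thesis .
    qed
    then show thesis using that by blast
  qed
qed

lemma face_polys_add:
  assumes "g \<in> face_polys p e" "h \<in> face_polys p e"
  shows "(\<lambda>z. g z + r * h z) \<in> face_polys p e"
proof -
  obtain a b where e: "e = closed_segment a b" using assms(1) by (auto simp: face_polys_def)
  obtain c where c: "\<And>t s. 0 \<le> s \<Longrightarrow> s \<le> 1 \<Longrightarrow>
    g (t, a + s *\<^sub>R (b - a)) = (\<Sum>k\<le>p. \<Sum>j\<le>p. c k j * t ^ k * s ^ j)"
    using face_polys_param[OF assms(1) e] by blast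
  obtain d where d: "\<And>t s. 0 \<le> s \<Longrightarrow> s \<le> 1 \<Longrightarrow>
    h (t, a + s *\<^sub>R (b - a)) = (\<Sum>k\<le>p. \<Sum>j\<le>p. d k j * t ^ k * s ^ j)"
    using face_polys_param[OF assms(2) e] by blast
  show ?thesis unfolding face_polys_def using e c d
    by (intro CollectI exI[of _ a] exI[of _ b] exI[of _ "\<lambda>k j. c k j + r * d k j"])
      (simp add: sum.distrib sum_distrib_left algebra_simps)
qed

lemma face_polys_0: "e = closed_segment a b \<Longrightarrow> (\<lambda>z. 0) \<in> face_polys p e"
  unfolding face_polys_def by (intro CollectI exI[of _ a] exI[of _ b] exI[of _ "\<lambda>k j. 0"]) simp

text \<open>The same root counting on a face. Sample points stay in [0,1] and the conclusion stays
  on \<open>e\<close>, because off the edge a face polynomial is arbitrary.\<close>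

lemma face_polys_eq_0:
  assumes g: "g \<in> face_polys p e" and e: "e = closed_segment a b"
    and St: "infinite St \<or> p < card St"
    and Ss: "\<And>t. t \<in> St \<Longrightarrow> Ss t \<subseteq> {0..1} \<and> (infinite (Ss t) \<or> p < card (Ss t))"
    and 0: "\<And>t s. t \<in> St \<Longrightarrow> s \<in> Ss t \<Longrightarrow> g (t, a + s *\<^sub>R (b - a)) = 0"
    and x: "x \<in> e"
  shows "g (t, x) = 0"
proof -
  obtain c where c: "\<And>t s. 0 \<le> s \<Longrightarrow> s \<le> 1 \<Longrightarrow>
    g (t, a + s *\<^sub>R (b - a)) = (\<Sum>k\<le>p. \<Sum>j\<le>p. c k j * t ^ k * s ^ j)"
    using face_polys_param[OF g e] by blast
  define G where "G t s = (\<Sum>k\<le>p. \<Sum>j\<le>p. c k j * t ^ k * s ^ j)" for t s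
  have "polyfn p (\<lambda>t. c k j * t ^ k * s ^ j)" if "k \<le> p" for k j s
    using polyfn_cmult[OF polyfn_power[OF that], of "c k j * s ^ j"] by (simp add: mult_ac)
  then have 1: "polyfn p (\<lambda>t. G t s)" for s
    unfolding G_def by (intro polyfn_sum) simp
  have "polyfn p (\<lambda>s. (c k j * t ^ k) * s ^ j)" if "j \<le> p" for k j t
    using that by (intro polyfn_cmult polyfn_power)
  then have 2: "polyfn p (G t)" for t
    unfolding G_def by (intro polyfn_sum) auto
  have G0: "G t s = 0" if "t \<in> St" "s \<in> Ss t" for t s
    using 0[OF that] c[of s t] Ss[OF that(1)] that(2) by (auto simp: G_def)
  have 3: "G t s = 0" if "t \<in> St" for t s
    using polyfn_eq_0[OF 2, of "Ss t" t] G0 Ss[OF that] that by (auto simp: fun_eq_iff)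
  have 4: "G t s = 0" for t s
    using polyfn_eq_0[OF 1, of St s] 3 St by (auto simp: fun_eq_iff)
  obtain s where s: "0 \<le> s" "s \<le> 1" "x = a + s *\<^sub>R (b - a)"
    using x unfolding e closed_segment_def by (auto simp: algebra_simps)
  then show ?thesis using c[OF s(1,2), of t] 4 by (simp add: G_def)
qed

lemma face_polys_smooth:
  assumes g: "g \<in> face_polys p e" and e: "e = closed_segment a b" "a \<noteq> b"
  obtains g' where "continuous_on (UNIV \<times> e) g" "continuous_on UNIV g'"
    "\<And>t x. x \<in> e \<Longrightarrow> ((\<lambda>s. g (s, x)) has_real_derivative g' (t, x)) (at t)"
proof -
  obtain c where c: "\<And>t s. 0 \<le> s \<Longrightarrow> s \<le> 1 \<Longrightarrow>
    g (t, a + s *\<^sub>R (b - a)) = (\<Sum>k\<le>p. \<Sum>j\<le>p. c k j * t ^ k * s ^ j)"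
    using face_polys_param[OF g e(1)] by blast
  \<comment> \<open>\<open>\<sigma>\<close> is orthogonal projection onto the line through
    \<open>a\<close> and \<open>b\<close>, scaled to return the parameter s on the edge. It rewrites
    \<open>g\<close> on \<open>e\<close> as an expression that is continuous everywhere.\<close>
  define \<sigma> where "\<sigma> x = (x - a) \<bullet> (b - a) / ((b - a) \<bullet> (b - a))" for x
  have [continuous_intros]: "continuous_on S (\<lambda>z. \<sigma> (snd z))" for S :: "spacetime set"
    unfolding \<sigma>_def using e(2) by (intro continuous_intros) auto
  have gx: "g (t, x) = (\<Sum>k\<le>p. \<Sum>j\<le>p. c k j * t ^ k * \<sigma> x ^ j)" if x: "x \<in> e" for t x
  proof -
    obtain s where s: "0 \<le> s" "s \<le> 1" "x = a + s *\<^sub>R (b - a)"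
      using x unfolding e closed_segment_def by (auto simp: algebra_simps)
    then have "\<sigma> x = s" using e(2) by (simp add: \<sigma>_def)
    then show ?thesis using s c by simp
  qed
  let ?g = "\<lambda>z. \<Sum>k\<le>p. \<Sum>j\<le>p. c k j * (real k * fst z ^ (k - 1)) * \<sigma> (snd z) ^ j"
  show thesis
  proof
    have "continuous_on (UNIV \<times> e) (\<lambda>z. \<Sum>k\<le>p. \<Sum>j\<le>p. c k j * fst z ^ k * \<sigma> (snd z) ^ j)"
      by (intro continuous_intros)
    then show "continuous_on (UNIV \<times> e) g"
      by (rule continuous_on_eq) (auto simp: gx)
    show "continuous_on UNIV ?g" by (intro continuous_intros)
    show "((\<lambda>s. g (s, x)) has_real_derivative ?g (t, x)) (at t)" if "x \<in> e" for t x
      by (auto simp: gx[OF that] intro!: derivative_eq_intros sum.cong)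
  qed
qed

section \<open>Arc length and integration on slabs\<close>

lemma weight_pos: "0 < weight \<alpha> tn t"
  by (simp add: weight_def)

lemma weight_has_derivative: "(weight \<alpha> tn has_real_derivative - \<alpha> * weight \<alpha> tn t) (at t within A)"
  unfolding weight_def by (auto intro!: derivative_eq_intros)

lemma deriv_weight: "deriv (weight \<alpha> tn) t = - \<alpha> * weight \<alpha> tn t"
  by (rule DERIV_imp_deriv) (rule weight_has_derivative)

lemma continuous_on_weight [continuous_intros]:
  "continuous_on A g \<Longrightarrow> continuous_on A (\<lambda>z. weight \<alpha> tn (g z))"
  unfolding weight_def by (intro continuous_intros)

lemma infinite_image_subset: "infinite A \<Longrightarrow> inj_on f A \<Longrightarrow> f ` A \<subseteq> B \<Longrightarrow> infinite B"
  using finite_imageD finite_subset by blast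

text \<open>Finite sets are null, so an almost-everywhere statement supplies enough points for root
  counting.\<close>

lemma infinite_if_AE:
  fixes a b :: real
  assumes "a < b" "AE s in lborel. s \<in> {a<..<b} \<longrightarrow> P s"
  shows "infinite {s \<in> {a<..<b}. P s}"
proof
  assume "finite {s \<in> {a<..<b}. P s}"
  then have "AE s in lborel. s \<notin> {s \<in> {a<..<b}. P s}"
    by (intro AE_not_in finite_imp_null_set_lborel)
  with assms(2) have "AE s in lborel. \<not> s \<in> {a<..<b}" by eventually_elim auto
  then have "emeasure lborel {s \<in> space lborel. s \<in> {a<..<b}} = 0" by (rule emeasure_eq_0_AE)
  also have "{s \<in> space lborel. s \<in> {a<..<b}} = {a<..<b}" by auto
  finally show False using assms(1) by simp
qed

section \<open>Arc length on segments\<close>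

lemma arc_length_obtain:
  obtains a b where "arc_length e = distr (restrict_space lborel {0..dist a b}) borel (\<lambda>s. a + s *\<^sub>R sgn (b - a))"
    "(\<exists>c d. e = closed_segment c d) \<Longrightarrow> e = closed_segment a b"
proof -
  \<comment> \<open>The choice inside \<open>arc_length\<close> is made for every set, returning
    arbitrary points if it is no segment. The measure is an image of Lebesgue measure on a bounded
    interval in any case, so finiteness needs no assumption on \<open>e\<close>.\<close>
  define ab where "ab = (SOME ab. e = closed_segment (fst ab) (snd ab))"
  have "e = closed_segment (fst ab) (snd ab)" if "\<exists>c d. e = closed_segment c d"
    unfolding ab_def using that by (intro someI_ex[of "\<lambda>ab. e = closed_segment (fst ab) (snd ab)"]) auto
  moreover have "arc_length e = distr (restrict_space lborel {0..dist (fst ab) (snd ab)}) borel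
      (\<lambda>s. fst ab + s *\<^sub>R sgn (snd ab - fst ab))"
    unfolding arc_length_def ab_def[symmetric] by (simp add: case_prod_beta)
  ultimately show thesis using that by blast
qed

lemma arc_length_segment:
  assumes "e = closed_segment a b"
  obtains a' b' where "arc_length e = distr (restrict_space lborel {0..dist a' b'}) borel (\<lambda>s. a' + s *\<^sub>R sgn (b' - a'))"
    "e = closed_segment a' b'" "{a', b'} = {a, b}"
proof (rule arc_length_obtain[of e])
  fix c d assume *: "arc_length e = distr (restrict_space lborel {0..dist c d}) borel (\<lambda>s. c + s *\<^sub>R sgn (d - c))"
    "(\<exists>c d. e = closed_segment c d) \<Longrightarrow> e = closed_segment c d"
  have e: "e = closed_segment c d" by (rule *(2)) (use assms in blast)
  have "{c, d} = {a, b}" using e assms closed_segment_eq by metis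
  with *(1) e show thesis by (rule that)
qed

lemma sets_arc_length [simp, measurable_cong]: "sets (arc_length e) = sets borel"
  by (rule arc_length_obtain[of e]) simp

lemma space_arc_length [simp]: "space (arc_length e) = UNIV"
  by (rule arc_length_obtain[of e]) simp

lemma finite_measure_arc_length: "finite_measure (arc_length e)"
proof -
  obtain a b where e: "arc_length e = distr (restrict_space lborel {0..dist a b}) borel (\<lambda>s. a + s *\<^sub>R sgn (b - a))"
    by (rule arc_length_obtain[of e])
  have "finite_measure (restrict_space lborel {0..dist a b})"
    by (intro finite_measureI) (simp add: space_restrict_space emeasure_restrict_space)
  then show ?thesis unfolding e
    by (rule finite_measure.finite_measure_distr) (auto intro!: measurable_restrict_space1)
qed

lemma sigma_finite_arc_length: "sigma_finite_measure (arc_length e)"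
  using finite_measure_arc_length finite_measure.axioms(1) by auto

lemma segment_point:
  fixes a b :: "'a::real_normed_vector"
  shows "0 \<le> s \<Longrightarrow> s \<le> 1 \<Longrightarrow> a + s *\<^sub>R (b - a) \<in> closed_segment a b"
  by (auto simp: in_segment algebra_simps)

lemma scaleR_dist_sgn:
  fixes a b :: "'a::real_normed_vector"
  shows "(dist a b * s) *\<^sub>R sgn (b - a) = s *\<^sub>R (b - a)"
  by (cases "a = b") (simp_all add: sgn_div_norm dist_norm norm_minus_commute)

text \<open>Arc length uses unit speed and an unspecified orientation, face polynomials use [0,1]
  and a given one. Infinitude survives both the rescaling by the length and the reversal s -> 1 -
  s.\<close>

lemma arc_length_AE_infinite:
  assumes e: "e = closed_segment a b" "a \<noteq> b"
    and AE: "AE x in arc_length e. x \<in> e \<longrightarrow> P x"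
  shows "infinite {s \<in> {0..1}. P (a + s *\<^sub>R (b - a))}"
proof -
  obtain a' b' where e': "arc_length e = distr (restrict_space lborel {0..dist a' b'}) borel (\<lambda>s. a' + s *\<^sub>R sgn (b' - a'))"
    "e = closed_segment a' b'" and ab: "{a', b'} = {a, b}"
    by (rule arc_length_segment[OF e(1)])
  then have l: "0 < dist a' b'" using e(2) by (auto simp: doubleton_eq_iff)
  let ?l = "dist a' b'"
  have "AE s in restrict_space lborel {0..?l}. a' + s *\<^sub>R sgn (b' - a') \<in> e \<longrightarrow> P (a' + s *\<^sub>R sgn (b' - a'))"
    using AE unfolding e'(1) by (rule AE_distrD[rotated]) (auto intro!: measurable_restrict_space1)
  then have "AE s in lborel. s \<in> {0..?l} \<longrightarrow> a' + s *\<^sub>R sgn (b' - a') \<in> e \<longrightarrow> P (a' + s *\<^sub>R sgn (b' - a'))"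
    by (subst (asm) AE_restrict_space_iff) auto
  moreover have "a' + s *\<^sub>R sgn (b' - a') \<in> e" if "s \<in> {0<..<?l}" for s
    using segment_point[of "s / ?l" a' b'] that l scaleR_dist_sgn[of a' b' "s / ?l"]
    unfolding e'(2) by simp
  ultimately have "AE s in lborel. s \<in> {0<..<?l} \<longrightarrow> P (a' + s *\<^sub>R sgn (b' - a'))" by auto
  from infinite_if_AE[OF l this] have inf: "infinite {s \<in> {0<..<?l}. P (a' + s *\<^sub>R sgn (b' - a'))}" .
  have "(\<lambda>s. s / ?l) ` {s \<in> {0<..<?l}. P (a' + s *\<^sub>R sgn (b' - a'))} \<subseteq> {s \<in> {0..1}. P (a' + s *\<^sub>R (b' - a'))}"
    using scaleR_dist_sgn[of a' b' "s / ?l" for s] l by (auto simp: dist_commute)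
  then have inf': "infinite {s \<in> {0..1}. P (a' + s *\<^sub>R (b' - a'))}"
    by (rule infinite_image_subset[OF inf, rotated]) (use l in \<open>auto simp: inj_on_def\<close>)
  consider "a' = a" "b' = b" | "a' = b" "b' = a" using ab by (auto simp: doubleton_eq_iff)
  then show ?thesis
  proof cases
    case 1
    then show ?thesis using inf' by simp
  next
    case 2
    have "(\<lambda>s. 1 - s) ` {s \<in> {0..1}. P (b + s *\<^sub>R (a - b))} \<subseteq> {s \<in> {0..1}. P (a + s *\<^sub>R (b - a))}"
    proof safe
      fix s assume "P (b + s *\<^sub>R (a - b))"
      moreover have "b + s *\<^sub>R (a - b) = a + (1 - s) *\<^sub>R (b - a)" by (simp add: algebra_simps)
      ultimately show "P (a + (1 - s) *\<^sub>R (b - a))" by simp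
    qed auto
    then show ?thesis
      by (rule infinite_image_subset[OF inf'[unfolded 2], rotated]) (auto simp: inj_on_def)
  qed
qed

lemma arc_length_integral:
  fixes h :: "plane \<Rightarrow> real"
  assumes e: "e = closed_segment a b" "a \<noteq> b"
    and h: "continuous_on e h"
  shows "(LINT x:e|arc_length e. h x) = dist a b * (LINT s:{0..1}|lborel. h (a + s *\<^sub>R (b - a)))"
proof -
  obtain a' b' where e': "arc_length e = distr (restrict_space lborel {0..dist a' b'}) borel (\<lambda>s. a' + s *\<^sub>R sgn (b' - a'))"
    "e = closed_segment a' b'" and ab: "{a', b'} = {a, b}"
    by (rule arc_length_segment[OF e(1)])
  then have l: "0 < dist a' b'" using e(2) by (auto simp: doubleton_eq_iff)
  let ?l = "dist a' b'"
  have meas: "(\<lambda>x. indicator e x *\<^sub>R h x) \<in> borel_measurable borel"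
    using h e(1) by (intro borel_measurable_continuous_on_indicator) auto
  have "(LINT x:e|arc_length e. h x) =
      (LINT s|restrict_space lborel {0..?l}. indicator e (a' + s *\<^sub>R sgn (b' - a')) *\<^sub>R h (a' + s *\<^sub>R sgn (b' - a')))"
    unfolding set_lebesgue_integral_def e'(1)
    by (rule integral_distr[OF _ meas]) (auto intro!: measurable_restrict_space1)
  also have "\<dots> = (LINT s|lborel. indicator {0..?l} s *\<^sub>R (indicator e (a' + s *\<^sub>R sgn (b' - a')) *\<^sub>R h (a' + s *\<^sub>R sgn (b' - a'))))"
    by (rule integral_restrict_space) auto
  \<comment> \<open>Rescaling the unit-speed parameter to [0,1] produces the length factor.\<close>
  also have "\<dots> = \<bar>?l\<bar> *\<^sub>R (LINT s|lborel. indicator {0..?l} (0 + ?l * s) *\<^sub>R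
      (indicator e (a' + (0 + ?l * s) *\<^sub>R sgn (b' - a')) *\<^sub>R h (a' + (0 + ?l * s) *\<^sub>R sgn (b' - a'))))"
    using l by (intro lborel_integral_real_affine) simp
  also have "\<dots> = ?l * (LINT s:{0..1}|lborel. h (a' + s *\<^sub>R (b' - a')))"
    unfolding set_lebesgue_integral_def
  proof -
    have "indicator {0..?l} (0 + ?l * s) *\<^sub>R
      (indicator e (a' + (0 + ?l * s) *\<^sub>R sgn (b' - a')) *\<^sub>R h (a' + (0 + ?l * s) *\<^sub>R sgn (b' - a'))) =
      indicator {0..1} s *\<^sub>R h (a' + s *\<^sub>R (b' - a'))" for s
    proof (cases "s \<in> {0..1}")
      case True
      then have "?l * s \<in> {0..?l}" "a' + s *\<^sub>R (b' - a') \<in> e"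
        using l segment_point[of s a' b'] by (auto simp: e'(2) mult_left_le)
      then show ?thesis using True by (simp add: scaleR_dist_sgn)
    next
      case False
      then have "?l * s \<notin> {0..?l}" using l by (auto simp: zero_le_mult_iff)
      then show ?thesis using False by simp
    qed
    then show "\<bar>?l\<bar> *\<^sub>R (LINT s|lborel. indicator {0..?l} (0 + ?l * s) *\<^sub>R
      (indicator e (a' + (0 + ?l * s) *\<^sub>R sgn (b' - a')) *\<^sub>R h (a' + (0 + ?l * s) *\<^sub>R sgn (b' - a')))) =
      ?l * (LINT s|lborel. indicator {0..1} s *\<^sub>R h (a' + s *\<^sub>R (b' - a')))"
      by simp
  qed
  finally have 1: "(LINT x:e|arc_length e. h x) = ?l * (LINT s:{0..1}|lborel. h (a' + s *\<^sub>R (b' - a')))" .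
  consider "a' = a" "b' = b" | "a' = b" "b' = a" using ab by (auto simp: doubleton_eq_iff)
  then show ?thesis
  proof cases
    case 2
    \<comment> \<open>If the choice picked the opposite orientation, the substitution s -> 1 - s
      restores the given one.\<close>
    have "(LINT s:{0..1}|lborel. h (b + s *\<^sub>R (a - b))) =
      \<bar>-1\<bar> *\<^sub>R (LINT s|lborel. indicator {0..1} (1 + (-1) * s) *\<^sub>R h (b + (1 + (-1) * s) *\<^sub>R (a - b)))"
      unfolding set_lebesgue_integral_def by (rule lborel_integral_real_affine) simp
    also have "\<dots> = (LINT s:{0..1}|lborel. h (a + s *\<^sub>R (b - a)))"
    proof -
      have "indicator {0..1} (1 + (-1) * s) *\<^sub>R h (b + (1 + (-1) * s) *\<^sub>R (a - b)) =
        indicator {0..1} s *\<^sub>R h (a + s *\<^sub>R (b - a))" for s :: real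
      proof -
        have "b + (1 + (-1) * s) *\<^sub>R (a - b) = a + s *\<^sub>R (b - a)" by (simp add: algebra_simps)
        then show ?thesis by (auto simp: indicator_def)
      qed
      then show ?thesis by (simp add: set_lebesgue_integral_def)
    qed
    finally show ?thesis using 1 2 by (simp add: dist_commute)
  qed (use 1 in simp)
qed

text \<open>Fubini for null sets gives almost every time a section with almost all points as zeros;
  both exceptional sets leave infinitely many parameters.\<close>

lemma face_polys_AE_0:
  assumes g: "g \<in> face_polys p e" and e: "e = closed_segment a b" "a \<noteq> b" and t: "t0 < t1"
    and AE: "AE z in face_measure e. z \<in> {t0<..<t1} \<times> e \<longrightarrow> g z = 0"
    and x: "x \<in> e"
  shows "g (t, x) = 0"
proof -
  let ?P = "\<lambda>t. AE x in arc_length e. x \<in> e \<longrightarrow> g (t, x) = 0"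
  have "AE t in lborel. AE x in arc_length e. (t, x) \<in> {t0<..<t1} \<times> e \<longrightarrow> g (t, x) = 0"
    using AE unfolding face_measure_def
    by (rule pair_sigma_finite.AE_pair[OF pair_sigma_finite.intro[OF lborel.sigma_finite_measure_axioms sigma_finite_arc_length]])
  then have "AE t in lborel. t \<in> {t0<..<t1} \<longrightarrow> ?P t" by eventually_elim auto
  from infinite_if_AE[OF t this] have inf: "infinite {t \<in> {t0<..<t1}. ?P t}" .
  show ?thesis
  proof (rule face_polys_eq_0[OF g e(1) disjI1[OF inf] _ _ x])
    let ?Ss = "\<lambda>t. {s \<in> {0..1}. g (t, a + s *\<^sub>R (b - a)) = 0}"
    show "?Ss t \<subseteq> {0..1} \<and> (infinite (?Ss t) \<or> p < card (?Ss t))"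
      if "t \<in> {t \<in> {t0<..<t1}. ?P t}" for t
      using arc_length_AE_infinite[OF e, of "\<lambda>x. g (t, x) = 0"] that by auto
    show "g (t, a + s *\<^sub>R (b - a)) = 0" if "s \<in> ?Ss t" for t s using that by simp
  qed
qed

text \<open>A box inside \<open>U\<close> lets Fubini be applied twice, so that zeros occur for
  almost every t, then x, then y. The conclusion holds on all of space-time, hence makes polynomial
  representatives unique.\<close>

lemma element_polys_AE_0:
  assumes g: "g \<in> element_polys p" and U: "open U" "U \<noteq> {}" and t: "t0 < t1"
    and AE: "AE z in lborel. z \<in> {t0<..<t1} \<times> U \<longrightarrow> g z = 0"
  shows "g z = 0"
proof -
  obtain u where u: "u \<in> U" using U(2) by blast
  obtain c d where cd: "box c d \<subseteq> U" "u \<in> box c d"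
    using open_contains_box[OF U(1) u] by metis
  obtain c1 c2 d1 d2 where c: "c = (c1, c2)" "d = (d1, d2)" by (cases c, cases d) auto
  have box: "box c d = {c1<..<d1} \<times> {c2<..<d2}"
    unfolding c by (auto simp: box_def Basis_prod_def)
  then have lt: "c1 < d1" "c2 < d2" using cd(2) by auto
  let ?Q = "\<lambda>t x. AE y in lborel. y \<in> {c2<..<d2} \<longrightarrow> g (t, x, y) = 0"
  let ?P = "\<lambda>t. AE x in lborel. x \<in> {c1<..<d1} \<longrightarrow> ?Q t x"
  let ?B = "{t0<..<t1} \<times> {c1<..<d1} \<times> {c2<..<d2}"
  have sub: "?B \<subseteq> {t0<..<t1} \<times> U" using cd(1) unfolding box by auto
  have pair: "AE w in lborel \<Otimes>\<^sub>M lborel. Q w" if "AE w in lborel. Q w" for Q :: "real \<times> real \<Rightarrow> bool"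
    using that unfolding lborel_prod .
  have "AE z in (lborel :: real measure) \<Otimes>\<^sub>M (lborel :: plane measure). z \<in> ?B \<longrightarrow> g z = 0"
    unfolding lborel_prod using AE by (rule eventually_mono) (use sub in auto)
  then have "AE t in lborel. AE w in lborel. (t, w) \<in> ?B \<longrightarrow> g (t, w) = 0"
    by (rule pair_sigma_finite.AE_pair[OF pair_sigma_finite.intro[OF
          lborel.sigma_finite_measure_axioms lborel.sigma_finite_measure_axioms]])
  moreover have sect: "AE x in lborel. AE y in lborel. (t, x, y) \<in> ?B \<longrightarrow> g (t, x, y) = 0"
    if "AE w in lborel. (t, w) \<in> ?B \<longrightarrow> g (t, w) = 0" for t
    using lborel_pair.AE_pair[OF pair[OF that]] by simp
  ultimately have AE3: "AE t in lborel. AE x in lborel. AE y in lborel. (t, x, y) \<in> ?B \<longrightarrow> g (t, x, y) = 0"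
    by (rule eventually_mono)
  have P: "?P t" if t: "t \<in> {t0<..<t1}" and "AE x in lborel. AE y in lborel. (t, x, y) \<in> ?B \<longrightarrow> g (t, x, y) = 0" for t
    using that(2)
  proof (rule eventually_mono, intro impI)
    fix x assume x: "x \<in> {c1<..<d1}" and "AE y in lborel. (t, x, y) \<in> ?B \<longrightarrow> g (t, x, y) = 0"
    from this(2) show "?Q t x" by (rule eventually_mono) (use t x in simp)
  qed
  have "AE t in lborel. t \<in> {t0<..<t1} \<longrightarrow> ?P t"
    using AE3 by (rule eventually_mono) (rule impI, rule P)
  from infinite_if_AE[OF t this] have 1: "infinite {t \<in> {t0<..<t1}. ?P t}" .
  have 2: "infinite {x \<in> {c1<..<d1}. ?Q t x}" if "t \<in> {t \<in> {t0<..<t1}. ?P t}" for t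
    by (rule infinite_if_AE[OF lt(1)]) (use that in simp)
  have 3: "infinite {y \<in> {c2<..<d2}. g (t, x, y) = 0}" if "x \<in> {x \<in> {c1<..<d1}. ?Q t x}" for t x
    by (rule infinite_if_AE[OF lt(2)]) (use that in simp)
  show ?thesis
  proof (rule element_polys_eq_0[OF g, where St = "{t \<in> {t0<..<t1}. ?P t}"
          and Sx = "\<lambda>t. {x \<in> {c1<..<d1}. ?Q t x}" and Sy = "\<lambda>t x. {y \<in> {c2<..<d2}. g (t, x, y) = 0}"])
    show "infinite {t \<in> {t0<..<t1}. ?P t} \<or> p < card {t \<in> {t0<..<t1}. ?P t}" using 1 by (rule disjI1)
    show "infinite {x \<in> {c1<..<d1}. ?Q t x} \<or> p < card {x \<in> {c1<..<d1}. ?Q t x}"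
      if "t \<in> {t \<in> {t0<..<t1}. ?P t}" for t using 2[OF that] by (rule disjI1)
    show "infinite {y \<in> {c2<..<d2}. g (t, x, y) = 0} \<or> p < card {y \<in> {c2<..<d2}. g (t, x, y) = 0}"
      if "t \<in> {t \<in> {t0<..<t1}. ?P t}" "x \<in> {x \<in> {c1<..<d1}. ?Q t x}" for t x
      using 3[OF that(2)] by (rule disjI1)
  qed blast
qed


text \<open>Compactness of \<open>C\<close> bounds \<open>g\<close>. Since \<open>g\<close> may be
  wild outside \<open>C\<close>, measurability is obtained from its product with the indicator of
  \<open>C\<close>.\<close>

lemma set_integrable_bounded_continuous:
  fixes g :: "'a::second_countable_topology \<Rightarrow> real"
  assumes M: "sets M = sets borel" and S: "S \<in> sets borel" "emeasure M S < \<infinity>"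
    and C: "compact C" "closed C" "S \<subseteq> C" and g: "continuous_on C g"
  shows "set_integrable M S g"
proof -
  obtain B where B: "\<And>x. x \<in> C \<Longrightarrow> norm (g x) \<le> B"
    using compact_imp_bounded[OF compact_continuous_image[OF g C(1)]] by (auto simp: bounded_iff)
  have "(\<lambda>x. indicator C x *\<^sub>R g x) \<in> borel_measurable borel"
    using C(2) g by (intro borel_measurable_continuous_on_indicator borel_closed)
  then have "(\<lambda>x. indicator C x *\<^sub>R g x) \<in> borel_measurable M"
    using M by (simp cong: measurable_cong_sets)
  then have "integrable M (\<lambda>x. indicator S x *\<^sub>R (indicator C x *\<^sub>R g x))"
    using S M B C(3) by (intro integrableI_bounded_set_indicator[where B = B] AE_I2) auto
  moreover have "(\<lambda>x. indicator S x *\<^sub>R (indicator C x *\<^sub>R g x)) = (\<lambda>x. indicator S x *\<^sub>R g x)"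
    using C(3) by (auto simp: indicator_def fun_eq_iff)
  ultimately show ?thesis by (simp add: set_integrable_def)
qed

text \<open>In the applications S is the interior of a mesh element or a mesh edge and C is its
  closure.\<close>

locale slab =
  fixes M :: "plane measure" and S C :: "plane set" and t0 t1 :: real
  assumes sets_M [simp, measurable_cong]: "sets M = sets borel"
    and sigma_finite_M: "sigma_finite_measure M"
    and S_borel [measurable]: "S \<in> sets borel" and emeasure_S: "emeasure M S < \<infinity>"
    and compact_C: "compact C" and S_sub_C: "S \<subseteq> C" and t01: "t0 < t1"
begin

sublocale pair_sigma_finite lborel M
  by (intro pair_sigma_finite.intro lborel.sigma_finite_measure_axioms sigma_finite_M)

lemma set_integrable_slab:
  assumes "continuous_on (UNIV \<times> C) (g :: spacetime \<Rightarrow> real)"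
  shows "set_integrable (lborel \<Otimes>\<^sub>M M) ({t0<..<t1} \<times> S) g"
proof (rule set_integrable_bounded_continuous)
  have "sets (lborel \<Otimes>\<^sub>M M) = sets (borel \<Otimes>\<^sub>M borel)" by (intro sets_pair_measure_cong) auto
  then show "sets (lborel \<Otimes>\<^sub>M M) = sets (borel :: spacetime measure)" unfolding borel_prod .
  show "{t0<..<t1} \<times> S \<in> sets borel"
    using pair_measureI[of "{t0<..<t1}" borel S borel] unfolding borel_prod by simp
  have "emeasure (lborel \<Otimes>\<^sub>M M) ({t0<..<t1} \<times> S) = emeasure lborel {t0<..<t1} * emeasure M S"
    by (intro M2.emeasure_pair_measure_Times) auto
  then show "emeasure (lborel \<Otimes>\<^sub>M M) ({t0<..<t1} \<times> S) < \<infinity>"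
    using emeasure_S t01 by (simp add: ennreal_mult_less_top)
  show "compact ({t0..t1} \<times> C)" "closed ({t0..t1} \<times> C)"
    using compact_C by (auto intro: compact_Times closed_Times compact_imp_closed)
  show "{t0<..<t1} \<times> S \<subseteq> {t0..t1} \<times> C" using S_sub_C by auto
  show "continuous_on ({t0..t1} \<times> C) g" using assms by (rule continuous_on_subset) auto
qed

lemma set_integrable_section:
  assumes "continuous_on C (h :: plane \<Rightarrow> real)"
  shows "set_integrable M S h"
  using compact_imp_closed[OF compact_C] emeasure_S compact_C S_sub_C assms
  by (intro set_integrable_bounded_continuous) auto

text \<open>Both orders are needed: time innermost for integration by parts in time, space innermost
  for the divergence theorem at a fixed time.\<close>

lemma slab_Fubini:
  assumes g: "continuous_on (UNIV \<times> C) (g :: spacetime \<Rightarrow> real)"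
  shows "(LINT z:{t0<..<t1} \<times> S|lborel \<Otimes>\<^sub>M M. g z) = (LINT x:S|M. LINT t:{t0<..<t1}|lborel. g (t, x))"
    and "(LINT z:{t0<..<t1} \<times> S|lborel \<Otimes>\<^sub>M M. g z) = (LINT t:{t0<..<t1}|lborel. LINT x:S|M. g (t, x))"
    and "set_integrable lborel {t0<..<t1} (\<lambda>t. LINT x:S|M. g (t, x))"
proof -
  let ?g = "\<lambda>z. indicator ({t0<..<t1} \<times> S) z *\<^sub>R g z"
  have int: "integrable (lborel \<Otimes>\<^sub>M M) ?g"
    using set_integrable_slab[OF g] by (simp add: set_integrable_def)
  have "(LINT z:{t0<..<t1} \<times> S|lborel \<Otimes>\<^sub>M M. g z) = (LINT x|M. LINT t|lborel. ?g (t, x))"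
    unfolding set_lebesgue_integral_def
    using integral_snd[of "\<lambda>t x. ?g (t, x)"] int unfolding case_prod_eta[of ?g] by simp
  also have "\<dots> = (LINT x:S|M. LINT t:{t0<..<t1}|lborel. g (t, x))"
    unfolding set_lebesgue_integral_def
    by (intro Bochner_Integration.integral_cong refl) (simp add: indicator_times mult_ac)
  finally show "(LINT z:{t0<..<t1} \<times> S|lborel \<Otimes>\<^sub>M M. g z) = (LINT x:S|M. LINT t:{t0<..<t1}|lborel. g (t, x))" .
  have sect: "(LINT x|M. ?g (t, x)) = indicator {t0<..<t1} t *\<^sub>R (LINT x:S|M. g (t, x))" for t
    unfolding set_lebesgue_integral_def by (simp add: indicator_times mult.assoc)
  show "set_integrable lborel {t0<..<t1} (\<lambda>t. LINT x:S|M. g (t, x))"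
    using integrable_fst'[OF int] unfolding sect set_integrable_def .
  have "(LINT z:{t0<..<t1} \<times> S|lborel \<Otimes>\<^sub>M M. g z) = (LINT t|lborel. LINT x|M. ?g (t, x))"
    unfolding set_lebesgue_integral_def using integral_fst'[OF int] by simp
  also have "\<dots> = (LINT t:{t0<..<t1}|lborel. LINT x:S|M. g (t, x))"
    unfolding set_lebesgue_integral_def
    by (intro Bochner_Integration.integral_cong refl) (simp add: indicator_times mult.assoc)
  finally show "(LINT z:{t0<..<t1} \<times> S|lborel \<Otimes>\<^sub>M M. g z) = (LINT t:{t0<..<t1}|lborel. LINT x:S|M. g (t, x))" .
qed

lemma AE_0_if_integral_0:
  assumes g: "continuous_on (UNIV \<times> C) (g :: spacetime \<Rightarrow> real)" "\<And>z. z \<in> {t0<..<t1} \<times> S \<Longrightarrow> 0 \<le> g z"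
    and 0: "(LINT z:{t0<..<t1} \<times> S|lborel \<Otimes>\<^sub>M M. g z) = 0"
  shows "AE z in lborel \<Otimes>\<^sub>M M. z \<in> {t0<..<t1} \<times> S \<longrightarrow> g z = 0"
proof -
  let ?g = "\<lambda>z. indicator ({t0<..<t1} \<times> S) z *\<^sub>R g z"
  have "integrable (lborel \<Otimes>\<^sub>M M) ?g"
    using set_integrable_slab[OF g(1)] by (simp add: set_integrable_def)
  moreover have "AE z in lborel \<Otimes>\<^sub>M M. 0 \<le> ?g z"
    using g(2) by (intro AE_I2) (auto simp: indicator_def)
  ultimately have "AE z in lborel \<Otimes>\<^sub>M M. ?g z = 0"
    using 0 integral_nonneg_eq_0_iff_AE[of "lborel \<Otimes>\<^sub>M M" ?g] by (simp add: set_lebesgue_integral_def)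
  then show ?thesis by eventually_elim auto
qed

text \<open>The time terms are coercive because the weight decreases:
  \<open>f h h' + f' h\<^sup>2 / 2\<close> is the time derivative of \<open>f h\<^sup>2 / 2\<close>.\<close>

lemma time_energy:
  fixes h h' :: "spacetime \<Rightarrow> real"
  assumes h: "continuous_on (UNIV \<times> C) h" and h': "continuous_on (UNIV \<times> C) h'"
    and deriv: "\<And>t x. x \<in> S \<Longrightarrow> ((\<lambda>s. h (s, x)) has_real_derivative h' (t, x)) (at t)"
  shows "\<alpha> / 2 * (LINT z:{t0<..<t1} \<times> S|lborel \<Otimes>\<^sub>M M. weight \<alpha> t0 (fst z) * (h z)\<^sup>2)
    \<le> - (LINT z:{t0<..<t1} \<times> S|lborel \<Otimes>\<^sub>M M. h z * (weight \<alpha> t0 (fst z) * h' z))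
       - (LINT z:{t0<..<t1} \<times> S|lborel \<Otimes>\<^sub>M M. h z * (deriv (weight \<alpha> t0) (fst z) * h z))
       + (LINT x:S|M. h (t1, x) * (weight \<alpha> t0 t1 * h (t1, x)))"
proof -
  let ?P = "lborel \<Otimes>\<^sub>M M" and ?I = "{t0<..<t1} \<times> S" and ?f = "\<lambda>z. weight \<alpha> t0 (fst z)"
  \<comment> \<open>\<open>D\<close> is the time derivative of f h^2 / 2, because f' = - \<alpha>
    f.\<close>
  define D where "D z = h z * (?f z * h' z) - \<alpha> / 2 * (?f z * (h z)\<^sup>2)" for z
  have contD: "continuous_on (UNIV \<times> C) D"
    unfolding D_def using h h' by (intro continuous_intros)
  have "(LINT t:{t0<..<t1}|lborel. D (t, x)) = weight \<alpha> t0 t1 * (h (t1, x))\<^sup>2 / 2 - weight \<alpha> t0 t0 * (h (t0, x))\<^sup>2 / 2"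
    if x: "x \<in> S" for x
  proof -
    have xC: "x \<in> C" using x S_sub_C by auto
    let ?F = "\<lambda>t. weight \<alpha> t0 t * (h (t, x) * h (t, x)) / 2"
    have cont: "continuous_on UNIV (\<lambda>t. D (t, x))"
      by (rule continuous_on_compose2[OF contD]) (use xC in \<open>auto intro!: continuous_intros\<close>)
    have der: "(?F has_real_derivative D (t, x)) (at t)" for t
      by (rule derivative_eq_intros deriv[OF x] weight_has_derivative refl)+
        (auto simp: D_def field_simps power2_eq_square)
    have "(LINT t:{t0<..<t1}|lborel. D (t, x)) = (LINT t:{t0..t1}|lborel. D (t, x))"
    proof (rule set_integral_cong_set)
      show "set_borel_measurable lborel {t0..t1} (\<lambda>t. D (t, x))" "set_borel_measurable lborel {t0<..<t1} (\<lambda>t. D (t, x))"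
        unfolding set_borel_measurable_def
        using borel_measurable_continuous_onI[OF cont] by (auto intro!: borel_measurable_scaleR)
      show "AE t in lborel. (t \<in> {t0..t1}) = (t \<in> {t0<..<t1})"
        using AE_lborel_singleton[of t0] AE_lborel_singleton[of t1] by eventually_elim auto
    qed
    also have "\<dots> = ?F t1 - ?F t0"
      unfolding set_lebesgue_integral_def
    proof (rule integral_FTC_Icc)
      show "t0 \<le> t1" using t01 by simp
      show "(?F has_vector_derivative D (t, x)) (at t within {t0..t1})" for t
        using der[of t] by (auto simp: has_real_derivative_iff_has_vector_derivative[symmetric] intro: DERIV_subset)
      show "continuous_on {t0..t1} (\<lambda>t. D (t, x))" using cont by (rule continuous_on_subset) simp
    qed
    finally show ?thesis by (simp add: power2_eq_square)
  qed
  then have "(LINT z:?I|?P. D z) = (LINT x:S|M. weight \<alpha> t0 t1 * (h (t1, x))\<^sup>2 / 2 - weight \<alpha> t0 t0 * (h (t0, x))\<^sup>2 / 2)"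
    unfolding slab_Fubini(1)[OF contD] by (intro set_lebesgue_integral_cong) auto
  \<comment> \<open>The square at \<open>t0\<close> enters with a minus sign and is dropped; half of
    the square at \<open>t1\<close> is bounded by the whole.\<close>
  also have "\<dots> \<le> (LINT x:S|M. h (t1, x) * (weight \<alpha> t0 t1 * h (t1, x)))"
    unfolding set_lebesgue_integral_def
  proof (rule integral_mono)
    have c: "continuous_on C (\<lambda>x. h (t, x))" for t
      by (rule continuous_on_compose2[OF h]) (auto intro!: continuous_intros)
    show "integrable M (\<lambda>x. indicator S x *\<^sub>R (weight \<alpha> t0 t1 * (h (t1, x))\<^sup>2 / 2 - weight \<alpha> t0 t0 * (h (t0, x))\<^sup>2 / 2))"
      "integrable M (\<lambda>x. indicator S x *\<^sub>R (h (t1, x) * (weight \<alpha> t0 t1 * h (t1, x))))"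
      by (fold set_integrable_def; rule set_integrable_section; intro continuous_intros c; simp)+
    fix x
    have "weight \<alpha> t0 t1 * (h (t1, x))\<^sup>2 / 2 - weight \<alpha> t0 t0 * (h (t0, x))\<^sup>2 / 2 \<le> weight \<alpha> t0 t1 * (h (t1, x))\<^sup>2 / 2"
      using weight_pos[of \<alpha> t0 t0] by simp
    also have "\<dots> \<le> h (t1, x) * (weight \<alpha> t0 t1 * h (t1, x))"
      using weight_pos[of \<alpha> t0 t1] by (simp add: power2_eq_square mult_ac)
    finally show "indicator S x *\<^sub>R (weight \<alpha> t0 t1 * (h (t1, x))\<^sup>2 / 2 - weight \<alpha> t0 t0 * (h (t0, x))\<^sup>2 / 2)
        \<le> indicator S x *\<^sub>R (h (t1, x) * (weight \<alpha> t0 t1 * h (t1, x)))"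
      by (auto simp: indicator_def)
  qed
  finally have le: "(LINT z:?I|?P. D z) \<le> (LINT x:S|M. h (t1, x) * (weight \<alpha> t0 t1 * h (t1, x)))" .
  \<comment> \<open>The term with f' contributes + \<alpha> times the integral of f h^2. Half of it
    is spent on completing \<open>D\<close>, and the other half is the lower bound.\<close>
  have "(LINT z:?I|?P. D z) = (LINT z:?I|?P. h z * (?f z * h' z)) - (LINT z:?I|?P. \<alpha> / 2 * (?f z * (h z)\<^sup>2))"
    unfolding D_def by (rule set_integral_diff(2); rule set_integrable_slab; intro continuous_intros h h')
  moreover have "(LINT z:?I|?P. h z * (deriv (weight \<alpha> t0) (fst z) * h z)) = - \<alpha> * (LINT z:?I|?P. ?f z * (h z)\<^sup>2)"
    by (subst set_integral_mult_right[symmetric]) (simp add: deriv_weight power2_eq_square mult_ac)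
  moreover have "(LINT z:?I|?P. \<alpha> / 2 * (?f z * (h z)\<^sup>2)) = \<alpha> / 2 * (LINT z:?I|?P. ?f z * (h z)\<^sup>2)"
    by (rule set_integral_mult_right)
  ultimately show ?thesis using le by (simp add: field_simps)
qed

end

section \<open>The divergence theorem on a triangle\<close>

text \<open>The affine change of variables is split into two one-dimensional ones.
  \<open>T x\<close> is the height at abscissa x of the line through (a1, a2) in direction (u1, u2),
  and \<open>c\<close> is the vertical shift of that line per unit of r; so y = T x + c r first, and
  x = a1 + r w1 + u1 s afterwards.\<close>

lemma lborel_integral_parallelogram_aux:
  fixes F :: "plane \<Rightarrow> real"
  assumes F: "integrable lborel F" and u1: "u1 \<noteq> 0" and d: "u1 * w2 - u2 * w1 \<noteq> 0"
  shows "(LINT z|lborel. F z) = \<bar>u1 * w2 - u2 * w1\<bar> *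
    (LINT r|lborel. LINT s|lborel. F (a1 + s * u1 + r * w1, a2 + s * u2 + r * w2))"
proof -
  define c where "c = (u1 * w2 - u2 * w1) / u1"
  define T where "T x = a2 + (x - a1) * u2 / u1" for x
  have c: "c \<noteq> 0" using u1 d by (simp add: c_def)
  have F': "integrable (lborel \<Otimes>\<^sub>M lborel) F" using F unfolding lborel_prod .
  have [measurable]: "F \<in> borel_measurable borel" using F by simp
  have [measurable]: "F \<in> borel_measurable (lborel \<Otimes>\<^sub>M lborel)" using F' by simp
  define G where "G z = F (fst z, T (fst z) + c * snd z)" for z
  have [measurable]: "G \<in> borel_measurable borel"
    unfolding G_def T_def by (intro measurable_compose[OF _ \<open>F \<in> borel_measurable borel\<close>]
        borel_measurable_continuous_onI continuous_intros) (use u1 in auto)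
  then have [measurable]: "G \<in> borel_measurable (lborel \<Otimes>\<^sub>M lborel)" by (simp add: lborel_prod)
  \<comment> \<open>Exchanging the order of integration after the first substitution requires
    \<open>G\<close> to be integrable, which Tonelli derives from the integrability of
    \<open>F\<close>.\<close>
  have "(\<integral>\<^sup>+z. ennreal (norm (F z)) \<partial>(lborel \<Otimes>\<^sub>M lborel)) = (\<integral>\<^sup>+x. \<integral>\<^sup>+y. ennreal (norm (F (x, y))) \<partial>lborel \<partial>lborel)"
    by (subst lborel.nn_integral_fst[symmetric]) auto
  also have "\<dots> = (\<integral>\<^sup>+x. ennreal \<bar>c\<bar> * (\<integral>\<^sup>+r. ennreal (norm (G (x, r))) \<partial>lborel) \<partial>lborel)"
  proof (rule nn_integral_cong)
    fix x
    show "(\<integral>\<^sup>+y. ennreal (norm (F (x, y))) \<partial>lborel) = ennreal \<bar>c\<bar> * (\<integral>\<^sup>+r. ennreal (norm (G (x, r))) \<partial>lborel)"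
      using nn_integral_real_affine[of "\<lambda>y. ennreal (norm (F (x, y)))" c "T x"] c by (simp add: G_def)
  qed
  also have "\<dots> = ennreal \<bar>c\<bar> * (\<integral>\<^sup>+x. (\<integral>\<^sup>+r. ennreal (norm (G (x, r))) \<partial>lborel) \<partial>lborel)"
    by (rule nn_integral_cmult) measurable
  also have "\<dots> = ennreal \<bar>c\<bar> * (\<integral>\<^sup>+z. ennreal (norm (G z)) \<partial>(lborel \<Otimes>\<^sub>M lborel))"
    by (subst lborel.nn_integral_fst[symmetric]) auto
  finally have "ennreal \<bar>c\<bar> * (\<integral>\<^sup>+z. ennreal (norm (G z)) \<partial>(lborel \<Otimes>\<^sub>M lborel)) < \<infinity>"
    using F' by (simp add: integrable_iff_bounded)
  then have "(\<integral>\<^sup>+z. ennreal (norm (G z)) \<partial>(lborel \<Otimes>\<^sub>M lborel)) < \<infinity>"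
    using c by (auto simp: ennreal_mult_less_top)
  then have G: "integrable (lborel \<Otimes>\<^sub>M lborel) G"
    by (intro integrableI_bounded) (auto simp: lborel_prod)
  have "(LINT z|lborel. F z) = (LINT x|lborel. LINT y|lborel. F (x, y))"
    using lborel_pair.integral_fst'[OF F'] unfolding lborel_prod by simp
  also have "\<dots> = (LINT x|lborel. \<bar>c\<bar> * (LINT r|lborel. G (x, r)))"
  proof (rule Bochner_Integration.integral_cong[OF refl])
    fix x
    show "(LINT y|lborel. F (x, y)) = \<bar>c\<bar> * (LINT r|lborel. G (x, r))"
      using lborel_integral_real_affine[of c "\<lambda>y. F (x, y)" "T x"] c by (simp add: G_def)
  qed
  also have "\<dots> = \<bar>c\<bar> * (LINT x|lborel. LINT r|lborel. G (x, r))"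
    by simp
  also have "(LINT x|lborel. LINT r|lborel. G (x, r)) = (LINT r|lborel. LINT x|lborel. G (x, r))"
    using lborel_pair.Fubini_integral[of "\<lambda>x r. G (x, r)"] G by simp
  also have "\<dots> = (LINT r|lborel. \<bar>u1\<bar> * (LINT s|lborel. F (a1 + s * u1 + r * w1, a2 + s * u2 + r * w2)))"
  proof (rule Bochner_Integration.integral_cong[OF refl])
    fix r
    have "(LINT x|lborel. G (x, r)) = \<bar>u1\<bar> *\<^sub>R (LINT s|lborel. G ((a1 + r * w1) + u1 * s, r))"
      using u1 by (rule lborel_integral_real_affine)
    also have "(\<lambda>s. G ((a1 + r * w1) + u1 * s, r)) = (\<lambda>s. F (a1 + s * u1 + r * w1, a2 + s * u2 + r * w2))"
    proof
      fix s
      have "T (a1 + r * w1 + u1 * s) + c * r = a2 + s * u2 + r * w2"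
        using u1 by (simp add: T_def c_def field_simps)
      then show "G ((a1 + r * w1) + u1 * s, r) = F (a1 + s * u1 + r * w1, a2 + s * u2 + r * w2)"
        by (simp add: G_def algebra_simps)
    qed
    finally show "(LINT x|lborel. G (x, r)) = \<bar>u1\<bar> * (LINT s|lborel. F (a1 + s * u1 + r * w1, a2 + s * u2 + r * w2))"
      by simp
  qed
  also have "\<bar>c\<bar> * \<dots> = \<bar>u1 * w2 - u2 * w1\<bar> * (LINT r|lborel. LINT s|lborel. F (a1 + s * u1 + r * w1, a2 + s * u2 + r * w2))"
    using u1 by (simp add: c_def)
  finally show ?thesis .
qed

definition cross :: "plane \<Rightarrow> plane \<Rightarrow> real" where
  "cross u w = fst u * snd w - snd u * fst w"

lemma parallel_if_cross_0:
  assumes "cross u w = 0" "u \<noteq> 0"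
  shows "w = ((u \<bullet> w) / (u \<bullet> u)) *\<^sub>R u"
proof -
  have c: "fst u * snd w = snd u * fst w" using assms(1) by (simp add: cross_def)
  have "(u \<bullet> u) *\<^sub>R w = (u \<bullet> w) *\<^sub>R u"
  proof (rule prod_eqI)
    have "fst ((u \<bullet> u) *\<^sub>R w) - fst ((u \<bullet> w) *\<^sub>R u) = snd u * (snd u * fst w - fst u * snd w)"
      by (simp add: inner_prod_def algebra_simps)
    then show "fst ((u \<bullet> u) *\<^sub>R w) = fst ((u \<bullet> w) *\<^sub>R u)" using c by simp
    have "snd ((u \<bullet> u) *\<^sub>R w) - snd ((u \<bullet> w) *\<^sub>R u) = fst u * (fst u * snd w - snd u * fst w)"
      by (simp add: inner_prod_def algebra_simps)
    then show "snd ((u \<bullet> u) *\<^sub>R w) = snd ((u \<bullet> w) *\<^sub>R u)" using c by simp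
  qed
  then have "(1 / (u \<bullet> u)) *\<^sub>R ((u \<bullet> u) *\<^sub>R w) = (1 / (u \<bullet> u)) *\<^sub>R ((u \<bullet> w) *\<^sub>R u)" by simp
  then show ?thesis using assms(2) by simp
qed

lemma lborel_integral_parallelogram:
  fixes F :: "plane \<Rightarrow> real"
  assumes F: "integrable lborel F" and d: "cross u w \<noteq> 0"
  shows "(LINT z|lborel. F z) = \<bar>cross u w\<bar> * (LINT r|lborel. LINT s|lborel. F (A + s *\<^sub>R u + r *\<^sub>R w))"
proof (cases "fst u = 0")
  case False
  then show ?thesis
    using lborel_integral_parallelogram_aux[OF F, of "fst u" "snd w" "snd u" "fst w" "fst A" "snd A"] d
    by (cases A, cases u, cases w) (simp add: cross_def)
next
  \<comment> \<open>For vertical \<open>u\<close> the two coordinates are exchanged; the determinant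
    only changes its sign.\<close>
  case True
  then have u2: "snd u \<noteq> 0" using d by (simp add: cross_def)
  have F': "integrable (lborel \<Otimes>\<^sub>M lborel) F" using F unfolding lborel_prod .
  have "integrable (lborel \<Otimes>\<^sub>M lborel) (\<lambda>(x, y). F (y, x))"
    using lborel_pair.integrable_product_swap[OF F'] .
  then have sw: "integrable lborel (\<lambda>(x, y). F (y, x))" unfolding lborel_prod .
  have "(LINT z|lborel. F z) = (LINT z|lborel. (case z of (x, y) \<Rightarrow> F (y, x)))"
    using lborel_pair.integral_product_swap[of F] F' unfolding lborel_prod by auto
  also have "\<dots> = \<bar>cross u w\<bar> * (LINT r|lborel. LINT s|lborel. F (A + s *\<^sub>R u + r *\<^sub>R w))"
    using lborel_integral_parallelogram_aux[OF sw u2, of "fst w" "fst u" "snd w" "snd A" "fst A"] d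
    by (cases A, cases u, cases w) (simp add: cross_def abs_minus_commute mult.commute)
  finally show ?thesis .
qed

locale triangle =
  fixes A B C :: plane and K :: "plane set"
  assumes cross_nz: "cross (B - A) (C - A) \<noteq> 0" and K_def: "K = convex hull {A, B, C}"
begin

text \<open>No orientation is fixed in the locale, so every relabelling of the vertices is again an
  instance. Facts about the edge opposite \<open>A\<close> thereby transfer to the other
  edges.\<close>

lemma swap: "triangle A C B K"
  using cross_nz by unfold_locales (simp_all add: K_def insert_commute cross_def algebra_simps)

lemma rotate: "triangle B C A K"
  using cross_nz by unfold_locales (simp_all add: K_def insert_commute cross_def algebra_simps)

lemma distinct_vertices: "A \<noteq> B" "B \<noteq> C" "A \<noteq> C"
  using cross_nz by (auto simp: cross_def)

lemma compact_K: "compact K"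
  unfolding K_def by (simp add: finite_imp_compact_convex_hull)

lemma convex_K: "convex K"
  unfolding K_def by simp

lemma coordinates_unique:
  assumes "s *\<^sub>R (B - A) + r *\<^sub>R (C - A) = s' *\<^sub>R (B - A) + r' *\<^sub>R (C - A)"
  shows "s = s'" "r = r'"
proof -
  define x where "x = (s - s') *\<^sub>R (B - A) + (r - r') *\<^sub>R (C - A)"
  have "x = 0" using assms by (simp add: x_def algebra_simps)
  moreover have "cross x (C - A) = (s - s') * cross (B - A) (C - A)"
    "cross (B - A) x = (r - r') * cross (B - A) (C - A)"
    by (simp_all add: x_def cross_def algebra_simps)
  ultimately have "(s - s') * cross (B - A) (C - A) = 0" "(r - r') * cross (B - A) (C - A) = 0"
    by (simp_all add: cross_def)
  then show "s = s'" "r = r'" using cross_nz by simp_all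
qed

lemma in_K_iff: "A + s *\<^sub>R (B - A) + r *\<^sub>R (C - A) \<in> K \<longleftrightarrow> 0 \<le> s \<and> 0 \<le> r \<and> s + r \<le> 1"
proof
  assume "A + s *\<^sub>R (B - A) + r *\<^sub>R (C - A) \<in> K"
  then obtain u v where uv: "A + s *\<^sub>R (B - A) + r *\<^sub>R (C - A) = A + u *\<^sub>R (B - A) + v *\<^sub>R (C - A)"
    "0 \<le> u" "0 \<le> v" "u + v \<le> 1"
    unfolding K_def convex_hull_3_alt by auto
  then have "s *\<^sub>R (B - A) + r *\<^sub>R (C - A) = u *\<^sub>R (B - A) + v *\<^sub>R (C - A)" by (simp add: add.assoc)
  from coordinates_unique[OF this] uv show "0 \<le> s \<and> 0 \<le> r \<and> s + r \<le> 1" by simp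
next
  assume "0 \<le> s \<and> 0 \<le> r \<and> s + r \<le> 1"
  then show "A + s *\<^sub>R (B - A) + r *\<^sub>R (C - A) \<in> K"
    unfolding K_def convex_hull_3_alt by auto
qed

text \<open>In the coordinates along \<open>B - A\<close> and \<open>C - A\<close> the indicator of
  \<open>K\<close> becomes that of the reference triangle. The frontier of a convex set is null, so
  interior and closed triangle give the same integral.\<close>

lemma integral_interior:
  fixes h :: "plane \<Rightarrow> real"
  assumes h: "continuous_on K h"
  shows "(LINT x:interior K|lborel. h x) = \<bar>cross (B - A) (C - A)\<bar> *
    (LINT r:{0..1}|lborel. LINT s:{0..1 - r}|lborel. h (A + s *\<^sub>R (B - A) + r *\<^sub>R (C - A)))"
proof -
  have meas: "(\<lambda>x. indicator K x *\<^sub>R h x) \<in> borel_measurable borel"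
    using h compact_K by (intro borel_measurable_continuous_on_indicator borel_compact)
  have int: "set_integrable lborel K h"
    using compact_K h emeasure_bounded_finite[OF compact_imp_bounded[OF compact_K]]
    by (intro set_integrable_bounded_continuous[of lborel K K])
      (auto simp: compact_imp_closed borel_compact)
  have "(LINT x:interior K|lborel. h x) = (LINT x:K|lborel. h x)"
  proof (rule set_integral_cong_set)
    show mK: "set_borel_measurable lborel K h" using meas by (simp add: set_borel_measurable_def)
    show "set_borel_measurable lborel (interior K) h"
      using mK by (rule set_borel_measurable_subset) (auto simp: interior_subset)
    have "frontier K \<in> null_sets lborel"
      using negligible_convex_frontier[OF convex_K] compact_K
      by (simp add: negligible_iff_null_sets null_sets_completion_iff borel_closed compact_imp_closed)
    then have "AE x in lborel. x \<notin> frontier K" by (rule AE_not_in)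
    then show "AE x in lborel. (x \<in> K) = (x \<in> interior K)"
      by eventually_elim (use compact_K interior_subset in \<open>auto simp: frontier_def compact_imp_closed\<close>)
  qed
  also have "\<dots> = \<bar>cross (B - A) (C - A)\<bar> * (LINT r|lborel. LINT s|lborel.
      indicator K (A + s *\<^sub>R (B - A) + r *\<^sub>R (C - A)) *\<^sub>R h (A + s *\<^sub>R (B - A) + r *\<^sub>R (C - A)))"
    unfolding set_lebesgue_integral_def using int cross_nz
    by (intro lborel_integral_parallelogram) (simp_all add: set_integrable_def)
  also have "(LINT r|lborel. LINT s|lborel.
      indicator K (A + s *\<^sub>R (B - A) + r *\<^sub>R (C - A)) *\<^sub>R h (A + s *\<^sub>R (B - A) + r *\<^sub>R (C - A))) =
    (LINT r:{0..1}|lborel. LINT s:{0..1 - r}|lborel. h (A + s *\<^sub>R (B - A) + r *\<^sub>R (C - A)))"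
  proof -
    have "indicat_real K (A + s *\<^sub>R (B - A) + r *\<^sub>R (C - A)) = indicator {0..1} r * indicator {0..1 - r} s" for r s
      unfolding indicator_def in_K_iff by auto
    then show ?thesis by (simp add: set_lebesgue_integral_def mult.assoc)
  qed
  finally show ?thesis .
qed

text \<open>The fundamental theorem of calculus on each segment parallel to \<open>A B\<close>,
  which enters \<open>K\<close> through the edge \<open>A C\<close> and leaves it through
  \<open>B C\<close>. The divisions by the lengths undo the arc length normalization.\<close>

lemma integral_edge_derivative:
  fixes g :: "plane \<Rightarrow> real"
  assumes deriv: "\<And>x. (g has_derivative (\<lambda>v. g1 x * fst v + g2 x * snd v)) (at x)"
    and cont: "continuous_on UNIV g1" "continuous_on UNIV g2"
  shows "(LINT x:interior K|lborel. g1 x * fst (B - A) + g2 x * snd (B - A)) = \<bar>cross (B - A) (C - A)\<bar> *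
    ((LINT x:closed_segment B C|arc_length (closed_segment B C). g x) / dist B C -
     (LINT x:closed_segment A C|arc_length (closed_segment A C). g x) / dist A C)"
proof -
  let ?d = "\<lambda>x. g1 x * fst (B - A) + g2 x * snd (B - A)"
  have cont_g: "continuous_on S g" for S
    by (intro continuous_at_imp_continuous_on ballI has_derivative_continuous[OF deriv])
  have cont_d: "continuous_on S ?d" for S
    by (intro continuous_intros continuous_on_subset[OF cont(1)] continuous_on_subset[OF cont(2)]) auto
  have inner: "(LINT s:{0..1 - r}|lborel. ?d (A + s *\<^sub>R (B - A) + r *\<^sub>R (C - A))) =
      g (B + r *\<^sub>R (C - B)) - g (A + r *\<^sub>R (C - A))" if r: "r \<in> {0..1}" for r
  proof -
    let ?\<gamma> = "\<lambda>s. A + s *\<^sub>R (B - A) + r *\<^sub>R (C - A)"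
    have "(LINT s:{0..1 - r}|lborel. ?d (?\<gamma> s)) = g (?\<gamma> (1 - r)) - g (?\<gamma> 0)"
      unfolding set_lebesgue_integral_def
    proof (rule integral_FTC_Icc)
      show "0 \<le> 1 - r" using r by simp
      have "((\<lambda>s. g (?\<gamma> s)) has_derivative (\<lambda>h. g1 (?\<gamma> s) * fst (h *\<^sub>R (B - A)) + g2 (?\<gamma> s) * snd (h *\<^sub>R (B - A)))) (at s within {0..1 - r})" for s
      proof (rule has_derivative_compose[where g = g])
        show "(?\<gamma> has_derivative (\<lambda>h. h *\<^sub>R (B - A))) (at s within {0..1 - r})"
          by (auto intro!: derivative_eq_intros)
      qed (rule deriv)
      from has_derivative_eq_rhs[OF this]
      show "((\<lambda>s. g (?\<gamma> s)) has_vector_derivative ?d (?\<gamma> s)) (at s within {0..1 - r})" for s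
        unfolding has_vector_derivative_def by (simp add: fun_eq_iff algebra_simps)
      show "continuous_on {0..1 - r} (\<lambda>s. ?d (?\<gamma> s))"
        by (rule continuous_on_compose2[OF cont_d[of UNIV]]) (auto intro!: continuous_intros)
    qed
    also have "?\<gamma> (1 - r) = B + r *\<^sub>R (C - B)" by (simp add: algebra_simps)
    finally show ?thesis by simp
  qed
  have "(LINT x:interior K|lborel. ?d x) = \<bar>cross (B - A) (C - A)\<bar> *
      (LINT r:{0..1}|lborel. g (B + r *\<^sub>R (C - B)) - g (A + r *\<^sub>R (C - A)))"
    unfolding integral_interior[OF cont_d]
    by (intro arg_cong2[where f = "(*)"] refl set_lebesgue_integral_cong) (use inner in auto)
  also have "(LINT r:{0..1}|lborel. g (B + r *\<^sub>R (C - B)) - g (A + r *\<^sub>R (C - A))) =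
      (LINT r:{0..1}|lborel. g (B + r *\<^sub>R (C - B))) - (LINT r:{0..1}|lborel. g (A + r *\<^sub>R (C - A)))"
    by (rule set_integral_diff(2); rule borel_integrable_atLeastAtMost'; rule continuous_on_compose2[OF cont_g[of UNIV]])
      (auto intro!: continuous_intros)
  also have "\<dots> = (LINT x:closed_segment B C|arc_length (closed_segment B C). g x) / dist B C -
     (LINT x:closed_segment A C|arc_length (closed_segment A C). g x) / dist A C"
    using distinct_vertices by (simp add: arc_length_integral[OF refl _ cont_g])
  finally show ?thesis .
qed

text \<open>The second value is base times height of the parallelogram spanned by
  \<open>B - A\<close> and \<open>C - A\<close>. The two products determine the normal, since
  \<open>C - B\<close> and \<open>B - A\<close> form a basis.\<close>

lemma outward_normal_opposite:
  defines "\<nu> \<equiv> outward_normal K (closed_segment B C)"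
  shows "\<nu> \<bullet> (C - B) = 0" "dist B C * (\<nu> \<bullet> (B - A)) = \<bar>cross (B - A) (C - A)\<bar>"
proof -
  let ?D = "cross (B - A) (C - A)" and ?e = "closed_segment B C"
  \<comment> \<open>\<open>m\<close> is \<open>C - B\<close> turned by a right angle; the sign of
    \<open>?D\<close> then selects the side of the edge away from \<open>A\<close>.\<close>
  define m where "m = (snd (C - B), - fst (C - B))"
  define \<nu>0 where "\<nu>0 = (sgn ?D / dist B C) *\<^sub>R m"
  have l: "0 < dist B C" using distinct_vertices by simp
  have norm_m: "norm m = dist B C"
    by (simp add: m_def norm_Pair dist_norm norm_prod_def power2_commute add.commute)
  have m0: "m \<bullet> (C - B) = 0" by (simp add: m_def inner_prod_def algebra_simps)
  have mA: "m \<bullet> (B - A) = ?D" by (simp add: m_def inner_prod_def cross_def algebra_simps)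
  have e: "x \<in> ?e \<Longrightarrow> \<exists>s. x = B + s *\<^sub>R (C - B)" for x
    by (auto simp: in_segment algebra_simps)
  have BC: "B \<in> ?e" "C \<in> ?e" by auto
  have AK: "A \<in> K" unfolding K_def by (rule hull_inc) simp
  have "outward_normal K ?e = \<nu>0"
    unfolding outward_normal_def
  proof (rule the_equality, intro conjI ballI)
    show "norm \<nu>0 = 1" using l cross_nz by (simp add: \<nu>0_def norm_m abs_sgn_eq)
    have n0: "\<nu>0 \<bullet> (C - B) = 0" by (simp add: \<nu>0_def m0)
    have nA: "\<nu>0 \<bullet> (B - A) \<ge> 0" using l by (simp add: \<nu>0_def mA abs_sgn[symmetric] sgn_mult_abs mult.commute)
    show "\<nu>0 \<bullet> (x - y) = 0" if x: "x \<in> ?e" and y: "y \<in> ?e" for x y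
    proof -
      obtain s s' where xy: "x = B + s *\<^sub>R (C - B)" "y = B + s' *\<^sub>R (C - B)"
        using e[OF x] e[OF y] by blast
      have "x - y = (s - s') *\<^sub>R (C - B)" unfolding xy by (simp add: algebra_simps)
      then show ?thesis using n0 by simp
    qed
    show "\<nu>0 \<bullet> (x - y) \<le> 0" if xK: "x \<in> K" and ye: "y \<in> ?e" for x y
    proof -
      obtain s' where y: "y = B + s' *\<^sub>R (C - B)" using e[OF ye] by blast
      obtain u v where x: "x = A + u *\<^sub>R (B - A) + v *\<^sub>R (C - A)" "0 \<le> u" "0 \<le> v" "u + v \<le> 1"
        using xK unfolding K_def convex_hull_3_alt by blast
      have "x - y = (u + v - 1) *\<^sub>R (B - A) + (v - s') *\<^sub>R (C - B)"
        unfolding x y by (simp add: algebra_simps)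
      then have "\<nu>0 \<bullet> (x - y) = (u + v - 1) * (\<nu>0 \<bullet> (B - A))" using n0 by (simp add: inner_add_right)
      then show ?thesis using x nA by (simp add: mult_nonpos_nonneg)
    qed
    \<comment> \<open>Uniqueness: orthogonality to the edge makes a candidate a multiple of
      \<open>m\<close>, unit length fixes the modulus of the factor, and the inequality at the
      vertex \<open>A\<close> fixes its sign.\<close>
    fix \<nu> assume \<nu>: "norm \<nu> = 1 \<and> (\<forall>x\<in>?e. \<forall>y\<in>?e. \<nu> \<bullet> (x - y) = 0) \<and> (\<forall>x\<in>K. \<forall>y\<in>?e. \<nu> \<bullet> (x - y) \<le> 0)"
    then have 1: "\<nu> \<bullet> (C - B) = 0" "\<nu> \<bullet> (A - B) \<le> 0" using BC AK by blast+
    define k where "k = (\<nu> \<bullet> m) / (dist B C)\<^sup>2"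
    have dd: "(dist B C)\<^sup>2 = m \<bullet> m" using norm_m by (simp add: power2_norm_eq_inner[symmetric])
    have mm: "m \<bullet> m \<noteq> 0" using l dd by auto
    have "cross m \<nu> = 0" using 1(1) by (simp add: cross_def m_def inner_prod_def algebra_simps)
    then have "\<nu> = k *\<^sub>R m"
      using parallel_if_cross_0[of m \<nu>] mm by (auto simp: k_def dd inner_commute)
    moreover from this have "\<bar>k\<bar> * dist B C = 1" using \<nu> norm_m by simp
    moreover have "k * ?D \<ge> 0"
    proof -
      have "\<nu> \<bullet> (A - B) = - (k * ?D)"
        using mA arg_cong[OF mA, of "(*) k"] unfolding \<open>\<nu> = k *\<^sub>R m\<close> by (simp add: inner_diff_right algebra_simps)
      then show ?thesis using 1(2) by simp
    qed
    ultimately have "k = sgn ?D / dist B C"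
      using l cross_nz by (auto simp: field_simps sgn_if abs_if zero_le_mult_iff split: if_splits)
    then show "\<nu> = \<nu>0" using \<open>\<nu> = k *\<^sub>R m\<close> by (simp add: \<nu>0_def)
  qed
  then show "\<nu> \<bullet> (C - B) = 0" "dist B C * (\<nu> \<bullet> (B - A)) = \<bar>?D\<bar>"
    using l m0 mA by (simp_all add: \<nu>_def \<nu>0_def abs_sgn mult.commute)
qed

lemma affine_independent: "\<not> affine_dependent {A, B, C}"
proof -
  have "\<not> collinear {A, B, C}"
  proof
    assume "collinear {A, B, C}"
    then obtain u where u: "\<And>x y. x \<in> {A, B, C} \<Longrightarrow> y \<in> {A, B, C} \<Longrightarrow> \<exists>c. x - y = c *\<^sub>R u"
      unfolding collinear_def by blast
    obtain c d where "B - A = c *\<^sub>R u" "C - A = d *\<^sub>R u" using u[of B A] u[of C A] by blast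
    then have "cross (B - A) (C - A) = 0" by (simp add: cross_def)
    then show False using cross_nz by simp
  qed
  then show ?thesis by (simp add: collinear_3_eq_affine_dependent)
qed

text \<open>The faces of a simplex are the hulls of the subsets of its vertices, and affine
  dimension 1 selects the pairs.\<close>

lemma edges_eq: "edges K = {closed_segment B C, closed_segment C A, closed_segment A B}"
proof -
  have dims: "aff_dim {A, B, C} = 2"
    using aff_dim_affine_independent[OF affine_independent] distinct_vertices by simp
  have "e \<in> edges K \<longleftrightarrow> (\<exists>c\<in>Pow {A, B, C}. e = convex hull c \<and> aff_dim c = 1)" for e
    unfolding edges_def edge_of_def K_def face_of_convex_hull_affine_independent[OF affine_independent]
    by (auto simp: aff_dim_convex_hull)
  moreover have "Pow {A, B, C} = {{}, {A}, {B}, {C}, {B, C}, {C, A}, {A, B}, {A, B, C}}"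
    by (auto simp: Pow_insert insert_commute)
  ultimately show ?thesis
    using dims distinct_vertices by (auto simp: segment_convex_hull aff_dim_2)
qed

lemma sum_edges:
  "(\<Sum>e\<in>edges K. f e) = f (closed_segment B C) + f (closed_segment C A) + (f (closed_segment A B) :: real)"
proof -
  have "closed_segment B C \<noteq> closed_segment C A" "closed_segment B C \<noteq> closed_segment A B"
    "closed_segment C A \<noteq> closed_segment A B"
    using distinct_vertices by (auto simp: closed_segment_eq doubleton_eq_iff)
  then show ?thesis by (simp add: edges_eq)
qed

text \<open>Both sides are linear in \<open>v\<close>, so two basis directions suffice. Along
  \<open>B - A\<close> the edge \<open>A B\<close> drops out, its normal being orthogonal to it, and
  the other two edges give the difference computed in \<open>integral_edge_derivative\<close>;
  likewise along \<open>C - A\<close>.\<close>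

theorem divergence:
  fixes g :: "plane \<Rightarrow> real"
  assumes deriv: "\<And>x. (g has_derivative (\<lambda>v. g1 x * fst v + g2 x * snd v)) (at x)"
    and cont: "continuous_on UNIV g1" "continuous_on UNIV g2"
  shows "(LINT x:interior K|lborel. g1 x * fst v + g2 x * snd v) =
    (\<Sum>e\<in>edges K. (outward_normal K e \<bullet> v) * (LINT x:e|arc_length e. g x))"
proof -
  interpret r: triangle B C A K by (rule rotate)
  interpret r2: triangle C A B K by (rule r.rotate)
  interpret s: triangle A C B K by (rule swap)
  let ?D = "cross (B - A) (C - A)"
  define I where "I e = (LINT x:e|arc_length e. g x)" for e
  define L where "L v = (LINT x:interior K|lborel. g1 x * fst v + g2 x * snd v)" for v :: plane
  define RR where "RR v = (\<Sum>e\<in>edges K. (outward_normal K e \<bullet> v) * I e)" for v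
  let ?BC = "closed_segment B C" and ?CA = "closed_segment C A" and ?AB = "closed_segment A B"
  have int: "set_integrable lborel (interior K) h" if "continuous_on UNIV h" for h :: "plane \<Rightarrow> real"
  proof (rule set_integrable_bounded_continuous[of lborel _ K])
    have "emeasure lborel (interior K) \<le> emeasure lborel K"
      using compact_K by (intro emeasure_mono) (auto simp: interior_subset borel_compact)
    then show "emeasure lborel (interior K) < \<infinity>"
      using emeasure_bounded_finite[OF compact_imp_bounded[OF compact_K]] by (rule le_less_trans)
  qed (use compact_K that in \<open>auto simp: compact_imp_closed interior_subset intro: continuous_on_subset\<close>)
  have L_eq: "L v = fst v * (LINT x:interior K|lborel. g1 x) + snd v * (LINT x:interior K|lborel. g2 x)" for v
  proof -
    have "L v = (LINT x:interior K|lborel. g1 x * fst v) + (LINT x:interior K|lborel. g2 x * snd v)"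
      unfolding L_def by (rule set_integral_add(2); rule int; intro continuous_intros cont)
    then show ?thesis by (simp add: mult.commute)
  qed
  have dist: "dist B C > 0" "dist C A > 0" "dist A B > 0" using distinct_vertices by auto
  have sw: "closed_segment A C = ?CA" "closed_segment C B = ?BC" "dist A C = dist C A" "dist C B = dist B C"
    by (auto simp: closed_segment_commute dist_commute)
  have D: "\<bar>cross (C - B) (A - B)\<bar> = \<bar>?D\<bar>" "\<bar>cross (A - C) (B - C)\<bar> = \<bar>?D\<bar>" "\<bar>cross (C - A) (B - A)\<bar> = \<bar>?D\<bar>"
    by (simp_all add: cross_def algebra_simps abs_minus_commute)
  have n: "outward_normal K ?BC \<bullet> (C - B) = 0" "outward_normal K ?BC \<bullet> (B - A) = \<bar>?D\<bar> / dist B C"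
    "outward_normal K ?CA \<bullet> (A - C) = 0" "outward_normal K ?CA \<bullet> (C - B) = \<bar>?D\<bar> / dist C A"
    "outward_normal K ?AB \<bullet> (B - A) = 0" "outward_normal K ?AB \<bullet> (A - C) = \<bar>?D\<bar> / dist A B"
    using outward_normal_opposite r.outward_normal_opposite r2.outward_normal_opposite dist
    by (simp_all add: D field_simps)
  have 1: "L (B - A) = RR (B - A)"
  proof -
    have m1: "outward_normal K ?CA \<bullet> (B - A) = - (\<bar>?D\<bar> / dist C A)"
      using n(3,4) by (simp add: inner_diff_right)
    have m2: "L (B - A) = \<bar>?D\<bar> * (I ?BC / dist B C - I ?CA / dist C A)"
      using integral_edge_derivative[OF deriv cont] unfolding L_def I_def sw .
    show ?thesis unfolding RR_def sum_edges n(2,5) m1 m2 by (simp add: right_diff_distrib)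
  qed
  have 2: "L (C - A) = RR (C - A)"
  proof -
    have m1: "outward_normal K ?BC \<bullet> (C - A) = \<bar>?D\<bar> / dist B C" "outward_normal K ?CA \<bullet> (C - A) = 0"
      "outward_normal K ?AB \<bullet> (C - A) = - (\<bar>?D\<bar> / dist A B)"
      using n by (simp_all add: inner_diff_right)
    have m2: "L (C - A) = \<bar>?D\<bar> * (I ?BC / dist B C - I ?AB / dist A B)"
      using s.integral_edge_derivative[OF deriv cont] unfolding L_def I_def sw D .
    show ?thesis unfolding RR_def sum_edges m1 m2 by (simp add: right_diff_distrib)
  qed
  \<comment> \<open>Cramer's rule in the basis \<open>B - A\<close>, \<open>C - A\<close>.\<close>
  obtain a b where v: "v = a *\<^sub>R (B - A) + b *\<^sub>R (C - A)"
  proof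
    let ?u = "B - A" and ?w = "C - A"
    have "?D *\<^sub>R v = cross v ?w *\<^sub>R ?u + cross ?u v *\<^sub>R ?w"
      by (rule prod_eqI) (simp_all add: cross_def algebra_simps)
    then have "(1 / ?D) *\<^sub>R (?D *\<^sub>R v) = (1 / ?D) *\<^sub>R (cross v ?w *\<^sub>R ?u + cross ?u v *\<^sub>R ?w)" by simp
    then show "v = (cross v ?w / ?D) *\<^sub>R ?u + (cross ?u v / ?D) *\<^sub>R ?w"
      using cross_nz by (simp add: scaleR_add_right)
  qed
  have "L v = a * L (B - A) + b * L (C - A)"
    unfolding L_eq v by (simp add: algebra_simps)
  also have "\<dots> = a * RR (B - A) + b * RR (C - A)" using 1 2 by simp
  also have "\<dots> = RR v"
    unfolding RR_def v sum_edges by (simp add: inner_add_right algebra_simps)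
  finally show ?thesis unfolding L_def RR_def I_def .
qed

end

lemma simplex_2_triangle:
  assumes "2 simplex K"
  obtains A B C where "triangle A B C K"
proof -
  obtain S where S: "\<not> affine_dependent S" "int (card S) = 2 + 1" "K = convex hull S"
    using assms by (auto simp: simplex)
  then have "card S = 3" by simp
  then obtain A B C where ABC: "S = {A, B, C}" "A \<noteq> B" "B \<noteq> C" "A \<noteq> C"
    by (auto simp: card_3_iff)
  have "cross (B - A) (C - A) \<noteq> 0"
  proof
    let ?u = "B - A" and ?w = "C - A"
    assume "cross ?u ?w = 0"
    then have "?w = ((?u \<bullet> ?w) / (?u \<bullet> ?u)) *\<^sub>R ?u"
      using ABC(2) by (intro parallel_if_cross_0) auto
    then have "collinear {0, ?u, ?w}" unfolding collinear_lemma by blast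
    then have "collinear {A, B, C}"
      using collinear_3[of B A C] by (simp add: insert_commute)
    then show False using S(1) ABC by (simp add: collinear_3_eq_affine_dependent)
  qed
  then show thesis using that S(3) ABC(1) by (simp add: triangle_def)
qed

section \<open>Geometry of the mesh\<close>

lemma piecewise_linear_on_continuous:
  assumes "piecewise_linear_on L R b"
  shows "continuous_on {L..R} b"
proof -
  obtain m s where s: "s 0 = L" "s m = R" "\<And>i. i < m \<Longrightarrow> s i < s (Suc i)"
    and lin: "\<And>i. i < m \<Longrightarrow> \<exists>c d. \<forall>x\<in>{s i..s (Suc i)}. b x = c * x + d"
    using assms unfolding piecewise_linear_on_def by auto
  have "k \<le> m \<Longrightarrow> s 0 \<le> s k \<and> continuous_on {s 0..s k} b" for k
  proof (induction k)
    case (Suc k)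
    then have k: "k < m" and IH: "s 0 \<le> s k" "continuous_on {s 0..s k} b" by auto
    obtain c d where cd: "\<forall>x\<in>{s k..s (Suc k)}. b x = c * x + d" using lin[OF k] by blast
    have "continuous_on {s k..s (Suc k)} (\<lambda>x. c * x + d)" by (intro continuous_intros)
    then have "continuous_on {s k..s (Suc k)} b" by (rule continuous_on_eq) (use cd in auto)
    then have "continuous_on ({s 0..s k} \<union> {s k..s (Suc k)}) b"
      using IH(2) by (intro continuous_on_closed_Un) auto
    moreover have "{s 0..s k} \<union> {s k..s (Suc k)} = {s 0..s (Suc k)}"
      using IH(1) s(3)[OF k] by (intro ivl_disj_un_two_touch) auto
    ultimately show ?case using IH(1) s(3)[OF k] by simp
  qed simp
  from this[of m] show ?thesis using s by simp
qed

locale water_mesh =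
  fixes L R H :: real and b :: "real \<Rightarrow> real" and \<Omega> :: "plane set" and \<T> :: "plane set set"
  assumes L_less_R: "L < R" and piecewise: "piecewise_linear_on L R b"
    and b_bounds: "\<forall>x\<in>{L..R}. 0 < b x \<and> b x < H"
    and \<Omega>_eq: "\<Omega> = water_domain L R H b" and mesh: "periodic_mesh L R \<Omega> \<T>"
begin

lemma finite_mesh: "finite \<T>"
  using mesh by (simp add: periodic_mesh_def triangulation_def)

lemma simplex_mesh: "K \<in> \<T> \<Longrightarrow> 2 simplex K"
  using mesh by (simp add: periodic_mesh_def)

lemma mesh_cover: "\<Union>\<T> = closure \<Omega>"
  using mesh by (simp add: periodic_mesh_def)

lemma mesh_face: "K \<in> \<T> \<Longrightarrow> K' \<in> \<T> \<Longrightarrow> K \<inter> K' face_of K"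
  using mesh by (simp add: periodic_mesh_def triangulation_def)

lemma mesh_triangle:
  assumes "K \<in> \<T>"
  obtains A B C where "triangle A B C K"
  using simplex_2_triangle[OF simplex_mesh[OF assms]] by blast

lemma compact_element: "K \<in> \<T> \<Longrightarrow> compact K"
  by (rule mesh_triangle) (auto intro: triangle.compact_K)

lemma convex_element: "K \<in> \<T> \<Longrightarrow> convex K"
  by (rule mesh_triangle) (auto intro: triangle.convex_K)

lemma aff_dim_element: "K \<in> \<T> \<Longrightarrow> aff_dim K = 2"
  using aff_dim_simplex simplex_mesh by blast

lemma interior_element_nonempty:
  assumes "K \<in> \<T>"
  shows "interior K \<noteq> {}"
proof -
  have "affine hull K = UNIV"
    using aff_dim_element[OF assms] by (simp add: aff_dim_eq_full[symmetric])
  then have "rel_interior K = interior K" by (rule rel_interior_interior)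
  moreover have "K \<noteq> {}" using aff_dim_element[OF assms] by auto
  ultimately show ?thesis using rel_interior_eq_empty[OF convex_element[OF assms]] by simp
qed

lemma edge_segment:
  assumes "e \<in> mesh_edges \<T>"
  obtains u v where "e = closed_segment u v" "u \<noteq> v"
proof -
  obtain K where K: "K \<in> \<T>" "e \<in> edges K" using assms by (auto simp: mesh_edges_def)
  obtain A B C where "triangle A B C K" using mesh_triangle[OF K(1)] by blast
  then interpret triangle A B C K .
  show thesis using K(2) distinct_vertices that unfolding edges_eq by blast
qed

lemma finite_edges: "K \<in> \<T> \<Longrightarrow> finite (edges K)"
  by (rule mesh_triangle) (auto simp: triangle.edges_eq)

lemma edge_subset: "e \<in> edges K \<Longrightarrow> e \<subseteq> K"
  by (auto simp: edges_def dest: edge_of_imp_subset)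

lemma finite_mesh_edges: "finite (mesh_edges \<T>)"
  unfolding mesh_edges_def using finite_mesh finite_edges by blast

lemma continuous_b: "continuous_on {L..R} b"
  using piecewise by (rule piecewise_linear_on_continuous)

lemma closure_domain_subset: "closure \<Omega> \<subseteq> {z \<in> {L..R} \<times> {..0}. - H + b (fst z) \<le> snd z}"
proof (rule closure_minimal)
  show "\<Omega> \<subseteq> {z \<in> {L..R} \<times> {..0}. - H + b (fst z) \<le> snd z}"
    by (auto simp: \<Omega>_eq water_domain_def)
  have "continuous_on ({L..R} \<times> {..0::real}) (\<lambda>z. b (fst z))"
    by (rule continuous_on_compose2[OF continuous_b]) (auto intro!: continuous_intros)
  then have "closed (({L..R} \<times> {..0}) \<inter> (\<lambda>z. - H + b (fst z) - snd z) -` {..0})"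
    by (intro continuous_closed_preimage continuous_intros) (auto intro: closed_Times)
  moreover have "({L..R} \<times> {..0}) \<inter> (\<lambda>z. - H + b (fst z) - snd z) -` {..0} =
      {z \<in> {L..R} \<times> {..0}. - H + b (fst z) \<le> snd z}" by auto
  ultimately show "closed {z \<in> {L..R} \<times> {..0}. - H + b (fst z) \<le> snd z}" by simp
qed

text \<open>An interior point of the closure can be moved slightly along both axes in either
  direction without violating the closed constraints, so each constraint is strict there. This
  places the interiors of mesh elements inside the open domain.\<close>

lemma interior_closure_domain: "interior (closure \<Omega>) \<subseteq> \<Omega>"
proof
  fix z assume z: "z \<in> interior (closure \<Omega>)"
  obtain x y where xy: "z = (x, y)" by (cases z)
  obtain e where e: "0 < e" "ball z e \<subseteq> closure \<Omega>" using z by (auto simp: mem_interior)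
  have near: "(x + d1, y + d2) \<in> {z \<in> {L..R} \<times> {..0}. - H + b (fst z) \<le> snd z}"
    if "\<bar>d1\<bar> + \<bar>d2\<bar> < e" for d1 d2
  proof -
    have "dist z (x + d1, y + d2) \<le> \<bar>d1\<bar> + \<bar>d2\<bar>"
      using sqrt_sum_squares_le_sum_abs[of d1 d2] by (simp add: xy dist_Pair_Pair dist_real_def)
    then have "(x + d1, y + d2) \<in> ball z e" using that by simp
    then show ?thesis using e(2) closure_domain_subset by blast
  qed
  have "L < x" "x < R" "y < 0" "- H + b x < y"
    using near[of "- e / 2" 0] near[of "e / 2" 0] near[of 0 "e / 2"] near[of 0 "- e / 2"] e(1) by auto
  then show "z \<in> \<Omega>" by (simp add: \<Omega>_eq water_domain_def xy)
qed

lemma element_subset: "K \<in> \<T> \<Longrightarrow> K \<subseteq> closure \<Omega>"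
  using mesh_cover by auto

lemma interior_element_subset: "K \<in> \<T> \<Longrightarrow> interior K \<subseteq> \<Omega>"
  using interior_mono[OF element_subset] interior_closure_domain by blast

text \<open>The intersection is a face of both elements and, as they differ, a proper face of at
  least one; a proper face misses the interior.\<close>

lemma disjoint_interiors:
  assumes "K \<in> \<T>" "K' \<in> \<T>" "K \<noteq> K'"
  shows "interior K \<inter> interior K' = {}"
proof (cases "K \<inter> K' = K")
  case False
  then have "(K \<inter> K') \<inter> interior K = {}"
    using face_of_disjoint_interior[OF mesh_face[OF assms(1,2)]] by simp
  then show ?thesis using interior_subset by blast
next
  case True
  have "K' \<inter> K face_of K'" using assms by (intro mesh_face)
  moreover have "K' \<inter> K \<noteq> K'" using True assms(3) by blast
  ultimately have "(K' \<inter> K) \<inter> interior K' = {}" by (rule face_of_disjoint_interior)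
  then show ?thesis using interior_subset by blast
qed

lemma AE_in_interior: "AE x in lborel. x \<in> \<Omega> \<longrightarrow> (\<exists>K\<in>\<T>. x \<in> interior K)"
proof -
  have "frontier K \<in> null_sets lborel" if "K \<in> \<T>" for K
    using negligible_convex_frontier[OF convex_element[OF that]] compact_element[OF that]
    by (simp add: negligible_iff_null_sets null_sets_completion_iff borel_closed compact_imp_closed)
  then have "(\<Union>K\<in>\<T>. frontier K) \<in> null_sets lborel"
    using finite_mesh by (intro null_sets_UN') (auto intro: countable_finite)
  then have "AE x in lborel. x \<notin> (\<Union>K\<in>\<T>. frontier K)" by (rule AE_not_in)
  then show ?thesis
  proof (rule eventually_mono, intro impI)
    fix x assume "x \<notin> (\<Union>K\<in>\<T>. frontier K)" "x \<in> \<Omega>"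
    then obtain K where "K \<in> \<T>" "x \<in> K" "x \<notin> frontier K"
      using mesh_cover closure_subset by blast
    then show "\<exists>K\<in>\<T>. x \<in> interior K"
      using compact_element by (auto simp: frontier_def compact_imp_closed)
  qed
qed

lemma open_domain: "open \<Omega>"
proof -
  have "continuous_on ({L<..<R} \<times> {..<0::real}) (\<lambda>z. b (fst z))"
    by (rule continuous_on_compose2[OF continuous_b]) (auto intro!: continuous_intros)
  then have "open (({L<..<R} \<times> {..<0}) \<inter> (\<lambda>z. - H + b (fst z) - snd z) -` {..<0})"
    by (intro continuous_open_preimage continuous_intros) (auto intro: open_Times)
  moreover have "({L<..<R} \<times> {..<0}) \<inter> (\<lambda>z. - H + b (fst z) - snd z) -` {..<0} = \<Omega>"
    by (auto simp: \<Omega>_eq water_domain_def)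
  ultimately show ?thesis by simp
qed

text \<open>Scaling the vertical coordinate by the depth maps a rectangle continuously onto the
  domain; \<open>b < H\<close> keeps the depth positive.\<close>

lemma connected_domain: "connected \<Omega>"
proof -
  let ?f = "\<lambda>z. (fst z, snd z * (- H + b (fst z)))"
  have "continuous_on ({L<..<R} \<times> {0<..<1::real}) (\<lambda>z. b (fst z))"
    by (rule continuous_on_compose2[OF continuous_b]) (auto intro!: continuous_intros)
  then have "continuous_on ({L<..<R} \<times> {0<..<1}) ?f" by (intro continuous_intros)
  then have "connected (?f ` ({L<..<R} \<times> {0<..<1}))"
    by (rule connected_continuous_image) (auto intro: connected_Times)
  moreover have "?f ` ({L<..<R} \<times> {0<..<1}) = \<Omega>"
  proof (intro equalityI subsetI)
    fix z assume "z \<in> ?f ` ({L<..<R} \<times> {0<..<1})"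
    then obtain x s where xs: "z = (x, s * (- H + b x))" "L < x" "x < R" "0 < s" "s < 1" by force
    then have "- H + b x < 0" using b_bounds by auto
    then have "s * (- H + b x) < 0" "- H + b x < s * (- H + b x)"
      using xs by (auto simp: mult_pos_neg)
    then show "z \<in> \<Omega>" using xs by (simp add: \<Omega>_eq water_domain_def)
  next
    fix z assume "z \<in> \<Omega>"
    then obtain x y where xy: "z = (x, y)" "L < x" "x < R" "- H + b x < y" "y < 0"
      by (auto simp: \<Omega>_eq water_domain_def)
    then have neg: "- H + b x < 0" by simp
    have "z = ?f (x, y / (- H + b x))" using neg xy(1) by simp
    moreover have "(x, y / (- H + b x)) \<in> {L<..<R} \<times> {0<..<1}"
      using xy neg by (auto simp: divide_neg_neg divide_less_eq)
    ultimately show "z \<in> ?f ` ({L<..<R} \<times> {0<..<1})" by (rule image_eqI)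
  qed
  ultimately show ?thesis by simp
qed

lemma finite_if_aff_dim_le_0:
  fixes S :: "plane set"
  assumes "aff_dim S \<le> 0"
  shows "finite S"
proof -
  have "aff_dim S = -1 \<or> aff_dim S = 0" using assms aff_dim_geq[of S] by linarith
  then show ?thesis by (auto simp: aff_dim_eq_0 aff_dim_empty[symmetric])
qed

text \<open>The domain minus the finitely many points in which elements with and without the property
  meet is still connected.\<close>

lemma mesh_connected:
  assumes K0: "K0 \<in> \<T>" "P K0" and K1: "K1 \<in> \<T>"
    and step: "\<And>K K' e. K \<in> \<T> \<Longrightarrow> K' \<in> \<T> \<Longrightarrow> e \<in> edges K \<Longrightarrow> e \<in> edges K' \<Longrightarrow> P K \<Longrightarrow> P K'"
  shows "P K1"
proof (rule ccontr)
  assume nP: "\<not> P K1"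
  define A where "A = \<Union>{K \<in> \<T>. P K}"
  define B where "B = \<Union>{K \<in> \<T>. \<not> P K}"
  \<comment> \<open>A common face of dimension 1 would be a shared edge, across which
    \<open>P\<close> propagates, and dimension 2 would make the elements equal. What remains is a
    vertex or the empty set.\<close>
  have fin: "finite (K \<inter> K')" if K: "K \<in> \<T>" "P K" and K': "K' \<in> \<T>" "\<not> P K'" for K K'
  proof (rule finite_if_aff_dim_le_0)
    have f: "K \<inter> K' face_of K" "K \<inter> K' face_of K'"
      using mesh_face[OF K(1) K'(1)] mesh_face[OF K'(1) K(1)] by (simp_all add: Int_commute)
    have "K \<noteq> K'" using K K' by blast
    have "aff_dim (K \<inter> K') \<noteq> 1"
    proof
      assume "aff_dim (K \<inter> K') = 1"
      then have "K \<inter> K' \<in> edges K" "K \<inter> K' \<in> edges K'" using f by (simp_all add: edges_def edge_of_def)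
      then show False using step[OF K(1) K'(1)] K K' by blast
    qed
    moreover have "aff_dim (K \<inter> K') < 2"
    proof (cases "K \<inter> K' = K")
      case False
      then show ?thesis
        using face_of_aff_dim_lt[OF convex_element[OF K(1)] f(1)] aff_dim_element[OF K(1)] by simp
    next
      case True
      then have "K \<inter> K' \<noteq> K'" using \<open>K \<noteq> K'\<close> by simp
      then show ?thesis
        using face_of_aff_dim_lt[OF convex_element[OF K'(1)] f(2)] aff_dim_element[OF K'(1)] by simp
    qed
    ultimately show "aff_dim (K \<inter> K') \<le> 0" by linarith
  qed
  have "A \<inter> B = (\<Union>K\<in>{K \<in> \<T>. P K}. \<Union>K'\<in>{K \<in> \<T>. \<not> P K}. K \<inter> K')"
    by (auto simp: A_def B_def)
  moreover have "finite (\<Union>K\<in>{K \<in> \<T>. P K}. \<Union>K'\<in>{K \<in> \<T>. \<not> P K}. K \<inter> K')"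
    using finite_mesh fin by (intro finite_UN_I) auto
  ultimately have finAB: "finite (A \<inter> B)" by simp
  have "connected (\<Omega> - A \<inter> B)"
    using open_domain connected_domain finAB
    by (intro connected_open_diff_countable) (auto intro: countable_finite)
  moreover have "closed A" "closed B"
    unfolding A_def B_def using finite_mesh compact_element
    by (auto intro!: closed_Union compact_imp_closed)
  moreover have "\<Omega> - A \<inter> B \<subseteq> A \<union> B"
  proof -
    have "A \<union> B = closure \<Omega>" unfolding mesh_cover[symmetric] A_def B_def by blast
    then show ?thesis using closure_subset by blast
  qed
  moreover have "A \<inter> B \<inter> (\<Omega> - A \<inter> B) = {}" by blast
  \<comment> \<open>Neither closed set is swallowed by the deleted points: the interior of an
    element is open and nonempty, hence infinite.\<close>
  moreover have meets: "X \<inter> (\<Omega> - A \<inter> B) \<noteq> {}" if "K \<in> \<T>" "K \<subseteq> X" for K X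
  proof
    assume "X \<inter> (\<Omega> - A \<inter> B) = {}"
    then have "interior K \<subseteq> A \<inter> B"
      using that interior_element_subset[OF that(1)] interior_subset[of K] by blast
    then have "finite (interior K)" using finAB by (rule finite_subset)
    then show False
      using interior_element_nonempty[OF that(1)] open_interior[of K] finite_imp_not_open by blast
  qed
  moreover have "A \<inter> (\<Omega> - A \<inter> B) \<noteq> {}"
    using K0 by (intro meets[of K0]) (auto simp: A_def)
  moreover have "B \<inter> (\<Omega> - A \<inter> B) \<noteq> {}"
    using K1 nP by (intro meets[of K1]) (auto simp: B_def)
  ultimately show False unfolding connected_closed by blast
qed

text \<open>Finitely many elements cover the infinitely many surface points, so one element
  \<open>K\<close> contains infinitely many of them. The line x2 = 0 supports \<open>K\<close>,
  hence cuts out a face; being infinite and different from \<open>K\<close>, it has dimension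
  1.\<close>

lemma surface_edge_exists:
  obtains K e where "K \<in> \<T>" "e \<in> edges K" "e \<in> surface_edges \<T>"
proof -
  let ?S = "(\<lambda>x. (x, 0::real)) ` {L<..<R}"
  have "?S \<subseteq> closure \<Omega>"
  proof
    fix z assume "z \<in> ?S"
    then obtain x where x: "z = (x, 0)" "L < x" "x < R" by auto
    then have bx: "b x < H" using b_bounds by auto
    show "z \<in> closure \<Omega>"
      unfolding closure_approachable
    proof (intro allI impI)
      fix e :: real assume "0 < e"
      \<comment> \<open>A depth small enough to be \<open>e\<close>-close to the surface and to
        remain above the bottom.\<close>
      define d where "d = min (e / 2) ((H - b x) / 2)"
      have d: "0 < d" "d < e" "d < H - b x" using \<open>0 < e\<close> bx by (auto simp: d_def min_def)
      have "dist (x, - d) z < e" using d by (simp add: x dist_Pair_Pair dist_real_def)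
      moreover have "(x, - d) \<in> \<Omega>" using d x by (simp add: \<Omega>_eq water_domain_def)
      ultimately show "\<exists>y\<in>\<Omega>. dist y z < e" by blast
    qed
  qed
  then have cover: "?S = (\<Union>K\<in>\<T>. K \<inter> ?S)" using mesh_cover by blast
  have "infinite ?S" using L_less_R by (simp add: finite_image_iff inj_on_def)
  then obtain K where K: "K \<in> \<T>" "infinite (K \<inter> ?S)"
    using cover finite_mesh finite_UN_I[of \<T> "\<lambda>K. K \<inter> ?S"] by auto
  define e where "e = K \<inter> {x. (0, 1) \<bullet> x = 0}"
  have "e face_of K" unfolding e_def
  proof (rule face_of_Int_supporting_hyperplane_le)
    show "convex K" using K(1) by (rule convex_element)
    show "(0, 1) \<bullet> x \<le> 0" if "x \<in> K" for x
      using element_subset[OF K(1)] closure_domain_subset that by (cases x) auto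
  qed
  have "K \<inter> ?S \<subseteq> e" by (auto simp: e_def)
  then have "infinite e" using K(2) finite_subset by blast
  then have "\<not> aff_dim e \<le> 0" using finite_if_aff_dim_le_0 by blast
  moreover have "aff_dim e < 2"
  proof -
    have "e \<noteq> K"
    proof
      assume "e = K"
      obtain x where "x \<in> interior K" using interior_element_nonempty[OF K(1)] by blast
      then have "x \<in> \<Omega>" "x \<in> e"
        using interior_element_subset[OF K(1)] interior_subset \<open>e = K\<close> by blast+
      then show False by (auto simp: e_def \<Omega>_eq water_domain_def)
    qed
    then show ?thesis
      using face_of_aff_dim_lt[OF convex_element[OF K(1)] \<open>e face_of K\<close>] aff_dim_element[OF K(1)] by simp
  qed
  ultimately have "aff_dim e = 1" by linarith
  then have e: "e \<in> edges K" using \<open>e face_of K\<close> by (simp add: edges_def edge_of_def)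
  moreover have "e \<subseteq> {x. snd x = 0}" by (auto simp: e_def inner_prod_def)
  ultimately have "e \<in> surface_edges \<T>" using K(1) by (auto simp: surface_edges_def mesh_edges_def)
  with K(1) e show thesis by (rule that)
qed

lemma surface_edge_segment:
  assumes "e \<in> surface_edges \<T>"
  obtains c d where "e = closed_segment (c, 0) (d, 0)" "L \<le> c" "c < d" "d \<le> R"
proof -
  have e: "e \<in> mesh_edges \<T>" "e \<subseteq> {x. snd x = 0}" using assms by (auto simp: surface_edges_def)
  obtain u v where uv: "e = closed_segment u v" "u \<noteq> v" using edge_segment[OF e(1)] .
  have in_e: "u \<in> e" "v \<in> e" using uv by auto
  have "e \<subseteq> closure \<Omega>"
    using e(1) element_subset edge_subset unfolding mesh_edges_def by blast
  then have bounds: "fst u \<in> {L..R}" "fst v \<in> {L..R}" using in_e closure_domain_subset by auto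
  have snd_0: "u = (fst u, 0)" "v = (fst v, 0)" using in_e e(2) by (auto simp: prod_eq_iff)
  have "fst u \<noteq> fst v" using uv(2) snd_0 by (auto simp: prod_eq_iff)
  then consider "fst u < fst v" | "fst v < fst u" by linarith
  then show thesis
  proof cases
    case 1
    have "e = closed_segment (fst u, 0) (fst v, 0)" using uv(1) snd_0 by simp
    then show thesis using that[of "fst u" "fst v"] 1 bounds by simp
  next
    case 2
    have "e = closed_segment (fst v, 0) (fst u, 0)" using uv(1) snd_0 by (simp add: closed_segment_commute)
    then show thesis using that[of "fst v" "fst u"] 2 bounds by simp
  qed
qed

end

section \<open>Square-integrable data\<close>

lemma L2_on_add:
  assumes f: "f \<in> L2_on M A" and g: "g \<in> L2_on M A"
  shows "(\<lambda>x. f x + c * g x) \<in> L2_on M A"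
proof -
  let ?i = "indicat_real A"
  have m: "(\<lambda>x. ?i x * f x) \<in> borel_measurable M" "(\<lambda>x. ?i x * g x) \<in> borel_measurable M"
    and int: "integrable M (\<lambda>x. ?i x * (f x)\<^sup>2)" "integrable M (\<lambda>x. ?i x * (g x)\<^sup>2)"
    using f g by (simp_all add: L2_on_def set_borel_measurable_def set_integrable_def)
  have "(\<lambda>x. ?i x * f x + c * (?i x * g x)) \<in> borel_measurable M" using m by measurable
  then have m': "(\<lambda>x. ?i x * (f x + c * g x)) \<in> borel_measurable M" by (simp add: algebra_simps)
  have "integrable M (\<lambda>x. 2 * (?i x * (f x)\<^sup>2) + (2 * c\<^sup>2) * (?i x * (g x)\<^sup>2))" using int by simp
  then have "integrable M (\<lambda>x. ?i x * (f x + c * g x)\<^sup>2)"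
  proof (rule Bochner_Integration.integrable_bound)
    have "(\<lambda>x. (?i x * (f x + c * g x))\<^sup>2) \<in> borel_measurable M" using m' by measurable
    moreover have "(?i x * (f x + c * g x))\<^sup>2 = ?i x * (f x + c * g x)\<^sup>2" for x
      by (simp add: indicator_def)
    ultimately show "(\<lambda>x. ?i x * (f x + c * g x)\<^sup>2) \<in> borel_measurable M" by simp
    have "(f x + c * g x)\<^sup>2 \<le> 2 * (f x)\<^sup>2 + (2 * c\<^sup>2) * (g x)\<^sup>2" for x
      using zero_le_power2[of "f x - c * g x"] by (simp add: power2_eq_square algebra_simps)
    then show "AE x in M. norm (?i x * (f x + c * g x)\<^sup>2) \<le> norm (2 * (?i x * (f x)\<^sup>2) + (2 * c\<^sup>2) * (?i x * (g x)\<^sup>2))"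
      by (intro AE_I2) (auto simp: indicator_def)
  qed
  then show ?thesis using m' by (simp add: L2_on_def set_borel_measurable_def set_integrable_def)
qed

lemma L2_on_0: "(\<lambda>x. 0) \<in> L2_on M A"
  by (simp add: L2_on_def set_borel_measurable_def set_integrable_def)

lemma L2_on_mult_integrable:
  assumes u: "u \<in> L2_on M A" and S: "S \<in> sets M" "S \<subseteq> A"
    and h: "set_integrable M S (\<lambda>x. (h x)\<^sup>2)" "set_borel_measurable M S h"
  shows "set_integrable M S (\<lambda>x. u x * h x)"
proof -
  let ?i = "indicat_real S"
  have mu: "(\<lambda>x. indicat_real A x * u x) \<in> borel_measurable M" and iu: "integrable M (\<lambda>x. indicat_real A x * (u x)\<^sup>2)"
    using u by (simp_all add: L2_on_def set_borel_measurable_def set_integrable_def)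
  have ii: "?i x * (indicat_real A x * y) = ?i x * y" for x y
    using S(2) by (auto simp: indicator_def)
  have "(\<lambda>x. ?i x * (indicat_real A x * u x)) \<in> borel_measurable M" using mu S(1) by measurable
  then have mu': "(\<lambda>x. ?i x * u x) \<in> borel_measurable M" by (simp add: ii)
  have "integrable M (\<lambda>x. ?i x *\<^sub>R (indicat_real A x * (u x)\<^sup>2))"
    using S(1) iu by (rule integrable_mult_indicator)
  then have iu': "integrable M (\<lambda>x. ?i x * (u x)\<^sup>2)" by (simp add: ii)
  have mh: "(\<lambda>x. ?i x * h x) \<in> borel_measurable M" and ih: "integrable M (\<lambda>x. ?i x * (h x)\<^sup>2)"
    using h by (simp_all add: set_borel_measurable_def set_integrable_def)
  have "integrable M (\<lambda>x. ?i x * (u x)\<^sup>2 + ?i x * (h x)\<^sup>2)" using iu' ih by simp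
  then have "integrable M (\<lambda>x. ?i x * (u x * h x))"
  proof (rule Bochner_Integration.integrable_bound)
    have "(\<lambda>x. (?i x * u x) * (?i x * h x)) \<in> borel_measurable M" using mu' mh by measurable
    moreover have "(?i x * u x) * (?i x * h x) = ?i x * (u x * h x)" for x by (simp add: indicator_def)
    ultimately show "(\<lambda>x. ?i x * (u x * h x)) \<in> borel_measurable M" by simp
    have "\<bar>u x * h x\<bar> \<le> (u x)\<^sup>2 + (h x)\<^sup>2" for x
    proof -
      have "2 * \<bar>u x * h x\<bar> \<le> (u x)\<^sup>2 + (h x)\<^sup>2"
        using zero_le_power2[of "\<bar>u x\<bar> - \<bar>h x\<bar>"] by (simp add: power2_diff abs_mult)
      then show ?thesis by linarith
    qed
    then show "AE x in M. norm (?i x * (u x * h x)) \<le> norm (?i x * (u x)\<^sup>2 + ?i x * (h x)\<^sup>2)"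
      by (intro AE_I2) (auto simp: indicator_def)
  qed
  then show ?thesis by (simp add: set_integrable_def)
qed

text \<open>The sign \<open>\<sigma>\<close> records which end point the choice in
  \<open>arc_length\<close> took as its start; the result does not depend on it. Thus arc lengths of
  all horizontal segments at height 0 are restrictions of one measure, and integrability over the
  whole surface passes to single edges.\<close>

lemma emeasure_horizontal_arc:
  fixes c d :: real
  assumes cd: "c < d" and A: "A \<in> sets borel"
  shows "emeasure (arc_length (closed_segment (c, 0) (d, 0))) A =
    (\<integral>\<^sup>+s. indicator {c..d} s * indicator A (s, 0) \<partial>lborel)"
proof -
  let ?e = "closed_segment (c, 0) (d, 0::real)"
  obtain a b where ab: "arc_length ?e = distr (restrict_space lborel {0..dist a b}) borel (\<lambda>s. a + s *\<^sub>R sgn (b - a))"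
    and "{a, b} = {(c, 0), (d, 0)}"
    by (rule arc_length_segment[OF refl])
  then have or: "a = (c, 0) \<and> b = (d, 0) \<or> a = (d, 0) \<and> b = (c, 0)" by (auto simp: doubleton_eq_iff)
  define \<sigma> where "\<sigma> = (if a = (c, 0) then 1 else - 1 :: real)"
  have l: "dist a b = d - c" using or cd by (auto simp: dist_Pair_Pair dist_real_def)
  have \<gamma>: "a + s *\<^sub>R sgn (b - a) = (fst a + \<sigma> * s, 0)" for s
    using or cd by (auto simp: \<sigma>_def sgn_div_norm norm_Pair field_simps)
  have \<sigma>: "\<sigma> \<noteq> 0" "\<bar>\<sigma>\<bar> = 1" by (simp_all add: \<sigma>_def)
  have [measurable]: "(\<lambda>s. (s, 0)) \<in> borel \<rightarrow>\<^sub>M (borel :: plane measure)"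
    by (intro borel_measurable_continuous_onI continuous_intros)
  have meas: "(\<lambda>s. (fst a + \<sigma> * s, 0)) \<in> restrict_space lborel {0..d - c} \<rightarrow>\<^sub>M (borel :: plane measure)"
    by (intro measurable_restrict_space1) measurable
  have "emeasure (arc_length ?e) A = emeasure (distr (restrict_space lborel {0..d - c}) borel (\<lambda>s. (fst a + \<sigma> * s, 0))) A"
    unfolding ab l \<gamma> ..
  also have "\<dots> = (\<integral>\<^sup>+x. indicator A x \<partial>distr (restrict_space lborel {0..d - c}) borel (\<lambda>s. (fst a + \<sigma> * s, 0)))"
    using A by simp
  also have "\<dots> = (\<integral>\<^sup>+s. indicator A (fst a + \<sigma> * s, 0) \<partial>restrict_space lborel {0..d - c})"
    using A by (intro nn_integral_distr meas) auto
  also have "\<dots> = (\<integral>\<^sup>+s. indicator A (fst a + \<sigma> * s, 0) * indicator {0..d - c} s \<partial>lborel)"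
    by (rule nn_integral_restrict_space) simp
  also have "\<dots> = (\<integral>\<^sup>+s. indicator {c..d} (fst a + \<sigma> * s) * indicator A (fst a + \<sigma> * s, 0) \<partial>lborel)"
    using or cd by (intro nn_integral_cong) (auto simp: \<sigma>_def indicator_def)
  also have "\<dots> = (\<integral>\<^sup>+s. indicator {c..d} s * indicator A (s, 0) \<partial>lborel)"
    using nn_integral_real_affine[of "\<lambda>s. indicator {c..d} s * indicator A (s, 0)" \<sigma> "fst a"] A \<sigma> by simp
  finally show ?thesis .
qed

lemma horizontal_arc_length:
  fixes c d :: real
  assumes "c < d"
  shows "arc_length (closed_segment (c, 0) (d, 0)) = distr (restrict_space lborel {c..d}) borel (\<lambda>s. (s, 0))"
proof (rule measure_eqI)
  have meas: "(\<lambda>s. (s, 0)) \<in> restrict_space lborel {c..d} \<rightarrow>\<^sub>M (borel :: plane measure)"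
    by (intro measurable_restrict_space1) (auto intro!: borel_measurable_continuous_onI continuous_intros)
  fix A assume "A \<in> sets (arc_length (closed_segment (c, 0) (d, 0)))"
  then have A: "A \<in> sets borel" by simp
  have "emeasure (distr (restrict_space lborel {c..d}) borel (\<lambda>s. (s, 0))) A =
      (\<integral>\<^sup>+x. indicator A x \<partial>distr (restrict_space lborel {c..d}) borel (\<lambda>s. (s, 0)))"
    using A by simp
  also have "\<dots> = (\<integral>\<^sup>+s. indicator A (s, 0) \<partial>restrict_space lborel {c..d})"
    using A by (intro nn_integral_distr meas) auto
  also have "\<dots> = (\<integral>\<^sup>+s. indicator A (s, 0) * indicator {c..d} s \<partial>lborel)"
    by (rule nn_integral_restrict_space) simp
  finally show "emeasure (arc_length (closed_segment (c, 0) (d, 0))) A =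
      emeasure (distr (restrict_space lborel {c..d}) borel (\<lambda>s. (s, 0))) A"
    by (simp add: emeasure_horizontal_arc[OF assms A] mult.commute)
qed simp

lemma integrable_horizontal_arc_iff:
  fixes c d :: real and h :: "plane \<Rightarrow> real"
  assumes "c < d" "h \<in> borel_measurable borel"
  shows "integrable (arc_length (closed_segment (c, 0) (d, 0))) h \<longleftrightarrow> set_integrable lborel {c..d} (\<lambda>s. h (s, 0))"
proof -
  have "(\<lambda>s. (s, 0)) \<in> restrict_space lborel {c..d} \<rightarrow>\<^sub>M (borel :: plane measure)"
    by (intro measurable_restrict_space1) (auto intro!: borel_measurable_continuous_onI continuous_intros)
  then show ?thesis
    unfolding horizontal_arc_length[OF assms(1)] set_integrable_def
    by (subst integrable_distr_eq) (use assms(2) in \<open>auto simp: integrable_restrict_space\<close>)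
qed

lemma emeasure_horizontal_arc_singleton:
  fixes c d :: real
  assumes "c < d"
  shows "emeasure (arc_length (closed_segment (c, 0) (d, 0))) {x} = 0"
proof -
  have "(\<integral>\<^sup>+s. indicator {c..d} s * indicator {x} (s, 0) \<partial>lborel) \<le> (\<integral>\<^sup>+s. indicator {fst x} s \<partial>lborel)"
    by (intro nn_integral_mono) (auto simp: indicator_def)
  also have "\<dots> = 0" by simp
  finally show ?thesis by (subst emeasure_horizontal_arc[OF assms]) auto
qed

text \<open>The data is square integrable on the open surface with respect to the arc length of its
  closure, while an edge may contain a corner (L, 0) or (R, 0). Corners are null for arc
  length.\<close>

lemma surface_data_integrable:
  assumes LR: "L < R" and l0: "l0 \<in> L2_on (arc_length (closure (free_surface L R))) (free_surface L R)"
    and e: "e = closed_segment (c, 0) (d, 0)" "L \<le> c" "c < d" "d \<le> R"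
    and h: "continuous_on e h"
  shows "set_integrable (arc_length e) e (\<lambda>x. l0 x * h x)"
proof -
  let ?Cl = "closed_segment (L, 0) (R, 0::real)" and ?F = "free_surface L R"
  have Cl: "closure ?F = ?Cl"
    using LR by (simp add: free_surface_def closure_Times closed_segment_same_snd closed_segment_eq_real_ivl)
  \<comment> \<open>The data is only known to be measurable on the open surface; cut off to it, it
    is Borel on the whole plane.\<close>
  define k where "k x = indicat_real ?F x * l0 x" for x
  have k: "k \<in> borel_measurable borel" "integrable (arc_length ?Cl) (\<lambda>x. indicat_real ?F x * (l0 x)\<^sup>2)"
    using l0 unfolding L2_on_def Cl set_borel_measurable_def set_integrable_def k_def
    by (auto cong: measurable_cong_sets)
  have k2: "indicat_real ?F x * (l0 x)\<^sup>2 = (k x)\<^sup>2" for x by (simp add: k_def indicator_def)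
  have "set_integrable lborel {L..R} (\<lambda>s. (k (s, 0))\<^sup>2)"
    using k(2) k(1) unfolding k2 by (subst (asm) integrable_horizontal_arc_iff[OF LR]) auto
  then have "set_integrable lborel {c..d} (\<lambda>s. (k (s, 0))\<^sup>2)"
    by (rule set_integrable_subset) (use e in auto)
  then have ik: "integrable (arc_length e) (\<lambda>x. (k x)\<^sup>2)"
    unfolding e(1) using k(1) by (subst integrable_horizontal_arc_iff[OF e(3)]) auto
  then have kL2: "k \<in> L2_on (arc_length e) UNIV"
    using k(1) by (simp add: L2_on_def set_borel_measurable_def set_integrable_def cong: measurable_cong_sets)
  have comp: "compact e" "closed e" by (simp_all add: e(1) closed_segment)
  have mh: "(\<lambda>x. indicat_real e x *\<^sub>R h x) \<in> borel_measurable borel"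
    using h comp by (intro borel_measurable_continuous_on_indicator borel_closed)
  have fin: "emeasure (arc_length e) e < \<infinity>"
    using finite_measure.emeasure_finite[OF finite_measure_arc_length, of e e] by (simp add: top.not_eq_extremum)
  have "set_integrable (arc_length e) e (\<lambda>x. k x * h x)"
  proof (rule L2_on_mult_integrable[OF kL2])
    show "set_integrable (arc_length e) e (\<lambda>x. (h x)\<^sup>2)"
      using comp fin by (intro set_integrable_bounded_continuous[where C = e] continuous_intros h) (auto intro: borel_closed)
    show "set_borel_measurable (arc_length e) e h"
      using mh by (simp add: set_borel_measurable_def cong: measurable_cong_sets)
  qed (use comp in \<open>auto intro: borel_closed\<close>)
  \<comment> \<open>On \<open>e\<close> the cut-off \<open>k\<close> and the data \<open>l0\<close>
    can differ only at the two corners.\<close>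
  moreover have "integrable (arc_length e) (\<lambda>x. indicat_real e x *\<^sub>R (k x * h x)) \<longleftrightarrow>
      integrable (arc_length e) (\<lambda>x. indicat_real e x *\<^sub>R (l0 x * h x))"
  proof (rule integrable_discrete_difference[where X = "{(L, 0), (R, 0)}"])
    show "emeasure (arc_length e) {x} = 0" for x
      unfolding e(1) by (rule emeasure_horizontal_arc_singleton[OF e(3)])
    fix x assume "x \<notin> {(L, 0), (R, 0::real)}"
    then have "x \<in> e \<Longrightarrow> x \<in> ?F"
      using e by (cases x) (auto simp: closed_segment_same_snd closed_segment_eq_real_ivl free_surface_def)
    then show "indicat_real e x *\<^sub>R (k x * h x) = indicat_real e x *\<^sub>R (l0 x * h x)"
      by (auto simp: k_def indicator_def)
  qed auto
  ultimately show ?thesis by (simp add: set_integrable_def)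
qed

section \<open>Discrete functions\<close>

definition dx1 :: "(spacetime \<Rightarrow> real) \<Rightarrow> spacetime \<Rightarrow> real" where
  "dx1 g = (\<lambda>(t, x, y). deriv (\<lambda>s. g (t, s, y)) x)"

definition dx2 :: "(spacetime \<Rightarrow> real) \<Rightarrow> spacetime \<Rightarrow> real" where
  "dx2 g = (\<lambda>(t, x, y). deriv (\<lambda>s. g (t, x, s)) y)"

lemma divergence_eq: "divergence g z = dx1 (\<lambda>z. fst (g z)) z + dx2 (\<lambda>z. snd (g z)) z"
  by (cases z) (simp add: divergence_def dx1_def dx2_def)

lemma element_polys_dx:
  assumes "g \<in> element_polys p"
  shows "dx1 g \<in> element_polys p" "dx2 g \<in> element_polys p"
    "((\<lambda>x. g (t, x)) has_derivative (\<lambda>v. dx1 g (t, x) * fst v + dx2 g (t, x) * snd v)) (at x)"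
proof -
  obtain g1 g2 where g: "g1 \<in> element_polys p" "g2 \<in> element_polys p"
    "\<And>t x. ((\<lambda>x. g (t, x)) has_derivative (\<lambda>v. g1 (t, x) * fst v + g2 (t, x) * snd v)) (at x)"
    using element_polys_gradient[OF assms] by blast
  have "dx1 g (t, x, y) = g1 (t, x, y)" for t x y
  proof -
    have "((\<lambda>s. g (t, s, y)) has_derivative (\<lambda>h. g1 (t, x, y) * fst (h, 0::real) + g2 (t, x, y) * snd (h, 0::real))) (at x)"
      by (rule has_derivative_compose[OF _ g(3)]) (auto intro!: derivative_eq_intros)
    then have "((\<lambda>s. g (t, s, y)) has_real_derivative g1 (t, x, y)) (at x)"
      by (simp add: has_field_derivative_def)
    then show ?thesis by (simp add: dx1_def DERIV_imp_deriv)
  qed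
  then have 1: "dx1 g = g1" by (auto simp: fun_eq_iff)
  have "dx2 g (t, x, y) = g2 (t, x, y)" for t x y
  proof -
    have "((\<lambda>s. g (t, x, s)) has_derivative (\<lambda>h. g1 (t, x, y) * fst (0::real, h) + g2 (t, x, y) * snd (0::real, h))) (at y)"
      by (rule has_derivative_compose[OF _ g(3)]) (auto intro!: derivative_eq_intros)
    then have "((\<lambda>s. g (t, x, s)) has_real_derivative g2 (t, x, y)) (at y)"
      by (simp add: has_field_derivative_def)
    then show ?thesis by (simp add: dx2_def DERIV_imp_deriv)
  qed
  then have 2: "dx2 g = g2" by (auto simp: fun_eq_iff)
  show "dx1 g \<in> element_polys p" "dx2 g \<in> element_polys p"
    "((\<lambda>x. g (t, x)) has_derivative (\<lambda>v. dx1 g (t, x) * fst v + dx2 g (t, x) * snd v)) (at x)"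
    using g by (simp_all add: 1 2)
qed

lemma has_derivative_plane_unique:
  fixes g :: "plane \<Rightarrow> real"
  assumes "(g has_derivative (\<lambda>v. a * fst v + b * snd v)) (at x)" "(g has_derivative (\<lambda>v. c * fst v + d * snd v)) (at x)"
  shows "a = c" "b = d"
proof -
  have "(\<lambda>v. a * fst v + b * snd v) = (\<lambda>v. c * fst v + d * snd v)"
    using assms by (rule has_derivative_unique)
  from fun_cong[OF this, of "(1, 0)"] fun_cong[OF this, of "(0, 1)"] show "a = c" "b = d" by simp_all
qed

lemma dx_add:
  assumes g: "g \<in> element_polys p" and h: "h \<in> element_polys p"
  shows "dx1 (\<lambda>z. g z + c * h z) z = dx1 g z + c * dx1 h z"
    "dx2 (\<lambda>z. g z + c * h z) z = dx2 g z + c * dx2 h z"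
proof -
  obtain t x where z: "z = (t, x)" by (cases z)
  have "((\<lambda>x. g (t, x) + c * h (t, x)) has_derivative
      (\<lambda>v. (dx1 g z * fst v + dx2 g z * snd v) + c * (dx1 h z * fst v + dx2 h z * snd v))) (at x)"
    unfolding z by (intro derivative_intros element_polys_dx(3)[OF g] element_polys_dx(3)[OF h])
  then have "((\<lambda>x. g (t, x) + c * h (t, x)) has_derivative
      (\<lambda>v. (dx1 g z + c * dx1 h z) * fst v + (dx2 g z + c * dx2 h z) * snd v)) (at x)"
    by (simp add: algebra_simps)
  from has_derivative_plane_unique[OF element_polys_dx(3)[OF element_polys_add[OF g h]] this]
  show "dx1 (\<lambda>z. g z + c * h z) z = dx1 g z + c * dx1 h z"
    "dx2 (\<lambda>z. g z + c * h z) z = dx2 g z + c * dx2 h z" unfolding z by simp_all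
qed

lemma dt_eqI:
  assumes "((\<lambda>s. g (s, x)) has_real_derivative D) (at t)"
  shows "dt g (t, x) = D"
  using assms by (simp add: dt_def has_real_derivative_iff_has_vector_derivative vector_derivative_at)

lemma element_polys_dt:
  assumes "g \<in> element_polys p"
  shows "continuous_on S (dt g)" "((\<lambda>s. g (s, x)) has_real_derivative dt g (t, x)) (at t)"
proof -
  obtain g' where g': "continuous_on UNIV g'"
    "\<And>t x. ((\<lambda>s. g (s, x)) has_real_derivative g' (t, x)) (at t)"
    using element_polys_time_derivative[OF assms] by blast
  have "dt g = g'" using dt_eqI[OF g'(2)] by (auto simp: fun_eq_iff)
  then show "continuous_on S (dt g)" "((\<lambda>s. g (s, x)) has_real_derivative dt g (t, x)) (at t)"
    using g' by (auto intro: continuous_on_subset)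
qed

lemma dt_element_add:
  assumes "g \<in> element_polys p" "h \<in> element_polys p"
  shows "dt (\<lambda>z. g z + c * h z) z = dt g z + c * dt h z"
proof -
  obtain t x where Pair: "z = (t, x)" by (cases z)
  have "((\<lambda>s. g (s, x) + c * h (s, x)) has_real_derivative dt g (t, x) + c * dt h (t, x)) (at t)"
    by (intro derivative_intros DERIV_cmult element_polys_dt(2)[OF assms(1)] element_polys_dt(2)[OF assms(2)])
  then show ?thesis unfolding Pair by (rule dt_eqI)
qed

lemma dt_Pair:
  assumes "g \<in> element_polys p" "h \<in> element_polys p"
  shows "dt (\<lambda>z. (g z, h z)) z = (dt g z, dt h z)"
proof -
  obtain t x where Pair: "z = (t, x)" by (cases z)
  have "((\<lambda>s. (g (s, x), h (s, x))) has_vector_derivative (dt g (t, x), dt h (t, x))) (at t)"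
    using element_polys_dt(2)[OF assms(1)] element_polys_dt(2)[OF assms(2)]
    by (intro has_vector_derivative_Pair) (simp_all add: has_real_derivative_iff_has_vector_derivative)
  then show ?thesis unfolding Pair by (simp add: dt_def vector_derivative_at)
qed

lemma face_polys_dt:
  assumes g: "g \<in> face_polys p e" and e: "e = closed_segment a b" "a \<noteq> b"
  shows "continuous_on (UNIV \<times> e) g" "continuous_on (UNIV \<times> e) (dt g)"
    "x \<in> e \<Longrightarrow> ((\<lambda>s. g (s, x)) has_real_derivative dt g (t, x)) (at t)"
proof -
  obtain g' where g': "continuous_on (UNIV \<times> e) g" "continuous_on UNIV g'"
    "\<And>t x. x \<in> e \<Longrightarrow> ((\<lambda>s. g (s, x)) has_real_derivative g' (t, x)) (at t)"
    using face_polys_smooth[OF g e] by blast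
  have eq: "dt g (t, x) = g' (t, x)" if "x \<in> e" for t x using dt_eqI[OF g'(3)[OF that]] .
  show "continuous_on (UNIV \<times> e) g" by (rule g'(1))
  have "continuous_on (UNIV \<times> e) g'" using g'(2) by (rule continuous_on_subset) simp
  then show "continuous_on (UNIV \<times> e) (dt g)" by (rule continuous_on_eq) (auto simp: eq)
  show "((\<lambda>s. g (s, x)) has_real_derivative dt g (t, x)) (at t)" if "x \<in> e"
    using g'(3)[OF that] eq[OF that] by simp
qed

text \<open>With symmetry, linearity in the first argument, shown below for each product, also
  serves for the second one.\<close>

lemma ip_elements_commute: "ip_elements \<T> I v w = ip_elements \<T> I w v"
  by (simp add: ip_elements_def inner_commute)

lemma ip_time_commute: "ip_time \<T> s v w = ip_time \<T> s w v"
  by (simp add: ip_time_def inner_commute)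

lemma ip_lateral_commute: "ip_lateral \<T> I v w = ip_lateral \<T> I w v"
  by (simp add: ip_lateral_def mult.commute)

lemma ip_surface_commute: "ip_surface \<T> I v w = ip_surface \<T> I w v"
  by (simp add: ip_surface_def mult.commute)

lemma ip_surface_time_commute: "ip_surface_time \<T> s v w = ip_surface_time \<T> s w v"
  by (simp add: ip_surface_time_def mult.commute)

lemma set_integral_linear:
  fixes f g h :: "'a \<Rightarrow> real"
  assumes "set_integrable M A g" "set_integrable M A h" "A \<in> sets M"
    and "\<And>x. x \<in> A \<Longrightarrow> f x = g x + c * h x"
  shows "(LINT x:A|M. f x) = (LINT x:A|M. g x) + c * (LINT x:A|M. h x)"
proof -
  have "(LINT x:A|M. f x) = (LINT x:A|M. g x + c * h x)"
    using assms(3,4) by (intro set_lebesgue_integral_cong) auto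
  also have "\<dots> = (LINT x:A|M. g x) + (LINT x:A|M. c * h x)"
    using assms(1,2) by (intro set_integral_add(2)) auto
  finally show ?thesis by simp
qed

locale hdg_slab = water_mesh +
  fixes t0 t1 \<alpha> :: real and p :: nat and \<tau> :: "plane set \<Rightarrow> real"
    and q0 :: "plane \<Rightarrow> plane" and l0 :: "plane \<Rightarrow> real"
  assumes t01: "t0 < t1" and \<alpha>_pos: "0 < \<alpha>" and \<tau>_pos: "\<And>K. K \<in> \<T> \<Longrightarrow> 0 < \<tau> K"
    and q0: "q0 \<in> vec_space (L2_on lborel \<Omega>)"
    and l0: "l0 \<in> L2_on (arc_length (closure (free_surface L R))) (free_surface L R)"
begin

abbreviation "I \<equiv> {t0<..<t1}"
abbreviation "W \<equiv> W_space p \<Omega> \<T> I"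
abbreviation "V \<equiv> V_space p \<Omega> \<T> I"
abbreviation "M \<equiv> M_space p L R \<T> I"
abbreviation "f z \<equiv> weight \<alpha> t0 (fst z)"
abbreviation "f' z \<equiv> deriv (weight \<alpha> t0) (fst z)"

lemma slab_element: "K \<in> \<T> \<Longrightarrow> slab lborel (interior K) K t0 t1"
proof unfold_locales
  assume K: "K \<in> \<T>"
  have "emeasure lborel (interior K) \<le> emeasure lborel K"
    using compact_element[OF K] by (intro emeasure_mono) (auto simp: interior_subset borel_compact)
  then show "emeasure lborel (interior K) < \<infinity>"
    using emeasure_bounded_finite[OF compact_imp_bounded[OF compact_element[OF K]]] by (rule le_less_trans)
  show "compact K" using K by (rule compact_element)
qed (auto simp: t01 interior_subset intro: lborel.sigma_finite_measure_axioms sigma_finite_measure.sigma_finite_countable)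

lemma slab_edge: "e \<in> mesh_edges \<T> \<Longrightarrow> slab (arc_length e) e e t0 t1"
proof (rule slab.intro)
  assume "e \<in> mesh_edges \<T>"
  then obtain u v where "e = closed_segment u v" by (rule edge_segment)
  then show "e \<in> sets borel" "compact e" by (auto simp: borel_closed)
  show "emeasure (arc_length e) e < \<infinity>"
    using finite_measure.emeasure_finite[OF finite_measure_arc_length, of e e] by (simp add: top.not_eq_extremum)
qed (auto simp: t01 intro: sigma_finite_arc_length)

lemma integrable_element:
  assumes "K \<in> \<T>" "continuous_on (UNIV \<times> K) (g :: spacetime \<Rightarrow> real)"
  shows "set_integrable lborel (I \<times> interior K) g"
  using slab.set_integrable_slab[OF slab_element[OF assms(1)] assms(2)] unfolding lborel_prod .

lemma integrable_element_time:
  assumes "K \<in> \<T>" "continuous_on K (g :: plane \<Rightarrow> real)"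
  shows "set_integrable lborel (interior K) g"
  by (rule slab.set_integrable_section[OF slab_element[OF assms(1)] assms(2)])

lemma integrable_face:
  assumes "e \<in> mesh_edges \<T>" "continuous_on (UNIV \<times> e) (g :: spacetime \<Rightarrow> real)"
  shows "set_integrable (face_measure e) (I \<times> e) g"
  using slab.set_integrable_slab[OF slab_edge[OF assms(1)] assms(2)] unfolding face_measure_def .

lemma integrable_face_time:
  assumes "e \<in> mesh_edges \<T>" "continuous_on e (g :: plane \<Rightarrow> real)"
  shows "set_integrable (arc_length e) e g"
  by (rule slab.set_integrable_section[OF slab_edge[OF assms(1)] assms(2)])

lemma slab_element_sets [measurable]: "I \<times> interior K \<in> sets (lborel :: spacetime measure)"
  using pair_measureI[of I borel "interior K" borel] unfolding borel_prod by simp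

lemma slab_face_sets: "e \<in> mesh_edges \<T> \<Longrightarrow> I \<times> e \<in> sets (face_measure e)"
  unfolding face_measure_def by (intro pair_measureI) (auto elim!: edge_segment simp: borel_closed)

lemma surface_edge_mesh: "e \<in> surface_edges \<T> \<Longrightarrow> e \<in> mesh_edges \<T>"
  by (simp add: surface_edges_def)

lemma edge_mesh: "K \<in> \<T> \<Longrightarrow> e \<in> edges K \<Longrightarrow> e \<in> mesh_edges \<T>"
  by (auto simp: mesh_edges_def)

section \<open>Linearity of the discrete inner products\<close>

lemma ip_elements_linear:
  fixes u :: "plane set \<Rightarrow> spacetime \<Rightarrow> 'a::real_inner"
  assumes "\<And>K. K \<in> \<T> \<Longrightarrow> continuous_on UNIV (u K)" "\<And>K. K \<in> \<T> \<Longrightarrow> continuous_on UNIV (v K)"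
    "\<And>K. K \<in> \<T> \<Longrightarrow> continuous_on UNIV (w K)"
    and "\<And>K z. K \<in> \<T> \<Longrightarrow> x K z = u K z + c *\<^sub>R v K z"
  shows "ip_elements \<T> I x w = ip_elements \<T> I u w + c * ip_elements \<T> I v w"
proof -
  have "(LINT z:I \<times> interior K|lborel. x K z \<bullet> w K z) =
      (LINT z:I \<times> interior K|lborel. u K z \<bullet> w K z) + c * (LINT z:I \<times> interior K|lborel. v K z \<bullet> w K z)"
    if K: "K \<in> \<T>" for K
    using assms(4)[OF K] continuous_on_subset[OF assms(1)[OF K]] continuous_on_subset[OF assms(2)[OF K]]
      continuous_on_subset[OF assms(3)[OF K]]
    by (intro set_integral_linear integrable_element[OF K] continuous_on_inner slab_element_sets)
      (auto simp: inner_add_left)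
  then show ?thesis by (simp add: ip_elements_def sum.distrib sum_distrib_left)
qed

lemma ip_time_linear:
  fixes u :: "plane set \<Rightarrow> spacetime \<Rightarrow> 'a::real_inner"
  assumes "\<And>K. K \<in> \<T> \<Longrightarrow> continuous_on UNIV (u K)" "\<And>K. K \<in> \<T> \<Longrightarrow> continuous_on UNIV (v K)"
    "\<And>K. K \<in> \<T> \<Longrightarrow> continuous_on UNIV (w K)"
    and "\<And>K z. K \<in> \<T> \<Longrightarrow> x K z = u K z + c *\<^sub>R v K z"
  shows "ip_time \<T> s x w = ip_time \<T> s u w + c * ip_time \<T> s v w"
proof -
  have cont: "continuous_on K (\<lambda>x. g (s, x))" if "continuous_on UNIV g" for g :: "spacetime \<Rightarrow> 'a" and K
    using that by (rule continuous_on_compose2) (auto intro!: continuous_intros)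
  have "(LINT y:interior K|lborel. x K (s, y) \<bullet> w K (s, y)) =
      (LINT y:interior K|lborel. u K (s, y) \<bullet> w K (s, y)) + c * (LINT y:interior K|lborel. v K (s, y) \<bullet> w K (s, y))"
    if K: "K \<in> \<T>" for K
    using assms(4)[OF K]
    by (intro set_integral_linear integrable_element_time[OF K] continuous_on_inner cont assms(1-3)[OF K])
      (auto simp: inner_add_left)
  then show ?thesis by (simp add: ip_time_def sum.distrib sum_distrib_left)
qed

lemma ip_lateral_linear:
  assumes "\<And>K e. K \<in> \<T> \<Longrightarrow> e \<in> edges K \<Longrightarrow> continuous_on (UNIV \<times> e) (u K e)"
    "\<And>K e. K \<in> \<T> \<Longrightarrow> e \<in> edges K \<Longrightarrow> continuous_on (UNIV \<times> e) (v K e)"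
    "\<And>K e. K \<in> \<T> \<Longrightarrow> e \<in> edges K \<Longrightarrow> continuous_on (UNIV \<times> e) (w K e)"
    and "\<And>K e z. K \<in> \<T> \<Longrightarrow> e \<in> edges K \<Longrightarrow> snd z \<in> e \<Longrightarrow> x K e z = u K e z + c * v K e z"
  shows "ip_lateral \<T> I x w = ip_lateral \<T> I u w + c * ip_lateral \<T> I v w"
proof -
  have "(LINT z:I \<times> e|face_measure e. x K e z * w K e z) =
      (LINT z:I \<times> e|face_measure e. u K e z * w K e z) + c * (LINT z:I \<times> e|face_measure e. v K e z * w K e z)"
    if K: "K \<in> \<T>" "e \<in> edges K" for K e
    using assms(4)[OF K]
    by (intro set_integral_linear integrable_face slab_face_sets edge_mesh[OF K] continuous_on_mult assms(1-3)[OF K])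
      (auto simp: algebra_simps)
  then show ?thesis by (simp add: ip_lateral_def sum.distrib sum_distrib_left)
qed

lemma ip_surface_linear:
  assumes "\<And>e. e \<in> mesh_edges \<T> \<Longrightarrow> continuous_on (UNIV \<times> e) (u e)"
    "\<And>e. e \<in> mesh_edges \<T> \<Longrightarrow> continuous_on (UNIV \<times> e) (v e)"
    "\<And>e. e \<in> mesh_edges \<T> \<Longrightarrow> continuous_on (UNIV \<times> e) (w e)"
    and "\<And>e z. e \<in> mesh_edges \<T> \<Longrightarrow> snd z \<in> e \<Longrightarrow> x e z = u e z + c * v e z"
  shows "ip_surface \<T> I x w = ip_surface \<T> I u w + c * ip_surface \<T> I v w"
proof -
  have "(LINT z:I \<times> e|face_measure e. x e z * w e z) =
      (LINT z:I \<times> e|face_measure e. u e z * w e z) + c * (LINT z:I \<times> e|face_measure e. v e z * w e z)"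
    if "e \<in> surface_edges \<T>" for e
    using assms(4)[OF surface_edge_mesh[OF that]]
    by (intro set_integral_linear integrable_face slab_face_sets surface_edge_mesh[OF that] continuous_on_mult
        assms(1-3)[OF surface_edge_mesh[OF that]]) (auto simp: algebra_simps)
  then show ?thesis by (simp add: ip_surface_def sum.distrib sum_distrib_left)
qed

lemma ip_surface_time_linear:
  assumes "\<And>e. e \<in> mesh_edges \<T> \<Longrightarrow> continuous_on (UNIV \<times> e) (u e)"
    "\<And>e. e \<in> mesh_edges \<T> \<Longrightarrow> continuous_on (UNIV \<times> e) (v e)"
    "\<And>e. e \<in> mesh_edges \<T> \<Longrightarrow> continuous_on (UNIV \<times> e) (w e)"
    and "\<And>e z. e \<in> mesh_edges \<T> \<Longrightarrow> snd z \<in> e \<Longrightarrow> x e z = u e z + c * v e z"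
  shows "ip_surface_time \<T> s x w = ip_surface_time \<T> s u w + c * ip_surface_time \<T> s v w"
proof -
  have cont: "continuous_on e (\<lambda>x. g (s, x))" if "continuous_on (UNIV \<times> e) g" for g :: "spacetime \<Rightarrow> real" and e
    using that by (rule continuous_on_compose2) (auto intro!: continuous_intros)
  have "(LINT y:e|arc_length e. x e (s, y) * w e (s, y)) =
      (LINT y:e|arc_length e. u e (s, y) * w e (s, y)) + c * (LINT y:e|arc_length e. v e (s, y) * w e (s, y))"
    if "e \<in> surface_edges \<T>" for e
    using assms(4)[OF surface_edge_mesh[OF that]] surface_edge_mesh[OF that]
    by (intro set_integral_linear integrable_face_time surface_edge_mesh[OF that] continuous_on_mult cont
        assms(1-3)[OF surface_edge_mesh[OF that]]) (auto simp: algebra_simps elim!: edge_segment intro: borel_closed)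
  then show ?thesis by (simp add: ip_surface_time_def sum.distrib sum_distrib_left)
qed

text \<open>Two polynomials that agree almost everywhere over the nonempty interior of
  \<open>K\<close> are equal, so the choice in \<open>elem_rep\<close> has only one
  candidate.\<close>

lemma elem_rep_eqI:
  assumes K: "K \<in> \<T>" and g: "g \<in> element_polys p" "ae_eq_on lborel (I \<times> interior K) w g"
  shows "elem_rep p I w K = g"
proof -
  let ?r = "elem_rep p I w K"
  have "?r \<in> element_polys p \<and> ae_eq_on lborel (I \<times> interior K) w ?r"
    unfolding elem_rep_def by (rule someI[of _ g]) (use g in simp)
  then have r: "?r \<in> element_polys p" "ae_eq_on lborel (I \<times> interior K) w ?r" by auto
  have "AE z in lborel. z \<in> I \<times> interior K \<longrightarrow> ?r z + (- 1) * g z = 0"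
    using r(2) g(2) unfolding ae_eq_on_def by eventually_elim auto
  from element_polys_AE_0[OF element_polys_add[OF r(1) g(1)] open_interior interior_element_nonempty[OF K] t01 this]
  show ?thesis by (simp add: fun_eq_iff)
qed

lemma elem_rep:
  assumes "w \<in> W" "K \<in> \<T>"
  shows "elem_rep p I w K \<in> element_polys p" "ae_eq_on lborel (I \<times> interior K) w (elem_rep p I w K)"
proof -
  obtain g where "g \<in> element_polys p" "ae_eq_on lborel (I \<times> interior K) w g"
    using assms by (auto simp: W_space_def)
  then show "elem_rep p I w K \<in> element_polys p" "ae_eq_on lborel (I \<times> interior K) w (elem_rep p I w K)"
    using elem_rep_eqI[OF assms(2)] by simp_all
qed

lemma elem_rep_add:
  assumes "v \<in> W" "w \<in> W" "K \<in> \<T>"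
  shows "elem_rep p I (\<lambda>z. v z + c * w z) K = (\<lambda>z. elem_rep p I v K z + c * elem_rep p I w K z)"
proof (rule elem_rep_eqI[OF assms(3)])
  show "(\<lambda>z. elem_rep p I v K z + c * elem_rep p I w K z) \<in> element_polys p"
    using assms by (intro element_polys_add elem_rep)
  show "ae_eq_on lborel (I \<times> interior K) (\<lambda>z. v z + c * w z) (\<lambda>z. elem_rep p I v K z + c * elem_rep p I w K z)"
    using elem_rep(2)[OF assms(1,3)] elem_rep(2)[OF assms(2,3)] unfolding ae_eq_on_def
    by eventually_elim auto
qed

lemma W_add:
  assumes "v \<in> W" "w \<in> W"
  shows "(\<lambda>z. v z + c * w z) \<in> W"
  unfolding W_space_def
proof (intro CollectI conjI ballI)
  show "(\<lambda>z. v z + c * w z) \<in> L2_on lborel (I \<times> \<Omega>)"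
    using assms by (intro L2_on_add) (auto simp: W_space_def)
  fix K assume K: "K \<in> \<T>"
  have "ae_eq_on lborel (I \<times> interior K) (\<lambda>z. v z + c * w z) (\<lambda>z. elem_rep p I v K z + c * elem_rep p I w K z)"
    using elem_rep(2)[OF assms(1) K] elem_rep(2)[OF assms(2) K] unfolding ae_eq_on_def
    by eventually_elim auto
  moreover have "(\<lambda>z. elem_rep p I v K z + c * elem_rep p I w K z) \<in> element_polys p"
    using assms K by (intro element_polys_add elem_rep)
  ultimately show "\<exists>g\<in>element_polys p. ae_eq_on lborel (I \<times> interior K) (\<lambda>z. v z + c * w z) g"
    by (rule bexI)
qed

lemma W_0: "(\<lambda>z. 0) \<in> W"
  by (auto simp: W_space_def L2_on_0 ae_eq_on_def intro!: bexI[OF _ element_polys_0])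

lemma elem_rep_0: "K \<in> \<T> \<Longrightarrow> elem_rep p I (\<lambda>z. 0) K = (\<lambda>z. 0)"
  by (rule elem_rep_eqI) (auto simp: ae_eq_on_def element_polys_0)

text \<open>No continuity across edges is required in the discrete space, so a polynomial on one
  element extends by zero. This supplies test functions supported on a single element.\<close>

lemma W_indicator:
  assumes K: "K \<in> \<T>" and g: "g \<in> element_polys p"
  shows "(\<lambda>z. indicator (interior K) (snd z) * g z) \<in> W"
    and "elem_rep p I (\<lambda>z. indicator (interior K) (snd z) * g z) K = g"
    and "K' \<in> \<T> \<Longrightarrow> K' \<noteq> K \<Longrightarrow> elem_rep p I (\<lambda>z. indicator (interior K) (snd z) * g z) K' = (\<lambda>z. 0)"
proof -
  let ?w = "\<lambda>z. indicat_real (interior K) (snd z) * g z"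
  have 1: "ae_eq_on lborel (I \<times> interior K) ?w g" by (auto simp: ae_eq_on_def)
  have 2: "ae_eq_on lborel (I \<times> interior K') ?w (\<lambda>z. 0)" if "K' \<in> \<T>" "K' \<noteq> K" for K'
    using disjoint_interiors[OF K that(1)] that(2) unfolding ae_eq_on_def
    by (intro AE_I2) (auto simp: indicator_def)
  show "elem_rep p I ?w K = g" by (rule elem_rep_eqI[OF K g 1])
  show "K' \<in> \<T> \<Longrightarrow> K' \<noteq> K \<Longrightarrow> elem_rep p I ?w K' = (\<lambda>z. 0)"
    by (rule elem_rep_eqI[OF _ element_polys_0 2])
  have cont: "continuous_on S g" for S by (rule element_polys_continuous[OF g])
  have [measurable]: "g \<in> borel_measurable borel" by (rule borel_measurable_continuous_onI[OF cont])
  have [measurable]: "(\<lambda>z. indicat_real (interior K) (snd z)) \<in> borel_measurable (borel :: spacetime measure)"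
    by (rule measurable_compose[of snd borel borel])
      (auto intro!: borel_measurable_continuous_onI continuous_intros borel_measurable_indicator)
  have [measurable]: "I \<times> \<Omega> \<in> sets (borel :: spacetime measure)"
    using pair_measureI[of I borel \<Omega> borel] open_domain unfolding borel_prod by simp
  have "?w \<in> L2_on lborel (I \<times> \<Omega>)"
    unfolding L2_on_def set_borel_measurable_def
  proof (intro CollectI conjI)
    show "(\<lambda>x. indicat_real (I \<times> \<Omega>) x *\<^sub>R ?w x) \<in> borel_measurable lborel" by measurable
    have "set_integrable lborel (I \<times> interior K) (\<lambda>z. (g z)\<^sup>2)"
      by (intro integrable_element[OF K] continuous_intros cont)
    moreover have "indicat_real (I \<times> interior K) z * (g z)\<^sup>2 = indicat_real (I \<times> \<Omega>) z * (?w z)\<^sup>2" for z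
      using interior_element_subset[OF K] by (auto simp: indicator_def)
    ultimately show "set_integrable lborel (I \<times> \<Omega>) (\<lambda>z. (?w z)\<^sup>2)"
      by (simp add: set_integrable_def)
  qed
  moreover have "\<exists>g\<in>element_polys p. ae_eq_on lborel (I \<times> interior K') ?w g" if "K' \<in> \<T>" for K'
    using 1 2[OF that] g element_polys_0 by (cases "K' = K") blast+
  ultimately show "?w \<in> W" by (simp add: W_space_def)
qed

text \<open>Only the values over \<open>e\<close> are determined, unlike for elements, because a
  face polynomial is arbitrary off the edge. Statements about face representatives are therefore
  pointwise on \<open>e\<close>.\<close>

lemma face_rep_eqI:
  assumes e: "e \<in> mesh_edges \<T>" and g: "g \<in> face_polys p e" "ae_eq_on (face_measure e) (I \<times> e) \<mu> g"
    and x: "x \<in> e"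
  shows "face_rep p I \<mu> e (t, x) = g (t, x)"
proof -
  let ?r = "face_rep p I \<mu> e"
  obtain u v where uv: "e = closed_segment u v" "u \<noteq> v" using edge_segment[OF e] .
  have "?r \<in> face_polys p e \<and> ae_eq_on (face_measure e) (I \<times> e) \<mu> ?r"
    unfolding face_rep_def by (rule someI[of _ g]) (use g in simp)
  then have r: "?r \<in> face_polys p e" "ae_eq_on (face_measure e) (I \<times> e) \<mu> ?r" by auto
  have "AE z in face_measure e. z \<in> I \<times> e \<longrightarrow> ?r z + (- 1) * g z = 0"
    using r(2) g(2) unfolding ae_eq_on_def by eventually_elim auto
  from face_polys_AE_0[OF face_polys_add[OF r(1) g(1)] uv t01 this x]
  show ?thesis by simp
qed

lemma face_rep:
  assumes "\<mu> \<in> M" "e \<in> mesh_edges \<T>"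
  shows "face_rep p I \<mu> e \<in> face_polys p e" "ae_eq_on (face_measure e) (I \<times> e) \<mu> (face_rep p I \<mu> e)"
proof -
  obtain g where "g \<in> face_polys p e \<and> ae_eq_on (face_measure e) (I \<times> e) \<mu> g"
    using assms by (auto simp: M_space_def)
  then have "face_rep p I \<mu> e \<in> face_polys p e \<and> ae_eq_on (face_measure e) (I \<times> e) \<mu> (face_rep p I \<mu> e)"
    unfolding face_rep_def by (rule someI[of _ g])
  then show "face_rep p I \<mu> e \<in> face_polys p e" "ae_eq_on (face_measure e) (I \<times> e) \<mu> (face_rep p I \<mu> e)"
    by auto
qed

lemma face_rep_add:
  assumes "\<mu> \<in> M" "\<nu> \<in> M" "e \<in> mesh_edges \<T>" "x \<in> e"
  shows "face_rep p I (\<lambda>z. \<mu> z + c * \<nu> z) e (t, x) = face_rep p I \<mu> e (t, x) + c * face_rep p I \<nu> e (t, x)"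
proof (rule face_rep_eqI[OF assms(3) _ _ assms(4)])
  show "(\<lambda>z. face_rep p I \<mu> e z + c * face_rep p I \<nu> e z) \<in> face_polys p e"
    using assms by (intro face_polys_add face_rep)
  show "ae_eq_on (face_measure e) (I \<times> e) (\<lambda>z. \<mu> z + c * \<nu> z) (\<lambda>z. face_rep p I \<mu> e z + c * face_rep p I \<nu> e z)"
    using face_rep(2)[OF assms(1,3)] face_rep(2)[OF assms(2,3)] unfolding ae_eq_on_def
    by eventually_elim auto
qed

lemma M_add:
  assumes "\<mu> \<in> M" "\<nu> \<in> M"
  shows "(\<lambda>z. \<mu> z + c * \<nu> z) \<in> M"
  unfolding M_space_def
proof (intro CollectI conjI ballI)
  fix e assume e: "e \<in> mesh_edges \<T>"
  show "(\<lambda>z. \<mu> z + c * \<nu> z) \<in> L2_on (face_measure e) (I \<times> e)"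
    using assms e by (intro L2_on_add) (auto simp: M_space_def)
  have "ae_eq_on (face_measure e) (I \<times> e) (\<lambda>z. \<mu> z + c * \<nu> z) (\<lambda>z. face_rep p I \<mu> e z + c * face_rep p I \<nu> e z)"
    using face_rep(2)[OF assms(1) e] face_rep(2)[OF assms(2) e] unfolding ae_eq_on_def
    by eventually_elim auto
  moreover have "(\<lambda>z. face_rep p I \<mu> e z + c * face_rep p I \<nu> e z) \<in> face_polys p e"
    using assms e by (intro face_polys_add face_rep)
  ultimately show "\<exists>g\<in>face_polys p e. ae_eq_on (face_measure e) (I \<times> e) (\<lambda>z. \<mu> z + c * \<nu> z) g"
    by (rule bexI)
next
  fix e assume "e \<in> vertical_edges \<T> L"
  then have "ae_eq_on (face_measure e) (I \<times> e) (\<lambda>z. \<mu> (z + (0, R - L, 0))) \<mu>"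
    "ae_eq_on (face_measure e) (I \<times> e) (\<lambda>z. \<nu> (z + (0, R - L, 0))) \<nu>"
    using assms by (auto simp: M_space_def)
  then show "ae_eq_on (face_measure e) (I \<times> e) (\<lambda>z. \<mu> (z + (0, R - L, 0)) + c * \<nu> (z + (0, R - L, 0))) (\<lambda>z. \<mu> z + c * \<nu> z)"
    unfolding ae_eq_on_def by eventually_elim auto
qed

lemma face_polys_mesh_0: "e \<in> mesh_edges \<T> \<Longrightarrow> (\<lambda>z. 0) \<in> face_polys p e"
  by (rule edge_segment) (auto intro: face_polys_0)

lemma M_0: "(\<lambda>z. 0) \<in> M"
  by (auto simp: M_space_def L2_on_0 ae_eq_on_def intro!: bexI[OF _ face_polys_mesh_0])

lemma face_rep_0: "e \<in> mesh_edges \<T> \<Longrightarrow> x \<in> e \<Longrightarrow> face_rep p I (\<lambda>z. 0) e (t, x) = 0"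
  using face_rep_eqI[of e "\<lambda>z. 0" "\<lambda>z. 0" x t] face_polys_mesh_0 by (simp add: ae_eq_on_def)

end

section \<open>The bilinear form\<close>

text \<open>Along an affine parametrization a monomial of total degree i + j has degree at most i +
  j <= p in the edge parameter; \<open>P k\<close> collects the coefficient of t^k. Hence v -
  \<lambda> is a face polynomial and vanishes on a face once it does so almost everywhere.\<close>

lemma element_polys_subset_face_polys:
  assumes g: "g \<in> element_polys p" and e: "e = closed_segment a b"
  shows "g \<in> face_polys p e"
proof -
  obtain c where c: "\<And>t x y. g (t, x, y) = (\<Sum>k\<le>p. \<Sum>i\<le>p. \<Sum>j\<le>p - i. c k i j * t ^ k * x ^ i * y ^ j)"
    using g by (auto simp: element_polys_def)
  define P where "P k = (\<Sum>i\<le>p. \<Sum>j\<le>p - i. smult (c k i j) ([:fst a, fst (b - a):] ^ i * [:snd a, snd (b - a):] ^ j))" for k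
  have deg: "degree (P k) \<le> p" for k
    unfolding P_def
  proof (intro degree_sum_le)
    fix i j assume ij: "i \<in> {..p}" "j \<in> {..p - i}"
    have lin: "degree ([:u, v:] ^ n) \<le> n" for u v :: real and n
      using degree_power_le[of "[:u, v:]" n] by (auto intro: order.trans)
    have "degree (smult (c k i j) ([:fst a, fst (b - a):] ^ i * [:snd a, snd (b - a):] ^ j))
        \<le> degree ([:fst a, fst (b - a):] ^ i * [:snd a, snd (b - a):] ^ j)"
      by (rule degree_smult_le)
    also have "\<dots> \<le> degree ([:fst a, fst (b - a):] ^ i) + degree ([:snd a, snd (b - a):] ^ j)"
      by (rule degree_mult_le)
    also have "\<dots> \<le> i + j" by (intro add_mono lin)
    finally show "degree (smult (c k i j) ([:fst a, fst (b - a):] ^ i * [:snd a, snd (b - a):] ^ j)) \<le> p"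
      using ij by simp
  qed auto
  have "g (t, a + s *\<^sub>R (b - a)) = (\<Sum>k\<le>p. \<Sum>j\<le>p. coeff (P k) j * t ^ k * s ^ j)" for t s
  proof -
    have "poly (P k) s = (\<Sum>j\<le>p. coeff (P k) j * s ^ j)" for k
      unfolding poly_altdef using deg[of k] by (intro sum.mono_neutral_left) (auto simp: coeff_eq_0)
    moreover have "poly (P k) s = (\<Sum>i\<le>p. \<Sum>j\<le>p - i. c k i j * (fst a + s * fst (b - a)) ^ i * (snd a + s * snd (b - a)) ^ j)" for k
      by (simp add: P_def poly_sum mult.assoc)
    moreover have "g (t, a + s *\<^sub>R (b - a)) =
        (\<Sum>k\<le>p. t ^ k * (\<Sum>i\<le>p. \<Sum>j\<le>p - i. c k i j * (fst a + s * fst (b - a)) ^ i * (snd a + s * snd (b - a)) ^ j))"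
    proof -
      have "a + s *\<^sub>R (b - a) = (fst a + s * fst (b - a), snd a + s * snd (b - a))" by (rule prod_eqI) simp_all
      then show ?thesis unfolding c[symmetric] by (simp only: c) (simp add: sum_distrib_left mult_ac)
    qed
    ultimately show ?thesis by (simp add: sum_distrib_left mult_ac)
  qed
  then show ?thesis
    unfolding face_polys_def using e
    by (intro CollectI exI[of _ a] exI[of _ b] exI[of _ "\<lambda>k. coeff (P k)"]) simp
qed

type_synonym discrete_triple = "(spacetime \<Rightarrow> plane) \<times> (spacetime \<Rightarrow> real) \<times> (spacetime \<Rightarrow> real)"

context hdg_slab begin

definition X :: "discrete_triple set" where
  "X = V \<times> W \<times> M"

abbreviation "rq x \<equiv> elem_rep_vec p I (fst x)"
abbreviation "rv x \<equiv> elem_rep p I (fst (snd x))"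
abbreviation "rl x \<equiv> face_rep p I (snd (snd x))"

definition comb where
  "comb x c y = (\<lambda>z. fst x z + c *\<^sub>R fst y z, \<lambda>z. fst (snd x) z + c * fst (snd y) z,
     \<lambda>z. snd (snd x) z + c * snd (snd y) z)"

lemma rq_rep:
  assumes "x \<in> X" "K \<in> \<T>"
  obtains g h where "g \<in> element_polys p" "h \<in> element_polys p" "rq x K = (\<lambda>z. (g z, h z))"
    "g = elem_rep p I (\<lambda>z. fst (fst x z)) K" "h = elem_rep p I (\<lambda>z. snd (fst x z)) K"
  using assms elem_rep(1)[of "\<lambda>z. fst (fst x z)" K] elem_rep(1)[of "\<lambda>z. snd (fst x z)" K]
  by (auto simp: X_def V_space_def vec_space_def elem_rep_vec_def)

lemma rv_rep: "x \<in> X \<Longrightarrow> K \<in> \<T> \<Longrightarrow> rv x K \<in> element_polys p"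
  by (rule elem_rep) (auto simp: X_def)

lemma rl_rep: "x \<in> X \<Longrightarrow> e \<in> mesh_edges \<T> \<Longrightarrow> rl x e \<in> face_polys p e"
  by (rule face_rep) (auto simp: X_def)

lemma comb_X:
  assumes "x \<in> X" "y \<in> X"
  shows "comb x c y \<in> X"
  using assms by (auto simp: X_def comb_def V_space_def vec_space_def intro!: W_add M_add)

lemma divergence_Pair: "divergence (\<lambda>z. (g z, h z)) z = dx1 g z + dx2 h z"
  by (simp add: divergence_eq)

lemma continuous_rq:
  assumes "x \<in> X" "K \<in> \<T>"
  shows "continuous_on S (rq x K)" "continuous_on S (dt (rq x K))" "continuous_on S (divergence (rq x K))"
proof -
  obtain g h where gh: "g \<in> element_polys p" "h \<in> element_polys p" "rq x K = (\<lambda>z. (g z, h z))"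
    by (rule rq_rep[OF assms])
  have "dt (rq x K) = (\<lambda>z. (dt g z, dt h z))" unfolding gh(3) using dt_Pair[OF gh(1,2)] by (simp add: fun_eq_iff)
  moreover have "divergence (rq x K) = (\<lambda>z. dx1 g z + dx2 h z)"
    unfolding gh(3) divergence_Pair ..
  ultimately show "continuous_on S (rq x K)" "continuous_on S (dt (rq x K))" "continuous_on S (divergence (rq x K))"
    unfolding gh(3)
    by (auto intro!: continuous_intros element_polys_continuous[OF gh(1)] element_polys_continuous[OF gh(2)]
        element_polys_dt(1)[OF gh(1)] element_polys_dt(1)[OF gh(2)]
        element_polys_continuous[OF element_polys_dx(1)[OF gh(1)]]
        element_polys_continuous[OF element_polys_dx(2)[OF gh(2)]])
qed

lemma continuous_rv: "x \<in> X \<Longrightarrow> K \<in> \<T> \<Longrightarrow> continuous_on S (rv x K)"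
  by (rule element_polys_continuous[OF rv_rep])

lemma continuous_rl:
  assumes "x \<in> X" "e \<in> mesh_edges \<T>"
  shows "continuous_on (UNIV \<times> e) (rl x e)" "continuous_on (UNIV \<times> e) (dt (rl x e))"
proof -
  obtain u v where "e = closed_segment u v" "u \<noteq> v" using edge_segment[OF assms(2)] .
  from face_polys_dt[OF rl_rep[OF assms] this]
  show "continuous_on (UNIV \<times> e) (rl x e)" "continuous_on (UNIV \<times> e) (dt (rl x e))" by simp_all
qed

lemma rq_comb:
  assumes "x \<in> X" "y \<in> X" "K \<in> \<T>"
  shows "rq (comb x c y) K z = rq x K z + c *\<^sub>R rq y K z"
    "dt (rq (comb x c y) K) z = dt (rq x K) z + c *\<^sub>R dt (rq y K) z"
    "divergence (rq (comb x c y) K) z = divergence (rq x K) z + c * divergence (rq y K) z"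
proof -
  obtain g h where gh: "g \<in> element_polys p" "h \<in> element_polys p" "rq x K = (\<lambda>z. (g z, h z))"
    "g = elem_rep p I (\<lambda>z. fst (fst x z)) K" "h = elem_rep p I (\<lambda>z. snd (fst x z)) K"
    by (rule rq_rep[OF assms(1,3)])
  obtain g' h' where gh': "g' \<in> element_polys p" "h' \<in> element_polys p" "rq y K = (\<lambda>z. (g' z, h' z))"
    "g' = elem_rep p I (\<lambda>z. fst (fst y z)) K" "h' = elem_rep p I (\<lambda>z. snd (fst y z)) K"
    by (rule rq_rep[OF assms(2,3)])
  have rq: "rq (comb x c y) K = (\<lambda>z. (g z + c * g' z, h z + c * h' z))"
    using assms unfolding elem_rep_vec_def gh(4,5) gh'(4,5)
    by (simp add: comb_def X_def V_space_def vec_space_def mem_Times_iff elem_rep_add)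
  show "rq (comb x c y) K z = rq x K z + c *\<^sub>R rq y K z"
    unfolding rq gh(3) gh'(3) by simp
  show "dt (rq (comb x c y) K) z = dt (rq x K) z + c *\<^sub>R dt (rq y K) z"
    unfolding rq gh(3) gh'(3) using gh(1,2) gh'(1,2)
    by (simp add: dt_Pair[where p = p] dt_element_add[where p = p] element_polys_add)
  show "divergence (rq (comb x c y) K) z = divergence (rq x K) z + c * divergence (rq y K) z"
    unfolding rq gh(3) gh'(3) divergence_Pair dx_add[OF gh(1) gh'(1)] dx_add[OF gh(2) gh'(2)]
    by (simp add: algebra_simps)
qed

lemma rv_comb: "x \<in> X \<Longrightarrow> y \<in> X \<Longrightarrow> K \<in> \<T> \<Longrightarrow> rv (comb x c y) K z = rv x K z + c * rv y K z"
  by (auto simp: comb_def X_def elem_rep_add)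

lemma rl_comb:
  assumes "x \<in> X" "y \<in> X" "e \<in> mesh_edges \<T>" "snd z \<in> e"
  shows "rl (comb x c y) e z = rl x e z + c * rl y e z"
    "dt (rl (comb x c y) e) z = dt (rl x e) z + c * dt (rl y e) z"
proof -
  obtain t s where z: "z = (t, s)" "s \<in> e" using assms(4) by (cases z) auto
  have rl: "rl (comb x c y) e (t, s) = rl x e (t, s) + c * rl y e (t, s)" for t
    using assms z(2) face_rep_add[of "snd (snd x)" "snd (snd y)" e s c t] by (auto simp: comb_def X_def)
  then show "rl (comb x c y) e z = rl x e z + c * rl y e z" unfolding z .
  obtain u v where uv: "e = closed_segment u v" "u \<noteq> v" using edge_segment[OF assms(3)] .
  have "((\<lambda>t. rl x e (t, s) + c * rl y e (t, s)) has_real_derivative dt (rl x e) (t, s) + c * dt (rl y e) (t, s)) (at t)"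
    by (intro derivative_intros DERIV_cmult face_polys_dt(3)[OF rl_rep[OF assms(1,3)] uv z(2)]
        face_polys_dt(3)[OF rl_rep[OF assms(2,3)] uv z(2)])
  then have "((\<lambda>t. rl (comb x c y) e (t, s)) has_real_derivative dt (rl x e) (t, s) + c * dt (rl y e) (t, s)) (at t)"
    unfolding rl .
  then show "dt (rl (comb x c y) e) z = dt (rl x e) z + c * dt (rl y e) z" unfolding z by (rule dt_eqI)
qed

definition form_A where
  "form_A x y = - ip_elements \<T> I (rq x) (\<lambda>K z. f z *\<^sub>R dt (rq y K) z)
     - ip_elements \<T> I (rq x) (\<lambda>K z. f' z *\<^sub>R rq y K z) + ip_time \<T> t1 (rq x) (\<lambda>K z. f z *\<^sub>R rq y K z)"

text \<open>Occurs as \<open>form_C x y\<close> in the first equation, while the second and third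
  together contain \<open>- form_C y x\<close>.\<close>

definition form_C where
  "form_C x y = ip_elements \<T> I (rv x) (\<lambda>K z. f z * divergence (rq y K) z)
     - ip_lateral \<T> I (\<lambda>K e. rl x e) (\<lambda>K e z. (rq y K z \<bullet> outward_normal K e) * f z)"

text \<open>The stabilization enters the second equation tested with w and the third one, negated,
  tested with \<mu>; the sum is tested with w - \<mu> and so is a square on the diagonal.\<close>

definition form_S where
  "form_S x y = ip_lateral \<T> I (\<lambda>K e z. \<tau> K * (rv x K z - rl x e z)) (\<lambda>K e z. (rv y K z - rl y e z) * f z)"

definition form_D where
  "form_D x y = - ip_surface \<T> I (rl x) (\<lambda>e z. f z * dt (rl y e) z)
     - ip_surface \<T> I (rl x) (\<lambda>e z. rl y e z * f' z) + ip_surface_time \<T> t1 (rl x) (\<lambda>e z. rl y e z * f z)"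

text \<open>The sum of the left-hand sides of the three equations. The coupling of q with
  \<open>(v, \<lambda>)\<close> is skew-symmetric.\<close>

definition form_B where
  "form_B x y = form_A x y + form_C x y - form_C y x + form_S x y + form_D x y"

definition data_q where
  "data_q y = ip_time \<T> t0 (\<lambda>K z. q0 (snd z)) (\<lambda>K z. f z *\<^sub>R rq y K z)"

definition data_l where
  "data_l y = ip_surface_time \<T> t0 (\<lambda>e z. l0 (snd z)) (\<lambda>e z. rl y e z * f z)"

lemma continuous_f' [continuous_intros]:
  "continuous_on S g \<Longrightarrow> continuous_on S (\<lambda>z. deriv (weight \<alpha> t0) (g z))"
  unfolding deriv_weight by (intro continuous_intros)

lemmas form_cont = continuous_intros continuous_rq continuous_rv continuous_rl

lemma form_add_left:
  assumes x: "x \<in> X" and y: "y \<in> X" and z: "z \<in> X"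
  shows "form_A (comb x c y) z = form_A x z + c * form_A y z"
    "form_C (comb x c y) z = form_C x z + c * form_C y z"
    "form_S (comb x c y) z = form_S x z + c * form_S y z"
    "form_D (comb x c y) z = form_D x z + c * form_D y z"
proof -
  have "ip_elements \<T> I (rq (comb x c y)) (\<lambda>K w. f w *\<^sub>R dt (rq z K) w) =
      ip_elements \<T> I (rq x) (\<lambda>K w. f w *\<^sub>R dt (rq z K) w) + c * ip_elements \<T> I (rq y) (\<lambda>K w. f w *\<^sub>R dt (rq z K) w)"
    using x y z by (intro ip_elements_linear form_cont rq_comb)
  moreover have "ip_elements \<T> I (rq (comb x c y)) (\<lambda>K w. f' w *\<^sub>R rq z K w) =
      ip_elements \<T> I (rq x) (\<lambda>K w. f' w *\<^sub>R rq z K w) + c * ip_elements \<T> I (rq y) (\<lambda>K w. f' w *\<^sub>R rq z K w)"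
    using x y z by (intro ip_elements_linear form_cont rq_comb)
  moreover have "ip_time \<T> t1 (rq (comb x c y)) (\<lambda>K w. f w *\<^sub>R rq z K w) =
      ip_time \<T> t1 (rq x) (\<lambda>K w. f w *\<^sub>R rq z K w) + c * ip_time \<T> t1 (rq y) (\<lambda>K w. f w *\<^sub>R rq z K w)"
    using x y z by (intro ip_time_linear form_cont rq_comb)
  ultimately show "form_A (comb x c y) z = form_A x z + c * form_A y z"
    by (simp add: form_A_def algebra_simps)
  have "ip_elements \<T> I (rv (comb x c y)) (\<lambda>K w. f w * divergence (rq z K) w) =
      ip_elements \<T> I (rv x) (\<lambda>K w. f w * divergence (rq z K) w) + c * ip_elements \<T> I (rv y) (\<lambda>K w. f w * divergence (rq z K) w)"
    using x y z by (intro ip_elements_linear form_cont) (simp_all add: rv_comb)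
  moreover have "ip_lateral \<T> I (\<lambda>K e. rl (comb x c y) e) (\<lambda>K e w. (rq z K w \<bullet> outward_normal K e) * f w) =
      ip_lateral \<T> I (\<lambda>K e. rl x e) (\<lambda>K e w. (rq z K w \<bullet> outward_normal K e) * f w) +
      c * ip_lateral \<T> I (\<lambda>K e. rl y e) (\<lambda>K e w. (rq z K w \<bullet> outward_normal K e) * f w)"
    using x y z by (intro ip_lateral_linear form_cont edge_mesh rl_comb)
  ultimately show "form_C (comb x c y) z = form_C x z + c * form_C y z"
    by (simp add: form_C_def algebra_simps)
  show "form_S (comb x c y) z = form_S x z + c * form_S y z"
    unfolding form_S_def using x y z
    by (intro ip_lateral_linear form_cont edge_mesh) (simp_all add: rv_comb rl_comb edge_mesh algebra_simps)
  have "ip_surface \<T> I (rl (comb x c y)) (\<lambda>e w. f w * dt (rl z e) w) =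
      ip_surface \<T> I (rl x) (\<lambda>e w. f w * dt (rl z e) w) + c * ip_surface \<T> I (rl y) (\<lambda>e w. f w * dt (rl z e) w)"
    using x y z by (intro ip_surface_linear form_cont rl_comb)
  moreover have "ip_surface \<T> I (rl (comb x c y)) (\<lambda>e w. rl z e w * f' w) =
      ip_surface \<T> I (rl x) (\<lambda>e w. rl z e w * f' w) + c * ip_surface \<T> I (rl y) (\<lambda>e w. rl z e w * f' w)"
    using x y z by (intro ip_surface_linear form_cont rl_comb)
  moreover have "ip_surface_time \<T> t1 (rl (comb x c y)) (\<lambda>e w. rl z e w * f w) =
      ip_surface_time \<T> t1 (rl x) (\<lambda>e w. rl z e w * f w) + c * ip_surface_time \<T> t1 (rl y) (\<lambda>e w. rl z e w * f w)"
    using x y z by (intro ip_surface_time_linear form_cont rl_comb)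
  ultimately show "form_D (comb x c y) z = form_D x z + c * form_D y z"
    by (simp add: form_D_def algebra_simps)
qed

lemma form_add_right:
  assumes x: "x \<in> X" and y: "y \<in> X" and z: "z \<in> X"
  shows "form_A z (comb x c y) = form_A z x + c * form_A z y"
    "form_C z (comb x c y) = form_C z x + c * form_C z y"
    "form_S z (comb x c y) = form_S z x + c * form_S z y"
    "form_D z (comb x c y) = form_D z x + c * form_D z y"
proof -
  note lin = rq_comb[OF x y] rv_comb[OF x y] rl_comb[OF x y]
  have "ip_elements \<T> I (rq z) (\<lambda>K w. f w *\<^sub>R dt (rq (comb x c y) K) w) =
      ip_elements \<T> I (rq z) (\<lambda>K w. f w *\<^sub>R dt (rq x K) w) + c * ip_elements \<T> I (rq z) (\<lambda>K w. f w *\<^sub>R dt (rq y K) w)"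
    unfolding ip_elements_commute[of \<T> I "rq z"] using x y z
    by (intro ip_elements_linear form_cont) (simp_all add: lin scaleR_add_right mult.commute)
  moreover have "ip_elements \<T> I (rq z) (\<lambda>K w. f' w *\<^sub>R rq (comb x c y) K w) =
      ip_elements \<T> I (rq z) (\<lambda>K w. f' w *\<^sub>R rq x K w) + c * ip_elements \<T> I (rq z) (\<lambda>K w. f' w *\<^sub>R rq y K w)"
    unfolding ip_elements_commute[of \<T> I "rq z"] using x y z
    by (intro ip_elements_linear form_cont) (simp_all add: lin scaleR_add_right mult.commute)
  moreover have "ip_time \<T> t1 (rq z) (\<lambda>K w. f w *\<^sub>R rq (comb x c y) K w) =
      ip_time \<T> t1 (rq z) (\<lambda>K w. f w *\<^sub>R rq x K w) + c * ip_time \<T> t1 (rq z) (\<lambda>K w. f w *\<^sub>R rq y K w)"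
    unfolding ip_time_commute[of \<T> t1 "rq z"] using x y z
    by (intro ip_time_linear form_cont) (simp_all add: lin scaleR_add_right mult.commute)
  ultimately show "form_A z (comb x c y) = form_A z x + c * form_A z y"
    by (simp add: form_A_def algebra_simps)
  have "ip_elements \<T> I (rv z) (\<lambda>K w. f w * divergence (rq (comb x c y) K) w) =
      ip_elements \<T> I (rv z) (\<lambda>K w. f w * divergence (rq x K) w) + c * ip_elements \<T> I (rv z) (\<lambda>K w. f w * divergence (rq y K) w)"
    unfolding ip_elements_commute[of \<T> I "rv z"] using x y z
    by (intro ip_elements_linear form_cont) (simp_all add: lin algebra_simps)
  moreover have "ip_lateral \<T> I (\<lambda>K e. rl z e) (\<lambda>K e w. (rq (comb x c y) K w \<bullet> outward_normal K e) * f w) =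
      ip_lateral \<T> I (\<lambda>K e. rl z e) (\<lambda>K e w. (rq x K w \<bullet> outward_normal K e) * f w) +
      c * ip_lateral \<T> I (\<lambda>K e. rl z e) (\<lambda>K e w. (rq y K w \<bullet> outward_normal K e) * f w)"
    unfolding ip_lateral_commute[of \<T> I "\<lambda>K e. rl z e"] using x y z
    by (intro ip_lateral_linear form_cont edge_mesh) (simp_all add: lin inner_add_left algebra_simps)
  ultimately show "form_C z (comb x c y) = form_C z x + c * form_C z y"
    by (simp add: form_C_def algebra_simps)
  show "form_S z (comb x c y) = form_S z x + c * form_S z y"
    unfolding form_S_def ip_lateral_commute[of \<T> I "\<lambda>K e w. \<tau> K * (rv z K w - rl z e w)"] using x y z
    by (intro ip_lateral_linear form_cont edge_mesh) (simp_all add: lin edge_mesh algebra_simps)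
  have "ip_surface \<T> I (rl z) (\<lambda>e w. f w * dt (rl (comb x c y) e) w) =
      ip_surface \<T> I (rl z) (\<lambda>e w. f w * dt (rl x e) w) + c * ip_surface \<T> I (rl z) (\<lambda>e w. f w * dt (rl y e) w)"
    unfolding ip_surface_commute[of \<T> I "rl z"] using x y z
    by (intro ip_surface_linear form_cont) (simp_all add: lin algebra_simps)
  moreover have "ip_surface \<T> I (rl z) (\<lambda>e w. rl (comb x c y) e w * f' w) =
      ip_surface \<T> I (rl z) (\<lambda>e w. rl x e w * f' w) + c * ip_surface \<T> I (rl z) (\<lambda>e w. rl y e w * f' w)"
    unfolding ip_surface_commute[of \<T> I "rl z"] using x y z
    by (intro ip_surface_linear form_cont) (simp_all add: lin algebra_simps)
  moreover have "ip_surface_time \<T> t1 (rl z) (\<lambda>e w. rl (comb x c y) e w * f w) =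
      ip_surface_time \<T> t1 (rl z) (\<lambda>e w. rl x e w * f w) + c * ip_surface_time \<T> t1 (rl z) (\<lambda>e w. rl y e w * f w)"
    unfolding ip_surface_time_commute[of \<T> t1 "rl z"] using x y z
    by (intro ip_surface_time_linear form_cont) (simp_all add: lin algebra_simps)
  ultimately show "form_D z (comb x c y) = form_D z x + c * form_D z y"
    by (simp add: form_D_def algebra_simps)
qed

lemma form_B_add:
  assumes "x \<in> X" "y \<in> X" "z \<in> X"
  shows "form_B (comb x c y) z = form_B x z + c * form_B y z"
    "form_B z (comb x c y) = form_B z x + c * form_B z y"
  by (simp_all add: form_B_def form_add_left[OF assms] form_add_right[OF assms] algebra_simps)

section \<open>The three equations and the energy estimate\<close>

lemma mesh_edge_borel: "e \<in> mesh_edges \<T> \<Longrightarrow> e \<in> sets borel"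
  by (rule edge_segment) (auto intro: borel_closed)

text \<open>The remaining volume terms have continuous integrands. Here the data is merely square
  integrable, and integrability comes from pairing it with a continuous function on a bounded
  set.\<close>

lemma data_q_integrable:
  assumes x: "x \<in> X" and K: "K \<in> \<T>"
  shows "set_integrable lborel (interior K) (\<lambda>y. q0 y \<bullet> (weight \<alpha> t0 t0 *\<^sub>R rq x K (t0, y)))"
proof -
  have *: "set_integrable lborel (interior K) (\<lambda>y. u y * h y)"
    if u: "u \<in> L2_on lborel \<Omega>" and h: "continuous_on UNIV h" for u h :: "plane \<Rightarrow> real"
  proof (rule L2_on_mult_integrable[OF u])
    show "set_integrable lborel (interior K) (\<lambda>y. (h y)\<^sup>2)"
      by (intro integrable_element_time[OF K] continuous_intros continuous_on_subset[OF h]) auto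
    show "set_borel_measurable lborel (interior K) h"
      unfolding set_borel_measurable_def
      using borel_measurable_continuous_onI[OF h] by (intro borel_measurable_scaleR borel_measurable_indicator) auto
  qed (use interior_element_subset[OF K] in auto)
  have c: "continuous_on UNIV (\<lambda>y. weight \<alpha> t0 t0 *\<^sub>R rq x K (t0, y))"
    by (intro continuous_intros continuous_on_compose2[OF continuous_rq(1)[OF x K, of UNIV]]) auto
  have "set_integrable lborel (interior K) (\<lambda>y. fst (q0 y) * fst (weight \<alpha> t0 t0 *\<^sub>R rq x K (t0, y)))"
    "set_integrable lborel (interior K) (\<lambda>y. snd (q0 y) * snd (weight \<alpha> t0 t0 *\<^sub>R rq x K (t0, y)))"
    by (rule *[OF _ continuous_on_fst[OF c]] *[OF _ continuous_on_snd[OF c]]; use q0 in \<open>simp add: vec_space_def\<close>)+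
  from set_integral_add(1)[OF this] show ?thesis by (simp add: inner_prod_def)
qed

lemma data_l_integrable:
  assumes x: "x \<in> X" and e: "e \<in> surface_edges \<T>"
  shows "set_integrable (arc_length e) e (\<lambda>y. l0 y * (rl x e (t0, y) * weight \<alpha> t0 t0))"
proof -
  obtain c d where cd: "e = closed_segment (c, 0) (d, 0)" "L \<le> c" "c < d" "d \<le> R"
    using surface_edge_segment[OF e] .
  have "continuous_on e (\<lambda>y. rl x e (t0, y) * weight \<alpha> t0 t0)"
    by (intro continuous_intros continuous_on_compose2[OF continuous_rl(1)[OF x surface_edge_mesh[OF e]]]) auto
  with L_less_R l0 cd show ?thesis by (rule surface_data_integrable)
qed

lemma data_add:
  assumes x: "x \<in> X" and y: "y \<in> X"
  shows "data_q (comb x c y) = data_q x + c * data_q y" "data_l (comb x c y) = data_l x + c * data_l y"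
proof -
  have "(LINT w:interior K|lborel. q0 w \<bullet> (weight \<alpha> t0 t0 *\<^sub>R rq (comb x c y) K (t0, w))) =
      (LINT w:interior K|lborel. q0 w \<bullet> (weight \<alpha> t0 t0 *\<^sub>R rq x K (t0, w))) +
      c * (LINT w:interior K|lborel. q0 w \<bullet> (weight \<alpha> t0 t0 *\<^sub>R rq y K (t0, w)))" if K: "K \<in> \<T>" for K
    by (intro set_integral_linear data_q_integrable x y K)
      (auto simp: rq_comb(1)[OF x y K] inner_add_right algebra_simps)
  then show "data_q (comb x c y) = data_q x + c * data_q y"
    by (simp add: data_q_def ip_time_def sum.distrib sum_distrib_left)
  have "(LINT w:e|arc_length e. l0 w * (rl (comb x c y) e (t0, w) * weight \<alpha> t0 t0)) =
      (LINT w:e|arc_length e. l0 w * (rl x e (t0, w) * weight \<alpha> t0 t0)) +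
      c * (LINT w:e|arc_length e. l0 w * (rl y e (t0, w) * weight \<alpha> t0 t0))" if e: "e \<in> surface_edges \<T>" for e
    by (intro set_integral_linear data_l_integrable x y e)
      (simp_all add: rl_comb(1)[OF x y surface_edge_mesh[OF e]] algebra_simps mesh_edge_borel surface_edge_mesh e)
  then show "data_l (comb x c y) = data_l x + c * data_l y"
    by (simp add: data_l_def ip_surface_time_def sum.distrib sum_distrib_left)
qed

text \<open>Being zero as a discrete function, expressed through representatives; the functions in
  \<open>x\<close> themselves vanish only almost everywhere. For the face component only points over
  the edge are meaningful.\<close>

definition q_null where "q_null x \<longleftrightarrow> (\<forall>K\<in>\<T>. rq x K = (\<lambda>z. 0))"
definition v_null where "v_null x \<longleftrightarrow> (\<forall>K\<in>\<T>. rv x K = (\<lambda>z. 0))"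
definition l_null where "l_null x \<longleftrightarrow> (\<forall>e\<in>mesh_edges \<T>. \<forall>t. \<forall>s\<in>e. rl x e (t, s) = 0)"

lemma ip_elements_0: "(\<And>K z. K \<in> \<T> \<Longrightarrow> v K z = 0) \<Longrightarrow> ip_elements \<T> I v w = 0"
  by (simp add: ip_elements_def set_lebesgue_integral_def)

lemma ip_time_0: "(\<And>K z. K \<in> \<T> \<Longrightarrow> v K z = 0) \<Longrightarrow> ip_time \<T> s v w = 0"
  by (simp add: ip_time_def set_lebesgue_integral_def)

lemma ip_lateral_0: 
  assumes "\<And>K e z. K \<in> \<T> \<Longrightarrow> e \<in> edges K \<Longrightarrow> snd z \<in> e \<Longrightarrow> v K e z = 0"
  shows "ip_lateral \<T> I v w = 0"
proof -
  have "(LINT z:I \<times> e|face_measure e. v K e z * w K e z) = (LINT z:I \<times> e|face_measure e. 0)"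
    if "K \<in> \<T>" "e \<in> edges K" for K e
    using assms[OF that] by (intro set_lebesgue_integral_cong slab_face_sets edge_mesh[OF that]) auto
  then show ?thesis by (simp add: ip_lateral_def set_lebesgue_integral_def)
qed

lemma ip_surface_0:
  assumes "\<And>e z. e \<in> surface_edges \<T> \<Longrightarrow> snd z \<in> e \<Longrightarrow> v e z = 0"
  shows "ip_surface \<T> I v w = 0"
proof -
  have "(LINT z:I \<times> e|face_measure e. v e z * w e z) = (LINT z:I \<times> e|face_measure e. 0)"
    if "e \<in> surface_edges \<T>" for e
    using assms[OF that] by (intro set_lebesgue_integral_cong slab_face_sets surface_edge_mesh[OF that]) auto
  then show ?thesis by (simp add: ip_surface_def set_lebesgue_integral_def)
qed

lemma ip_surface_time_0:
  assumes "\<And>e z. e \<in> surface_edges \<T> \<Longrightarrow> snd z \<in> e \<Longrightarrow> v e z = 0"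
  shows "ip_surface_time \<T> s v w = 0"
proof -
  have "(LINT y:e|arc_length e. v e (s, y) * w e (s, y)) = (LINT y:e|arc_length e. 0)"
    if "e \<in> surface_edges \<T>" for e
    using assms[OF that] mesh_edge_borel[OF surface_edge_mesh[OF that]]
    by (intro set_lebesgue_integral_cong) auto
  then show ?thesis by (simp add: ip_surface_time_def set_lebesgue_integral_def)
qed

lemma form_q_null:
  assumes "q_null x"
  shows "form_A x y = 0" "form_A y x = 0" "form_C y x = 0" "data_q x = 0"
proof -
  have rq: "rq x K = (\<lambda>z. 0)" if "K \<in> \<T>" for K using assms that by (simp add: q_null_def)
  have dt0: "dt (\<lambda>z. 0 :: plane) = (\<lambda>z. 0)" by (auto simp: dt_def fun_eq_iff)
  have div0: "divergence (\<lambda>z. 0) = (\<lambda>z. 0)" by (auto simp: divergence_def fun_eq_iff)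
  show "form_A x y = 0" by (simp add: form_A_def ip_elements_0 ip_time_0 rq)
  show "form_A y x = 0"
    unfolding form_A_def ip_elements_commute[of \<T> I "rq y"] ip_time_commute[of \<T> t1 "rq y"]
    by (simp add: ip_elements_0 ip_time_0 rq dt0)
  show "form_C y x = 0"
    unfolding form_C_def ip_elements_commute[of \<T> I "rv y"] ip_lateral_commute[of \<T> I "\<lambda>K e. rl y e"]
    by (simp add: ip_elements_0 ip_lateral_0 rq div0)
  show "data_q x = 0" unfolding data_q_def ip_time_commute[of \<T> t0 "\<lambda>K z. q0 (snd z)"]
    by (simp add: ip_time_0 rq)
qed

lemma l_null_dt:
  assumes "l_null x" "e \<in> mesh_edges \<T>" "snd z \<in> e"
  shows "rl x e z = 0" "dt (rl x e) z = 0"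
proof -
  obtain t s where z: "z = (t, s)" "s \<in> e" using assms(3) by (cases z) auto
  have "(\<lambda>t. rl x e (t, s)) = (\<lambda>t. 0)" using assms(1,2) z(2) by (auto simp: l_null_def)
  then have "((\<lambda>t. rl x e (t, s)) has_real_derivative 0) (at t)" by simp
  then show "dt (rl x e) z = 0" unfolding z(1) by (rule dt_eqI)
  show "rl x e z = 0" using assms(1,2) z by (auto simp: l_null_def)
qed

lemma form_l_null:
  assumes "l_null x"
  shows "form_D x y = 0" "form_D y x = 0" "data_l x = 0"
    "ip_lateral \<T> I (\<lambda>K e. rl x e) w = 0" "ip_lateral \<T> I w (\<lambda>K e z. rl x e z * f z) = 0"
proof -
  note [simp] = l_null_dt[OF assms] surface_edge_mesh edge_mesh
  show "form_D x y = 0" by (simp add: form_D_def ip_surface_0 ip_surface_time_0)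
  show "form_D y x = 0"
    unfolding form_D_def ip_surface_commute[of \<T> I "rl y"] ip_surface_time_commute[of \<T> t1 "rl y"]
    by (simp add: ip_surface_0 ip_surface_time_0)
  show "data_l x = 0" unfolding data_l_def ip_surface_time_commute[of \<T> t0 "\<lambda>e z. l0 (snd z)"]
    by (simp add: ip_surface_time_0)
  show "ip_lateral \<T> I (\<lambda>K e. rl x e) w = 0" by (rule ip_lateral_0) simp
  show "ip_lateral \<T> I w (\<lambda>K e z. rl x e z * f z) = 0"
    unfolding ip_lateral_commute[of \<T> I w] by (rule ip_lateral_0) simp
qed

lemma form_vl_null:
  assumes "v_null x" "l_null x"
  shows "form_S x y = 0" "form_S y x = 0" "form_C x y = 0"
proof -
  note [simp] = l_null_dt[OF assms(2)] edge_mesh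
  have rv [simp]: "K \<in> \<T> \<Longrightarrow> rv x K = (\<lambda>z. 0)" for K using assms(1) by (simp add: v_null_def)
  show "form_S x y = 0" by (simp add: form_S_def ip_lateral_0)
  show "form_S y x = 0"
    unfolding form_S_def ip_lateral_commute[of \<T> I "\<lambda>K e z. \<tau> K * (rv y K z - rl y e z)"]
    by (simp add: ip_lateral_0)
  show "form_C x y = 0" by (simp add: form_C_def ip_elements_0 ip_lateral_0)
qed

abbreviation "eqs x y \<equiv> hdg_equations p \<T> t0 t1 \<alpha> \<tau> q0 l0 (fst x) (fst (snd x)) (snd (snd x)) (fst y) (fst (snd y)) (snd (snd y))"

text \<open>The lateral term of the third equation is split so that its flux part is recognized as
  the coupling term with the two arguments exchanged.\<close>

lemma hdg_equations_forms:
  assumes x: "x \<in> X" and y: "y \<in> X"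
  shows "eqs x y \<longleftrightarrow> form_A x y + form_C x y = data_q y \<and>
    - ip_elements \<T> I (rv y) (\<lambda>K z. f z * divergence (rq x K) z) +
      ip_lateral \<T> I (\<lambda>K e z. \<tau> K * (rv x K z - rl x e z)) (\<lambda>K e z. rv y K z * f z) = 0 \<and>
    ip_lateral \<T> I (\<lambda>K e. rl y e) (\<lambda>K e z. (rq x K z \<bullet> outward_normal K e) * f z) -
      ip_lateral \<T> I (\<lambda>K e z. \<tau> K * (rv x K z - rl x e z)) (\<lambda>K e z. rl y e z * f z) + form_D x y = data_l y"
proof -
  let ?T = "\<lambda>K e z. \<tau> K * (rv x K z - rl x e z)" and ?N = "\<lambda>K e z. rq x K z \<bullet> outward_normal K e"
  have "ip_lateral \<T> I (\<lambda>K e z. ?N K e z - ?T K e z) (\<lambda>K e z. rl y e z * f z) =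
      ip_lateral \<T> I ?N (\<lambda>K e z. rl y e z * f z) + (- 1) * ip_lateral \<T> I ?T (\<lambda>K e z. rl y e z * f z)"
    using x y by (intro ip_lateral_linear form_cont edge_mesh) auto
  moreover have "ip_lateral \<T> I ?N (\<lambda>K e z. rl y e z * f z) =
      ip_lateral \<T> I (\<lambda>K e. rl y e) (\<lambda>K e z. ?N K e z * f z)"
    by (simp add: ip_lateral_def mult_ac)
  ultimately have N: "ip_lateral \<T> I (\<lambda>K e z. ?N K e z - ?T K e z) (\<lambda>K e z. rl y e z * f z) =
      ip_lateral \<T> I (\<lambda>K e. rl y e) (\<lambda>K e z. ?N K e z * f z) - ip_lateral \<T> I ?T (\<lambda>K e z. rl y e z * f z)"
    by simp
  show ?thesis
    unfolding hdg_equations_def Let_def N form_A_def form_C_def form_D_def data_q_def data_l_def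
    by (intro iffI conjI; elim conjE; linarith)
qed

lemma form_S_split:
  assumes x: "x \<in> X" and y: "y \<in> X"
  shows "form_S x y = ip_lateral \<T> I (\<lambda>K e z. \<tau> K * (rv x K z - rl x e z)) (\<lambda>K e z. rv y K z * f z) -
    ip_lateral \<T> I (\<lambda>K e z. \<tau> K * (rv x K z - rl x e z)) (\<lambda>K e z. rl y e z * f z)"
proof -
  let ?T = "\<lambda>K e z. \<tau> K * (rv x K z - rl x e z)"
  have "form_S x y = ip_lateral \<T> I (\<lambda>K e z. rv y K z * f z) ?T + (- 1) * ip_lateral \<T> I (\<lambda>K e z. rl y e z * f z) ?T"
    unfolding form_S_def ip_lateral_commute[of \<T> I ?T] using x y
    by (intro ip_lateral_linear form_cont edge_mesh) (auto simp: algebra_simps)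
  then show ?thesis by (simp add: ip_lateral_commute[of \<T> I ?T])
qed

lemma hdg_equations_imp_form_B:
  assumes "x \<in> X" "y \<in> X" "eqs x y"
  shows "form_B x y = data_q y + data_l y"
  using assms(3) unfolding hdg_equations_forms[OF assms(1,2)] form_B_def form_S_split[OF assms(1,2)]
  by (simp add: form_C_def[of y x])

lemma null_components:
  "q_null (\<lambda>z. 0, w)" "v_null (q, \<lambda>z. 0, l)" "l_null (q, v, \<lambda>z. 0)"
  by (auto simp: q_null_def v_null_def l_null_def elem_rep_vec_def elem_rep_0 face_rep_0 zero_prod_def)

lemma zero_components:
  assumes "x \<in> X"
  shows "(fst x, \<lambda>z. 0, \<lambda>z. 0) \<in> X" "(\<lambda>z. 0, fst (snd x), \<lambda>z. 0) \<in> X" "(\<lambda>z. 0, \<lambda>z. 0, snd (snd x)) \<in> X"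
  using assms by (auto simp: X_def V_space_def vec_space_def W_0 M_0)

text \<open>Testing with one component at a time recovers the three equations from their sum.\<close>

lemma form_B_imp_hdg_equations:
  assumes x: "x \<in> X" and y: "y \<in> X" and B: "\<And>y. y \<in> X \<Longrightarrow> form_B x y = data_q y + data_l y"
  shows "eqs x y"
proof -
  let ?y1 = "(fst y, \<lambda>z. 0, \<lambda>z. 0) :: discrete_triple"
  let ?y2 = "(\<lambda>z. 0, fst (snd y), \<lambda>z. 0) :: discrete_triple"
  let ?y3 = "(\<lambda>z. 0, \<lambda>z. 0, snd (snd y)) :: discrete_triple"
  note Y = zero_components[OF y]
  have 1: "form_A x ?y1 + form_C x ?y1 = data_q ?y1"
    using B[OF Y(1)] by (simp add: form_B_def form_vl_null[OF null_components(2,3)] form_l_null[OF null_components(3)])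
  \<comment> \<open>A test triple with zero q-part removes \<open>form_A\<close> and one coupling
    term, so only the coupling with exchanged arguments remains.\<close>
  have 2: "- form_C ?y2 x + form_S x ?y2 = 0"
    using B[OF Y(2)] by (simp add: form_B_def form_q_null[OF null_components(1)] form_l_null[OF null_components(3)])
  have 3: "- form_C ?y3 x + form_S x ?y3 + form_D x ?y3 = data_l ?y3"
    using B[OF Y(3)] by (simp add: form_B_def form_q_null[OF null_components(1)])
  have v0: "ip_elements \<T> I (rv ?y3) w = 0" for w
    by (rule ip_elements_0) (simp add: elem_rep_0)
  have v0': "ip_lateral \<T> I w (\<lambda>K e z. rv ?y3 K z * f z) = 0" for w
    unfolding ip_lateral_commute[of \<T> I w] by (rule ip_lateral_0) (simp add: elem_rep_0)
  show ?thesis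
    unfolding hdg_equations_forms[OF x y]
    using 1 2 3 v0 v0' form_l_null(4,5)[OF null_components(3)] form_S_split[OF x Y(2)] form_S_split[OF x Y(3)]
    by (simp add: form_A_def form_C_def form_D_def data_q_def data_l_def)
qed

lemma element_AE_0:
  fixes g :: "spacetime \<Rightarrow> real"
  assumes "K \<in> \<T>" "(LINT z:I \<times> interior K|lborel. g z) = 0" "continuous_on (UNIV \<times> K) g"
    "\<And>z. z \<in> I \<times> interior K \<Longrightarrow> 0 \<le> g z"
  shows "AE z in lborel. z \<in> I \<times> interior K \<longrightarrow> g z = 0"
  by (rule slab.AE_0_if_integral_0[OF slab_element[OF assms(1)], unfolded lborel_prod]) (use assms in auto)

text \<open>The time terms do not mix the two components of q, so \<open>form_A x x\<close> is a sum
  of scalar energies \<open>E\<close>, each bounded below by \<open>time_energy\<close>. Nonnegative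
  summands with sum 0 vanish one by one, and a polynomial with zero weighted square integral is
  zero.\<close>

lemma form_A_energy:
  assumes x: "x \<in> X"
  shows "0 \<le> form_A x x" "form_A x x = 0 \<Longrightarrow> q_null x"
proof -
  define E where "E K g = - (LINT z:I \<times> interior K|lborel. g z * (f z * dt g z))
      - (LINT z:I \<times> interior K|lborel. g z * (f' z * g z))
      + (LINT y:interior K|lborel. g (t1, y) * (weight \<alpha> t0 t1 * g (t1, y)))" for K and g :: "spacetime \<Rightarrow> real"
  have E_ge: "\<alpha> / 2 * (LINT z:I \<times> interior K|lborel. f z * (g z)\<^sup>2) \<le> E K g" if "K \<in> \<T>" "g \<in> element_polys p" for K g
  proof -
    interpret slab lborel "interior K" K t0 t1 using slab_element[OF that(1)] .
    show ?thesis
      unfolding E_def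
      using time_energy[OF element_polys_continuous[OF that(2)] element_polys_dt[OF that(2)], of \<alpha>]
      unfolding lborel_prod .
  qed
  have nn: "0 \<le> (LINT z:I \<times> interior K|lborel. f z * (g z)\<^sup>2)" for K and g :: "spacetime \<Rightarrow> real"
    unfolding set_lebesgue_integral_def
    by (intro Bochner_Integration.integral_nonneg) (auto simp: weight_pos less_imp_le)
  have E_nn: "0 \<le> E K g" if "K \<in> \<T>" "g \<in> element_polys p" for K g
    using E_ge[OF that] nn[of K g] \<alpha>_pos by (smt (verit) mult_nonneg_nonneg divide_nonneg_pos)
  have E_0: "g = (\<lambda>z. 0)" if K: "K \<in> \<T>" and g: "g \<in> element_polys p" and 0: "E K g = 0" for K g
  proof -
    have "\<alpha> / 2 * (LINT z:I \<times> interior K|lborel. f z * (g z)\<^sup>2) \<le> 0" using E_ge[OF K g] 0 by simp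
    then have "(LINT z:I \<times> interior K|lborel. f z * (g z)\<^sup>2) = 0"
      using nn[of K g] \<alpha>_pos by (simp add: mult_le_0_iff)
    then have "AE z in lborel. z \<in> I \<times> interior K \<longrightarrow> f z * (g z)\<^sup>2 = 0"
      by (rule element_AE_0[OF K]) (auto intro!: continuous_intros element_polys_continuous[OF g] simp: weight_pos less_imp_le)
    then have "AE z in lborel. z \<in> I \<times> interior K \<longrightarrow> g z = 0"
    proof (rule eventually_mono, intro impI)
      fix z assume "z \<in> I \<times> interior K" "z \<in> I \<times> interior K \<longrightarrow> f z * (g z)\<^sup>2 = 0"
      then show "g z = 0" using weight_pos[of \<alpha> t0 "fst z"] by auto
    qed
    from element_polys_AE_0[OF g open_interior interior_element_nonempty[OF K] t01 this]
    show ?thesis by auto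
  qed
  let ?g = "\<lambda>K. elem_rep p I (\<lambda>z. fst (fst x z)) K" and ?h = "\<lambda>K. elem_rep p I (\<lambda>z. snd (fst x z)) K"
  have gh: "?g K \<in> element_polys p" "?h K \<in> element_polys p" "rq x K = (\<lambda>z. (?g K z, ?h K z))" if "K \<in> \<T>" for K
    by (rule rq_rep[OF x that]; simp)+
  have A: "form_A x x = (\<Sum>K\<in>\<T>. E K (?g K) + E K (?h K))"
  proof -
    have "- (LINT z:I \<times> interior K|lborel. rq x K z \<bullet> (f z *\<^sub>R dt (rq x K) z))
        - (LINT z:I \<times> interior K|lborel. rq x K z \<bullet> (f' z *\<^sub>R rq x K z))
        + (LINT y:interior K|lborel. rq x K (t1, y) \<bullet> (weight \<alpha> t0 t1 *\<^sub>R rq x K (t1, y))) = E K (?g K) + E K (?h K)"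
      if K: "K \<in> \<T>" for K
    proof -
      note g = gh(1)[OF K] and h = gh(2)[OF K]
      have c: "continuous_on S (?g K)" "continuous_on S (?h K)" "continuous_on S (dt (?g K))" "continuous_on S (dt (?h K))" for S
        by (intro element_polys_continuous[OF g] element_polys_continuous[OF h] element_polys_dt(1)[OF g] element_polys_dt(1)[OF h])+
      have ct: "continuous_on K (\<lambda>y. ?g K (t1, y))" "continuous_on K (\<lambda>y. ?h K (t1, y))"
        by (rule continuous_on_compose2[OF c(1)[of UNIV]] continuous_on_compose2[OF c(2)[of UNIV]];
            auto intro!: continuous_intros)+
      have "(LINT z:I \<times> interior K|lborel. rq x K z \<bullet> (f z *\<^sub>R dt (rq x K) z)) =
          (LINT z:I \<times> interior K|lborel. ?g K z * (f z * dt (?g K) z)) + 1 * (LINT z:I \<times> interior K|lborel. ?h K z * (f z * dt (?h K) z))"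
        by (rule set_integral_linear; (intro integrable_element[OF K] continuous_intros c slab_element_sets)?)
          (simp add: gh(3)[OF K] dt_Pair[OF g h] inner_prod_def)
      moreover have "(LINT z:I \<times> interior K|lborel. rq x K z \<bullet> (f' z *\<^sub>R rq x K z)) =
          (LINT z:I \<times> interior K|lborel. ?g K z * (f' z * ?g K z)) + 1 * (LINT z:I \<times> interior K|lborel. ?h K z * (f' z * ?h K z))"
        by (rule set_integral_linear; (intro integrable_element[OF K] continuous_intros c slab_element_sets)?)
          (simp add: gh(3)[OF K] inner_prod_def)
      moreover have "(LINT y:interior K|lborel. rq x K (t1, y) \<bullet> (weight \<alpha> t0 t1 *\<^sub>R rq x K (t1, y))) =
          (LINT y:interior K|lborel. ?g K (t1, y) * (weight \<alpha> t0 t1 * ?g K (t1, y))) +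
          1 * (LINT y:interior K|lborel. ?h K (t1, y) * (weight \<alpha> t0 t1 * ?h K (t1, y)))"
        by (rule set_integral_linear; (intro integrable_element_time[OF K] continuous_intros ct)?)
          (simp_all add: gh(3)[OF K] inner_prod_def)
      ultimately show ?thesis by (simp add: E_def)
    qed
    then have "(\<Sum>K\<in>\<T>. E K (?g K) + E K (?h K)) = (\<Sum>K\<in>\<T>. - (LINT z:I \<times> interior K|lborel. rq x K z \<bullet> (f z *\<^sub>R dt (rq x K) z))
        - (LINT z:I \<times> interior K|lborel. rq x K z \<bullet> (f' z *\<^sub>R rq x K z))
        + (LINT y:interior K|lborel. rq x K (t1, y) \<bullet> (weight \<alpha> t0 t1 *\<^sub>R rq x K (t1, y))))"
      by (intro sum.cong) auto
    then show ?thesis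
      by (simp add: form_A_def ip_elements_def ip_time_def sum.distrib sum_subtractf sum_negf)
  qed
  have nn': "0 \<le> E K (?g K) + E K (?h K)" if "K \<in> \<T>" for K
    using E_nn[OF that gh(1)[OF that]] E_nn[OF that gh(2)[OF that]] by simp
  then show "0 \<le> form_A x x" unfolding A by (intro sum_nonneg)
  assume "form_A x x = 0"
  then have 0: "\<forall>K\<in>\<T>. E K (?g K) + E K (?h K) = 0"
    unfolding A using sum_nonneg_eq_0_iff[OF finite_mesh nn'] by simp
  show "q_null x" unfolding q_null_def
  proof
    fix K assume K: "K \<in> \<T>"
    have "E K (?g K) = 0" "E K (?h K) = 0"
      using 0 K E_nn[OF K gh(1)[OF K]] E_nn[OF K gh(2)[OF K]] by (auto dest!: bspec[of _ _ K])
    then have "?g K = (\<lambda>z. 0)" "?h K = (\<lambda>z. 0)" using E_0[OF K gh(1)[OF K]] E_0[OF K gh(2)[OF K]] by auto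
    then show "rq x K = (\<lambda>z. 0)" unfolding gh(3)[OF K] by (simp add: fun_eq_iff zero_prod_def)
  qed
qed

lemma face_AE_0:
  assumes g: "g \<in> face_polys p e" and e: "e \<in> mesh_edges \<T>" and x: "x \<in> e"
    and 0: "(LINT z:I \<times> e|face_measure e. f z * (g z)\<^sup>2) = 0"
  shows "g (t, x) = 0"
proof -
  obtain u v where uv: "e = closed_segment u v" "u \<noteq> v" using edge_segment[OF e] .
  have "AE z in face_measure e. z \<in> I \<times> e \<longrightarrow> f z * (g z)\<^sup>2 = 0"
    unfolding face_measure_def
  proof (rule slab.AE_0_if_integral_0[OF slab_edge[OF e]])
    show "continuous_on (UNIV \<times> e) (\<lambda>z. f z * (g z)\<^sup>2)"
      by (intro continuous_intros face_polys_dt(1)[OF g uv])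
  qed (use 0 in \<open>simp_all add: face_measure_def weight_pos less_imp_le\<close>)
  then have "AE z in face_measure e. z \<in> I \<times> e \<longrightarrow> g z = 0"
  proof (rule eventually_mono, intro impI)
    fix z assume "z \<in> I \<times> e" "z \<in> I \<times> e \<longrightarrow> f z * (g z)\<^sup>2 = 0"
    then show "g z = 0" using weight_pos[of \<alpha> t0 "fst z"] by auto
  qed
  then show ?thesis by (rule face_polys_AE_0[OF g uv t01 _ x])
qed

text \<open>On the diagonal this is a sum of \<tau> times weighted squares of v - \<lambda>. Each is
  nonnegative, so vanishing of the sum forces v = \<lambda> on every face from each adjacent
  element.\<close>

lemma form_S_energy:
  assumes x: "x \<in> X"
  shows "0 \<le> form_S x x"
    "form_S x x = 0 \<Longrightarrow> K \<in> \<T> \<Longrightarrow> e \<in> edges K \<Longrightarrow> s \<in> e \<Longrightarrow> rl x e (t, s) = rv x K (t, s)"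
proof -
  \<comment> \<open>The difference is written as \<open>+ (- 1) *\<close> to match
    \<open>face_polys_add\<close>.\<close>
  define E where "E K e = \<tau> K * (LINT z:I \<times> e|face_measure e. f z * (rv x K z + (- 1) * rl x e z)\<^sup>2)" for K e
  have S: "form_S x x = (\<Sum>K\<in>\<T>. \<Sum>e\<in>edges K. E K e)"
    unfolding form_S_def ip_lateral_def E_def
    by (subst set_integral_mult_right[symmetric]) (simp add: power2_eq_square mult_ac)
  have nn: "0 \<le> E K e" if "K \<in> \<T>" for K e
    unfolding E_def set_lebesgue_integral_def using \<tau>_pos[OF that]
    by (intro mult_nonneg_nonneg Bochner_Integration.integral_nonneg) (auto simp: weight_pos less_imp_le)
  show "0 \<le> form_S x x" unfolding S by (intro sum_nonneg nn)
  assume 0: "form_S x x = 0" and K: "K \<in> \<T>" and e: "e \<in> edges K" and s: "s \<in> e"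
  have "\<forall>K\<in>\<T>. (\<Sum>e\<in>edges K. E K e) = 0"
    using 0 unfolding S by (subst (asm) sum_nonneg_eq_0_iff) (auto simp: finite_mesh nn sum_nonneg)
  then have "(\<Sum>e\<in>edges K. E K e) = 0" using K by blast
  then have "\<forall>e\<in>edges K. E K e = 0"
    unfolding sum_nonneg_eq_0_iff[OF finite_edges[OF K] nn[OF K]] .
  then have "(LINT z:I \<times> e|face_measure e. f z * (rv x K z + (- 1) * rl x e z)\<^sup>2) = 0"
    using e \<tau>_pos[OF K] by (auto simp: E_def)
  moreover have "(\<lambda>z. rv x K z + (- 1) * rl x e z) \<in> face_polys p e"
  proof -
    obtain u v where "e = closed_segment u v" using edge_segment[OF edge_mesh[OF K e]] .
    from element_polys_subset_face_polys[OF rv_rep[OF x K] this] rl_rep[OF x edge_mesh[OF K e]]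
    show ?thesis by (rule face_polys_add)
  qed
  ultimately have "rv x K (t, s) + (- 1) * rl x e (t, s) = 0"
    using face_AE_0[OF _ edge_mesh[OF K e] s, of "\<lambda>z. rv x K z + (- 1) * rl x e z" t] by simp
  then show "rl x e (t, s) = rv x K (t, s)" by simp
qed

lemma finite_surface_edges: "finite (surface_edges \<T>)"
  using finite_mesh_edges by (rule finite_subset[rotated]) (auto simp: surface_edges_def)

text \<open>The same estimate in time as for q, with arc length on surface edges in place of area on
  elements.\<close>

lemma form_D_energy:
  assumes x: "x \<in> X"
  shows "0 \<le> form_D x x"
    "form_D x x = 0 \<Longrightarrow> e \<in> surface_edges \<T> \<Longrightarrow> s \<in> e \<Longrightarrow> rl x e (t, s) = 0"
proof -
  define E where "E e = - (LINT z:I \<times> e|face_measure e. rl x e z * (f z * dt (rl x e) z))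
      - (LINT z:I \<times> e|face_measure e. rl x e z * (f' z * rl x e z))
      + (LINT y:e|arc_length e. rl x e (t1, y) * (weight \<alpha> t0 t1 * rl x e (t1, y)))" for e
  have E_ge: "\<alpha> / 2 * (LINT z:I \<times> e|face_measure e. f z * (rl x e z)\<^sup>2) \<le> E e" if e: "e \<in> mesh_edges \<T>" for e
  proof -
    interpret slab "arc_length e" e e t0 t1 using slab_edge[OF e] .
    obtain u v where uv: "e = closed_segment u v" "u \<noteq> v" using edge_segment[OF e] .
    note g = face_polys_dt[OF rl_rep[OF x e] uv]
    show ?thesis
      unfolding E_def face_measure_def using time_energy[OF g(1,2,3), of \<alpha>] .
  qed
  have nn: "0 \<le> (LINT z:I \<times> e|face_measure e. f z * (rl x e z)\<^sup>2)" for e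
    unfolding set_lebesgue_integral_def
    by (intro Bochner_Integration.integral_nonneg) (auto simp: weight_pos less_imp_le)
  have E_nn: "0 \<le> E e" if "e \<in> surface_edges \<T>" for e
    using E_ge[OF surface_edge_mesh[OF that]] nn[of e] \<alpha>_pos by (smt (verit) mult_nonneg_nonneg divide_nonneg_pos)
  have D: "form_D x x = (\<Sum>e\<in>surface_edges \<T>. E e)"
    by (simp add: form_D_def ip_surface_def ip_surface_time_def E_def sum.distrib sum_subtractf sum_negf mult_ac)
  show "0 \<le> form_D x x" unfolding D by (intro sum_nonneg E_nn)
  assume 0: "form_D x x = 0" and e: "e \<in> surface_edges \<T>" and s: "s \<in> e"
  have "E e = 0"
    using 0 e unfolding D by (subst (asm) sum_nonneg_eq_0_iff) (auto simp: finite_surface_edges E_nn)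
  then have "\<alpha> / 2 * (LINT z:I \<times> e|face_measure e. f z * (rl x e z)\<^sup>2) \<le> 0"
    using E_ge[OF surface_edge_mesh[OF e]] by simp
  then have "(LINT z:I \<times> e|face_measure e. f z * (rl x e z)\<^sup>2) = 0"
    using nn[of e] \<alpha>_pos by (simp add: mult_le_0_iff)
  then show "rl x e (t, s) = 0"
    by (rule face_AE_0[OF rl_rep[OF x surface_edge_mesh[OF e]] surface_edge_mesh[OF e] s])
qed

section \<open>The kernel of the bilinear form\<close>

text \<open>The weight depends on time only, so it factors out of the spatial integrals and the
  divergence theorem applies at each fixed time.\<close>

lemma weighted_divergence:
  fixes h h1 h2 :: "spacetime \<Rightarrow> real"
  assumes K: "K \<in> \<T>"
    and deriv: "\<And>t x. ((\<lambda>x. h (t, x)) has_derivative (\<lambda>v. h1 (t, x) * fst v + h2 (t, x) * snd v)) (at x)"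
    and c: "continuous_on UNIV h" "continuous_on UNIV h1" "continuous_on UNIV h2"
  shows "(LINT z:I \<times> interior K|lborel. f z * (h1 z * fst v + h2 z * snd v)) =
    (\<Sum>e\<in>edges K. (outward_normal K e \<bullet> v) * (LINT z:I \<times> e|face_measure e. f z * h z))"
proof -
  have c': "continuous_on S h" "continuous_on S h1" "continuous_on S h2" for S
    using c by (auto intro: continuous_on_subset)
  have sect: "continuous_on UNIV (\<lambda>x. h1 (t, x))" "continuous_on UNIV (\<lambda>x. h2 (t, x))" for t
    by (rule continuous_on_compose2[OF c(2)] continuous_on_compose2[OF c(3)]; auto intro!: continuous_intros)+
  obtain A B C where "triangle A B C K" using mesh_triangle[OF K] by blast
  then interpret triangle A B C K .
  have edge: "(LINT z:I \<times> e|face_measure e. f z * h z) = (LINT t:I|lborel. LINT x:e|arc_length e. weight \<alpha> t0 t * h (t, x))"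
    "set_integrable lborel I (\<lambda>t. LINT x:e|arc_length e. weight \<alpha> t0 t * h (t, x))" if "e \<in> edges K" for e
  proof -
    have "continuous_on (UNIV \<times> e) (\<lambda>z. f z * h z)" by (intro continuous_intros c')
    from slab.slab_Fubini(2,3)[OF slab_edge[OF edge_mesh[OF K that]] this]
    show "(LINT z:I \<times> e|face_measure e. f z * h z) = (LINT t:I|lborel. LINT x:e|arc_length e. weight \<alpha> t0 t * h (t, x))"
      "set_integrable lborel I (\<lambda>t. LINT x:e|arc_length e. weight \<alpha> t0 t * h (t, x))"
      by (simp_all add: face_measure_def)
  qed
  have "continuous_on (UNIV \<times> K) (\<lambda>z. f z * (h1 z * fst v + h2 z * snd v))" by (intro continuous_intros c')
  from slab.slab_Fubini(2)[OF slab_element[OF K] this]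
  have "(LINT z:I \<times> interior K|lborel. f z * (h1 z * fst v + h2 z * snd v)) =
      (LINT t:I|lborel. LINT x:interior K|lborel. weight \<alpha> t0 t * (h1 (t, x) * fst v + h2 (t, x) * snd v))"
    by (simp add: lborel_prod)
  also have "\<dots> = (LINT t:I|lborel. \<Sum>e\<in>edges K. (outward_normal K e \<bullet> v) * (LINT x:e|arc_length e. weight \<alpha> t0 t * h (t, x)))"
  proof (rule set_lebesgue_integral_cong, simp, intro allI impI)
    fix t
    have "(LINT x:interior K|lborel. weight \<alpha> t0 t * (h1 (t, x) * fst v + h2 (t, x) * snd v)) =
        weight \<alpha> t0 t * (LINT x:interior K|lborel. h1 (t, x) * fst v + h2 (t, x) * snd v)"
      by (rule set_integral_mult_right)
    also have "\<dots> = weight \<alpha> t0 t * (\<Sum>e\<in>edges K. (outward_normal K e \<bullet> v) * (LINT x:e|arc_length e. h (t, x)))"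
      by (simp only: divergence[OF deriv sect])
    finally show "(LINT x:interior K|lborel. weight \<alpha> t0 t * (h1 (t, x) * fst v + h2 (t, x) * snd v)) =
        (\<Sum>e\<in>edges K. (outward_normal K e \<bullet> v) * (LINT x:e|arc_length e. weight \<alpha> t0 t * h (t, x)))"
      by (simp add: sum_distrib_left mult_ac)
  qed
  also have "\<dots> = (\<Sum>e\<in>edges K. LINT t:I|lborel. (outward_normal K e \<bullet> v) * (LINT x:e|arc_length e. weight \<alpha> t0 t * h (t, x)))"
    unfolding set_lebesgue_integral_def scaleR_sum_right
  proof (rule Bochner_Integration.integral_sum)
    fix e assume e: "e \<in> edges K"
    have "set_integrable lborel I (\<lambda>t. (outward_normal K e \<bullet> v) * (LINT x:e|arc_length e. weight \<alpha> t0 t * h (t, x)))"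
      using edge(2)[OF e] by simp
    then show "integrable lborel (\<lambda>t. indicat_real I t *\<^sub>R ((outward_normal K e \<bullet> v) *
        (LINT x|arc_length e. indicat_real e x *\<^sub>R (weight \<alpha> t0 t * h (t, x)))))"
      unfolding set_integrable_def set_lebesgue_integral_def .
  qed
  also have "\<dots> = (\<Sum>e\<in>edges K. (outward_normal K e \<bullet> v) * (LINT z:I \<times> e|face_measure e. f z * h z))"
    by (intro sum.cong refl) (simp add: edge(1))
  finally show ?thesis .
qed

text \<open>Testing with the gradient of v on one element, the divergence theorem turns the coupling
  form into the weighted integral of \<open>|\<nabla>v|\<^sup>2\<close>.\<close>

lemma coupling_kernel_gradient:
  assumes x: "x \<in> X" and C: "\<And>y. y \<in> X \<Longrightarrow> v_null y \<Longrightarrow> l_null y \<Longrightarrow> form_C x y = 0"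
    and vl: "\<And>K e s t. K \<in> \<T> \<Longrightarrow> e \<in> edges K \<Longrightarrow> s \<in> e \<Longrightarrow> rl x e (t, s) = rv x K (t, s)"
    and K: "K \<in> \<T>"
  shows "dx1 (rv x K) z = 0" "dx2 (rv x K) z = 0"
proof -
  let ?v = "rv x K" and ?N = "outward_normal K"
  \<comment> \<open>The test field is the gradient (a, b) of v on the one element \<open>K\<close>,
    extended by zero.\<close>
  define a b where "a = dx1 ?v" and "b = dx2 ?v"
  note v = rv_rep[OF x K]
  have a: "a \<in> element_polys p" and b: "b \<in> element_polys p"
    using element_polys_dx(1,2)[OF v] by (simp_all add: a_def b_def)
  note c = element_polys_continuous[OF v] element_polys_continuous[OF a] element_polys_continuous[OF b]
    element_polys_continuous[OF element_polys_dx(1)[OF a]] element_polys_continuous[OF element_polys_dx(2)[OF a]]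
    element_polys_continuous[OF element_polys_dx(1)[OF b]] element_polys_continuous[OF element_polys_dx(2)[OF b]]
  define y :: "discrete_triple" where
    "y = (\<lambda>z. (indicator (interior K) (snd z) * a z, indicator (interior K) (snd z) * b z), \<lambda>z. 0, \<lambda>z. 0)"
  have yX: "y \<in> X"
    using W_indicator(1)[OF K a] W_indicator(1)[OF K b] by (simp add: X_def y_def V_space_def vec_space_def W_0 M_0)
  have rqK: "rq y K = (\<lambda>z. (a z, b z))"
    using W_indicator(2)[OF K a] W_indicator(2)[OF K b] by (simp add: y_def elem_rep_vec_def)
  have rqK': "rq y K' = (\<lambda>z. 0)" if "K' \<in> \<T>" "K' \<noteq> K" for K'
    using W_indicator(3)[OF K a that] W_indicator(3)[OF K b that] by (simp add: y_def elem_rep_vec_def zero_prod_def)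
  have div0: "divergence (\<lambda>z. 0) = (\<lambda>z. 0)" by (auto simp: divergence_def fun_eq_iff)
  have "form_C x y = 0"
    using yX null_components(2,3) by (intro C) (simp_all add: y_def)
  moreover have "ip_elements \<T> I (rv x) (\<lambda>K z. f z * divergence (rq y K) z) =
      (LINT z:I \<times> interior K|lborel. ?v z \<bullet> (f z * (dx1 a z + dx2 b z)))"
    unfolding ip_elements_def using finite_mesh K
    by (subst sum.remove[of _ K]) (auto intro!: sum.neutral simp: rqK rqK' div0 divergence_Pair set_lebesgue_integral_def)
  moreover have "ip_lateral \<T> I (\<lambda>K e. rl x e) (\<lambda>K e z. (rq y K z \<bullet> outward_normal K e) * f z) =
      (\<Sum>e\<in>edges K. LINT z:I \<times> e|face_measure e. rl x e z * (((a z, b z) \<bullet> ?N e) * f z))"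
    unfolding ip_lateral_def using finite_mesh K
    by (subst sum.remove[of _ K]) (auto intro!: sum.neutral simp: rqK rqK' set_lebesgue_integral_def)
  moreover have "(LINT z:I \<times> e|face_measure e. rl x e z * (((a z, b z) \<bullet> ?N e) * f z)) =
      (?N e \<bullet> (1, 0)) * (LINT z:I \<times> e|face_measure e. f z * (?v z * a z)) +
      (?N e \<bullet> (0, 1)) * (LINT z:I \<times> e|face_measure e. f z * (?v z * b z))" if e: "e \<in> edges K" for e
  proof -
    have "(LINT z:I \<times> e|face_measure e. rl x e z * (((a z, b z) \<bullet> ?N e) * f z)) =
        (LINT z:I \<times> e|face_measure e. (?N e \<bullet> (1, 0)) * (f z * (?v z * a z))) +
        (?N e \<bullet> (0, 1)) * (LINT z:I \<times> e|face_measure e. f z * (?v z * b z))"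
    \<comment> \<open>On the edge \<lambda> may be replaced by v, so the face term becomes the flux
      of the field v (a, b).\<close>
    proof (rule set_integral_linear)
      fix z assume "z \<in> I \<times> e"
      then have "rl x e z = ?v z" using vl[OF K e] by auto
      then show "rl x e z * (((a z, b z) \<bullet> ?N e) * f z) =
          (?N e \<bullet> (1, 0)) * (f z * (?v z * a z)) + (?N e \<bullet> (0, 1)) * (f z * (?v z * b z))"
        by (simp add: inner_prod_def algebra_simps)
    qed (intro integrable_face slab_face_sets edge_mesh[OF K e] continuous_intros c)+
    then show ?thesis by simp
  qed
  ultimately have "(LINT z:I \<times> interior K|lborel. ?v z \<bullet> (f z * (dx1 a z + dx2 b z))) =
      (\<Sum>e\<in>edges K. (?N e \<bullet> (1, 0)) * (LINT z:I \<times> e|face_measure e. f z * (?v z * a z))) +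
      (\<Sum>e\<in>edges K. (?N e \<bullet> (0, 1)) * (LINT z:I \<times> e|face_measure e. f z * (?v z * b z)))"
    by (simp add: form_C_def sum.distrib)
  \<comment> \<open>The flux is converted back to a volume integral one component at a time: v a in
    the direction (1, 0), then v b in the direction (0, 1).\<close>
  also have "(\<Sum>e\<in>edges K. (?N e \<bullet> (1, 0)) * (LINT z:I \<times> e|face_measure e. f z * (?v z * a z))) =
      (LINT z:I \<times> interior K|lborel. f z * ((?v z * dx1 a z + a z * a z) * fst (1::real, 0::real) + (?v z * dx2 a z + b z * a z) * snd (1::real, 0::real)))"
  proof (rule weighted_divergence[OF K, symmetric])
    show "((\<lambda>x. ?v (t, x) * a (t, x)) has_derivative
        (\<lambda>w. (?v (t, x) * dx1 a (t, x) + a (t, x) * a (t, x)) * fst w + (?v (t, x) * dx2 a (t, x) + b (t, x) * a (t, x)) * snd w)) (at x)" for t x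
      by (rule has_derivative_eq_rhs[OF has_derivative_mult[OF element_polys_dx(3)[OF v] element_polys_dx(3)[OF a]]])
        (simp add: a_def[symmetric] b_def[symmetric] fun_eq_iff algebra_simps)
  qed (intro continuous_intros c)+
  also have "(\<Sum>e\<in>edges K. (?N e \<bullet> (0, 1)) * (LINT z:I \<times> e|face_measure e. f z * (?v z * b z))) =
      (LINT z:I \<times> interior K|lborel. f z * ((?v z * dx1 b z + a z * b z) * fst (0::real, 1::real) + (?v z * dx2 b z + b z * b z) * snd (0::real, 1::real)))"
  proof (rule weighted_divergence[OF K, symmetric])
    show "((\<lambda>x. ?v (t, x) * b (t, x)) has_derivative
        (\<lambda>w. (?v (t, x) * dx1 b (t, x) + a (t, x) * b (t, x)) * fst w + (?v (t, x) * dx2 b (t, x) + b (t, x) * b (t, x)) * snd w)) (at x)" for t x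
      by (rule has_derivative_eq_rhs[OF has_derivative_mult[OF element_polys_dx(3)[OF v] element_polys_dx(3)[OF b]]])
        (simp add: a_def[symmetric] b_def[symmetric] fun_eq_iff algebra_simps)
  qed (intro continuous_intros c)+
  also have "(LINT z:I \<times> interior K|lborel. f z * ((?v z * dx1 a z + a z * a z) * fst (1::real, 0::real) + (?v z * dx2 a z + b z * a z) * snd (1::real, 0::real))) +
      (LINT z:I \<times> interior K|lborel. f z * ((?v z * dx1 b z + a z * b z) * fst (0::real, 1::real) + (?v z * dx2 b z + b z * b z) * snd (0::real, 1::real))) =
      (LINT z:I \<times> interior K|lborel. f z * (?v z * dx1 a z + a z * a z) + f z * (?v z * dx2 b z + b z * b z))"
    by (subst set_integral_add(2)) (auto intro!: integrable_element[OF K] continuous_intros c)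
  \<comment> \<open>The product rule splits div(v grad v) into v div(grad v), which cancels against
    the volume term of the coupling, and the squared gradient.\<close>
  also have "\<dots> = (LINT z:I \<times> interior K|lborel. ?v z \<bullet> (f z * (dx1 a z + dx2 b z))) +
      1 * (LINT z:I \<times> interior K|lborel. f z * ((a z)\<^sup>2 + (b z)\<^sup>2))"
    by (rule set_integral_linear; (intro integrable_element[OF K] continuous_intros c slab_element_sets)?)
      (simp add: power2_eq_square algebra_simps)
  finally have "(LINT z:I \<times> interior K|lborel. f z * ((a z)\<^sup>2 + (b z)\<^sup>2)) = 0" by simp
  then have "AE z in lborel. z \<in> I \<times> interior K \<longrightarrow> f z * ((a z)\<^sup>2 + (b z)\<^sup>2) = 0"
    by (rule element_AE_0[OF K]) (auto intro!: continuous_intros c simp: weight_pos less_imp_le)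
  then have ab: "AE z in lborel. z \<in> I \<times> interior K \<longrightarrow> a z = 0 \<and> b z = 0"
  proof (rule eventually_mono, intro impI)
    fix z assume "z \<in> I \<times> interior K" "z \<in> I \<times> interior K \<longrightarrow> f z * ((a z)\<^sup>2 + (b z)\<^sup>2) = 0"
    then have "(a z)\<^sup>2 + (b z)\<^sup>2 = 0" using weight_pos[of \<alpha> t0 "fst z"] by auto
    then show "a z = 0 \<and> b z = 0" by (simp add: sum_power2_eq_zero_iff)
  qed
  have "AE z in lborel. z \<in> I \<times> interior K \<longrightarrow> a z = 0" using ab by eventually_elim auto
  from element_polys_AE_0[OF a open_interior interior_element_nonempty[OF K] t01 this]
  show "dx1 ?v z = 0" by (simp add: a_def)
  have "AE z in lborel. z \<in> I \<times> interior K \<longrightarrow> b z = 0" using ab by eventually_elim auto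
  from element_polys_AE_0[OF b open_interior interior_element_nonempty[OF K] t01 this]
  show "dx2 ?v z = 0" by (simp add: b_def)
qed

lemma coupling_kernel:
  assumes x: "x \<in> X" and C: "\<And>y. y \<in> X \<Longrightarrow> v_null y \<Longrightarrow> l_null y \<Longrightarrow> form_C x y = 0"
    and vl: "\<And>K e s t. K \<in> \<T> \<Longrightarrow> e \<in> edges K \<Longrightarrow> s \<in> e \<Longrightarrow> rl x e (t, s) = rv x K (t, s)"
    and l: "\<And>e s t. e \<in> surface_edges \<T> \<Longrightarrow> s \<in> e \<Longrightarrow> rl x e (t, s) = 0"
  shows "v_null x" "l_null x"
proof -
  have const: "rv x K (t, r) = rv x K (t, s)" if K: "K \<in> \<T>" for K t r s
  proof -
    have "((\<lambda>x'. rv x K (t, x')) has_derivative (\<lambda>h. 0)) (at y)" for y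
      using element_polys_dx(3)[OF rv_rep[OF x K], of t y] coupling_kernel_gradient[OF x C vl K] by simp
    then have "\<exists>c. \<forall>y. rv x K (t, y) = c"
      using has_derivative_zero_constant[of UNIV "\<lambda>x'. rv x K (t, x')"] by auto
    then obtain c where "\<And>y. rv x K (t, y) = c" by blast
    then show ?thesis by simp
  qed
  have edge_point: "\<exists>s. s \<in> e" if e: "e \<in> mesh_edges \<T>" for e
  proof -
    obtain u v where "e = closed_segment u v" using edge_segment[OF e] .
    then have "u \<in> e" by simp
    then show ?thesis by (rule exI)
  qed
  obtain K0 e0 where K0: "K0 \<in> \<T>" "e0 \<in> edges K0" "e0 \<in> surface_edges \<T>" using surface_edge_exists .
  obtain s0 where s0: "s0 \<in> e0" using edge_point[OF edge_mesh[OF K0(1,2)]] by blast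
  have P0: "\<forall>z. rv x K0 z = 0"
  proof
    fix z :: spacetime
    obtain t :: real and r :: plane where z: "z = (t, r)" by (cases z)
    have "rv x K0 (t, r) = rv x K0 (t, s0)" by (rule const[OF K0(1)])
    also have "\<dots> = 0" using vl[OF K0(1,2) s0, of t] l[OF K0(3) s0, of t] by simp
    finally show "rv x K0 z = 0" unfolding z .
  qed
  have all: "\<forall>z. rv x K z = 0" if K: "K \<in> \<T>" for K
  proof (rule mesh_connected[where P = "\<lambda>K. \<forall>z. rv x K z = 0", OF K0(1) P0 K])
    fix K K' e assume K: "K \<in> \<T>" and K': "K' \<in> \<T>" and e: "e \<in> edges K" "e \<in> edges K'"
      and 0: "\<forall>z. rv x K z = 0"
    obtain s where s: "s \<in> e" using edge_point[OF edge_mesh[OF K e(1)]] by blast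
    show "\<forall>z. rv x K' z = 0"
    proof
      fix z :: spacetime
      obtain t :: real and r :: plane where z: "z = (t, r)" by (cases z)
      have "rv x K' (t, r) = rv x K' (t, s)" by (rule const[OF K'])
      \<comment> \<open>Both elements take the value of the same face polynomial on their common
        edge, so \<lambda> transports the zero from \<open>K\<close> to \<open>K'\<close>; one point
        of the edge is enough.\<close>
      also have "\<dots> = rv x K (t, s)" using vl[OF K' e(2) s, of t] vl[OF K e(1) s, of t] by simp
      finally show "rv x K' z = 0" using 0 unfolding z by simp
    qed
  qed
  then show "v_null x" by (auto simp: v_null_def)
  show "l_null x" unfolding l_null_def
  proof (intro ballI allI)
    fix e and t :: real and s assume "e \<in> mesh_edges \<T>" and s: "s \<in> e"
    then obtain K where K: "K \<in> \<T>" "e \<in> edges K" by (auto simp: mesh_edges_def)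
    show "rl x e (t, s) = 0" using vl[OF K s, of t] all[OF K(1)] by simp
  qed
qed

lemma form_B_energy:
  assumes x: "x \<in> X" and B: "form_B x x = 0"
  shows "q_null x" "K \<in> \<T> \<Longrightarrow> e \<in> edges K \<Longrightarrow> s \<in> e \<Longrightarrow> rl x e (t, s) = rv x K (t, s)"
    "e \<in> surface_edges \<T> \<Longrightarrow> s \<in> e \<Longrightarrow> rl x e (t, s) = 0"
proof -
  have "form_A x x + form_S x x + form_D x x = 0" using B by (simp add: form_B_def)
  then have 0: "form_A x x = 0" "form_S x x = 0" "form_D x x = 0"
    using form_A_energy(1)[OF x] form_S_energy(1)[OF x] form_D_energy(1)[OF x] by linarith+
  show "q_null x" using form_A_energy(2)[OF x 0(1)] .
  show "K \<in> \<T> \<Longrightarrow> e \<in> edges K \<Longrightarrow> s \<in> e \<Longrightarrow> rl x e (t, s) = rv x K (t, s)"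
    using form_S_energy(2)[OF x 0(2)] .
  show "e \<in> surface_edges \<T> \<Longrightarrow> s \<in> e \<Longrightarrow> rl x e (t, s) = 0"
    using form_D_energy(2)[OF x 0(3)] .
qed

text \<open>When q vanishes, testing with a pure q-field \<open>y\<close> leaves
  \<open>form_B x y = form_C x y\<close> and \<open>form_B y x = - form_C x y\<close>. So either
  kernel yields the same condition on v and \<lambda>.\<close>

lemma form_B_kernel:
  assumes x: "x \<in> X" and B: "(\<forall>y\<in>X. form_B x y = 0) \<or> (\<forall>y\<in>X. form_B y x = 0)"
  shows "q_null x" "v_null x" "l_null x"
proof -
  have "form_B x x = 0" using B x by blast
  note en = form_B_energy[OF x this]
  show "q_null x" by (rule en(1))
  have "form_C x y = 0" if y: "y \<in> X" "v_null y" "l_null y" for y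
    using B
  proof
    assume "\<forall>y\<in>X. form_B x y = 0"
    then have "form_B x y = 0" using y by blast
    then show ?thesis
      by (simp add: form_B_def form_q_null[OF en(1)] form_vl_null[OF y(2,3)] form_l_null[OF y(3)])
  next
    assume "\<forall>y\<in>X. form_B y x = 0"
    then have "form_B y x = 0" using y by blast
    then show ?thesis
      by (simp add: form_B_def form_q_null[OF en(1)] form_vl_null[OF y(2,3)] form_l_null[OF y(3)])
  qed
  from coupling_kernel[OF x this en(2,3)] show "v_null x" "l_null x" by blast+
qed

section \<open>Existence and uniqueness\<close>

lemma form_B_null:
  assumes "q_null x" "v_null x" "l_null x"
  shows "form_B x y = 0"
  unfolding form_B_def
  by (simp add: form_q_null[OF assms(1)] form_vl_null[OF assms(2,3)] form_l_null[OF assms(3)])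

text \<open>Any p + 1 distinct points determine a polynomial of degree p. Points for the edge
  parameter must lie in [0,1], the range in which face polynomials are specified.\<close>

definition grid :: "real set" where "grid = real ` {..p}"
definition unit_grid :: "real set" where "unit_grid = (\<lambda>j. 1 / (real j + 1)) ` {..p}"

lemma grids: "finite grid" "p < card grid" "finite unit_grid" "p < card unit_grid" "unit_grid \<subseteq> {0..1}"
proof -
  have "inj_on (\<lambda>j. 1 / (real j + 1)) {..p}" by (auto simp: inj_on_def)
  then show "p < card unit_grid" by (simp add: unit_grid_def card_image)
  show "p < card grid" by (simp add: grid_def card_image)
qed (auto simp: grid_def unit_grid_def)

lemma element_polys_grid_0:
  assumes "g \<in> element_polys p" "\<And>z. z \<in> grid \<times> grid \<times> grid \<Longrightarrow> g z = 0"
  shows "g = (\<lambda>z. 0)"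
proof
  show "g z = 0" for z
    by (rule element_polys_eq_0[OF assms(1), where St = grid and Sx = "\<lambda>_. grid" and Sy = "\<lambda>_ _. grid"])
      (use assms(2) grids(2) in auto)
qed

text \<open>Modulo null elements the discrete space is finite dimensional, since its elements are
  determined by finitely many point values of the representing polynomials.\<close>

lemma form_B_solvable: "\<exists>x\<in>X. \<forall>y\<in>X. form_B x y = data_q y + data_l y"
proof -
  have "\<forall>e\<in>mesh_edges \<T>. \<exists>ab. e = closed_segment (fst ab) (snd ab)"
  proof
    fix e assume "e \<in> mesh_edges \<T>"
    then obtain u v where "e = closed_segment u v" by (rule edge_segment)
    then show "\<exists>ab. e = closed_segment (fst ab) (snd ab)" by (intro exI[of _ "(u, v)"]) simp
  qed
  from bchoice[OF this] obtain ab where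
    ab: "\<And>e. e \<in> mesh_edges \<T> \<Longrightarrow> e = closed_segment (fst (ab e)) (snd (ab e))" by blast
  define pt where "pt e s = fst (ab e) + s *\<^sub>R (snd (ab e) - fst (ab e))" for e s
  have pt: "pt e s \<in> e" if "e \<in> mesh_edges \<T>" "s \<in> unit_grid" for e s
  proof -
    have "0 \<le> s" "s \<le> 1" using grids(5) that(2) by auto
    then have "pt e s \<in> closed_segment (fst (ab e)) (snd (ab e))" unfolding pt_def by (rule segment_point)
    then show ?thesis using ab[OF that(1), symmetric] by simp
  qed
  let ?G = "\<T> \<times> (grid \<times> grid \<times> grid)" and ?F = "mesh_edges \<T> \<times> grid \<times> unit_grid"
  \<comment> \<open>The point evaluations themselves form the index set, so the family of
    functionals is the identity on \<open>J\<close>.\<close>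
  define J where "J = (\<lambda>(K, z) x. rv x K z) ` ?G \<union> (\<lambda>(K, z) x. fst (rq x K z)) ` ?G \<union>
    (\<lambda>(K, z) x. snd (rq x K z)) ` ?G \<union> (\<lambda>(e, t, s) x. rl x e (t, pt e s)) ` ?F"
  have fin: "finite J"
    unfolding J_def by (simp add: finite_mesh finite_mesh_edges grids)
  have lin: "i (comb x c y) = i x + c * i y" if "i \<in> J" "x \<in> X" "y \<in> X" for i x c y
    using that(1) unfolding J_def
    by (auto simp: rv_comb[OF that(2,3)] rq_comb(1)[OF that(2,3)] rl_comb(1)[OF that(2,3)] pt)
  have sep: "q_null x \<and> v_null x \<and> l_null x" if x: "x \<in> X" and 0: "\<forall>i\<in>J. i x = 0" for x
  proof (intro conjI)
    have J: "rv x K z = 0" "fst (rq x K z) = 0" "snd (rq x K z) = 0" if "K \<in> \<T>" "z \<in> grid \<times> grid \<times> grid" for K z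
    proof -
      have "(\<lambda>x. rv x K z) \<in> J" "(\<lambda>x. fst (rq x K z)) \<in> J" "(\<lambda>x. snd (rq x K z)) \<in> J"
        unfolding J_def using that by force+
      from this[THEN bspec[OF 0]] show "rv x K z = 0" "fst (rq x K z) = 0" "snd (rq x K z) = 0" by simp_all
    qed
    show "v_null x" unfolding v_null_def
    proof
      fix K assume K: "K \<in> \<T>"
      show "rv x K = (\<lambda>z. 0)" by (rule element_polys_grid_0[OF rv_rep[OF x K] J(1)[OF K]])
    qed
    show "q_null x" unfolding q_null_def
    proof
      fix K assume K: "K \<in> \<T>"
      obtain g h where gh: "g \<in> element_polys p" "h \<in> element_polys p" "rq x K = (\<lambda>z. (g z, h z))"
        by (rule rq_rep[OF x K])
      have "g = (\<lambda>z. 0)" by (rule element_polys_grid_0[OF gh(1)]) (use J(2)[OF K] gh(3) in simp)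
      moreover have "h = (\<lambda>z. 0)" by (rule element_polys_grid_0[OF gh(2)]) (use J(3)[OF K] gh(3) in simp)
      ultimately show "rq x K = (\<lambda>z. 0)" unfolding gh(3) by (simp add: zero_prod_def)
    qed
    show "l_null x" unfolding l_null_def
    proof (intro ballI allI)
      fix e and t :: real and s assume e: "e \<in> mesh_edges \<T>" and s: "s \<in> e"
      show "rl x e (t, s) = 0"
      proof (rule face_polys_eq_0[OF rl_rep[OF x e] ab[OF e], where St = grid and Ss = "\<lambda>_. unit_grid"])
        fix t' s' assume "t' \<in> grid" "s' \<in> unit_grid"
        then have "(\<lambda>x. rl x e (t', pt e s')) \<in> J"
          unfolding J_def using e by (intro UnI2 image_eqI[where x = "(e, t', s')"]) simp_all
        from bspec[OF 0 this] show "rl x e (t', fst (ab e) + s' *\<^sub>R (snd (ab e) - fst (ab e))) = 0"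
          by (simp add: pt_def)
      qed (use s grids in auto)
    qed
  qed
  let ?z = "(\<lambda>z. 0, \<lambda>z. 0, \<lambda>z. 0) :: discrete_triple"
  show ?thesis
  proof (rule variational_problem_solvable[where J = J and \<phi> = "\<lambda>i. i" and comb = comb and z = ?z])
    show "form_B x y = 0" if "x \<in> X" "\<forall>i\<in>J. i x = 0" for x y
      using sep[OF that] by (intro form_B_null) auto
    \<comment> \<open>The compatibility condition of the alternative: the right kernel consists of
      null elements only, and the data functional ignores these.\<close>
    show "data_q y + data_l y = 0" if y: "y \<in> X" "\<forall>x\<in>X. form_B x y = 0" for y
      using form_B_kernel[OF y(1) disjI2[OF y(2)]] by (simp add: form_q_null form_l_null)
    show "?z \<in> X" by (simp add: X_def V_space_def vec_space_def W_0 M_0)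
    show "form_B ?z y = 0" for y by (intro form_B_null null_components)
  qed (use fin lin in \<open>simp_all add: comb_X form_B_add data_add algebra_simps\<close>)
qed

abbreviation "solution x \<equiv>
  hdg_solution p L R \<Omega> \<T> t0 t1 \<alpha> \<tau> q0 l0 (fst x) (fst (snd x)) (snd (snd x))"

lemma solution_iff: "solution x \<longleftrightarrow> x \<in> X \<and> (\<forall>y\<in>X. form_B x y = data_q y + data_l y)"
proof
  assume sol: "solution x"
  then have x: "x \<in> X" by (auto simp: hdg_solution_def X_def mem_Times_iff)
  have "eqs x y" if "y \<in> X" for y
    using sol that by (auto simp: hdg_solution_def X_def)
  then show "x \<in> X \<and> (\<forall>y\<in>X. form_B x y = data_q y + data_l y)"
    using x hdg_equations_imp_form_B by blast
next
  assume x: "x \<in> X \<and> (\<forall>y\<in>X. form_B x y = data_q y + data_l y)"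
  then have eqs: "eqs x y" if "y \<in> X" for y using form_B_imp_hdg_equations that by blast
  have "hdg_equations p \<T> t0 t1 \<alpha> \<tau> q0 l0 (fst x) (fst (snd x)) (snd (snd x)) r w \<mu>"
    if "r \<in> V" "w \<in> W" "\<mu> \<in> M" for r w \<mu>
    using eqs[of "(r, w, \<mu>)"] that by (simp add: X_def)
  then show "solution x" using x by (simp add: hdg_solution_def X_def mem_Times_iff)
qed

text \<open>The interiors of the elements exhaust the domain up to a null set of the plane, and the
  product with the time axis is again null.\<close>

lemma ae_eq_on_domain:
  assumes "\<And>K. K \<in> \<T> \<Longrightarrow> ae_eq_on lborel (I \<times> interior K) g h"
  shows "ae_eq_on lborel (I \<times> \<Omega>) (g :: spacetime \<Rightarrow> 'b) h"
proof -
  \<comment> \<open>Adding the complement of the domain turns the statement into one about a Borel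
    set of full measure in the plane, as needed for lifting it to the product measure.\<close>
  let ?S = "- \<Omega> \<union> (\<Union>K\<in>\<T>. interior K)"
  have S: "?S \<in> sets borel"
    using open_domain by (intro sets.Un borel_comp borel_open open_UN ballI open_interior)
  have "AE z in lborel \<Otimes>\<^sub>M lborel. (z :: spacetime) \<in> UNIV \<times> ?S"
  proof (rule pair_sigma_finite.AE_pair_measure[OF pair_sigma_finite.intro[OF
          lborel.sigma_finite_measure_axioms lborel.sigma_finite_measure_axioms]])
    have "{z \<in> space (lborel \<Otimes>\<^sub>M lborel). (z :: spacetime) \<in> UNIV \<times> ?S} = UNIV \<times> ?S"
      by (auto simp: space_pair_measure)
    then show "{z \<in> space (lborel \<Otimes>\<^sub>M lborel). (z :: spacetime) \<in> UNIV \<times> ?S} \<in> sets (lborel \<Otimes>\<^sub>M lborel)"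
      using S by (simp only:) (intro pair_measureI, auto)
    have "AE x in lborel. x \<in> ?S" using AE_in_interior by (rule eventually_mono) auto
    then show "AE t in lborel. AE x in lborel. (t :: real, x) \<in> UNIV \<times> ?S" by simp
  qed
  then have "AE z in lborel. (z :: spacetime) \<in> UNIV \<times> ?S" unfolding lborel_prod .
  moreover have "AE z in lborel. \<forall>K\<in>\<T>. z \<in> I \<times> interior K \<longrightarrow> g z = h z"
    using assms finite_mesh unfolding ae_eq_on_def by (intro AE_finite_allI)
  ultimately show ?thesis unfolding ae_eq_on_def by eventually_elim auto
qed

text \<open>The difference of two solutions lies in the left kernel, hence is null. So the
  representatives coincide, and the functions agree almost everywhere with their common
  representative.\<close>

lemma solution_unique:
  assumes x: "solution x" and y: "solution y"
  shows "ae_eq_on lborel (I \<times> \<Omega>) (fst x) (fst y)"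
    "ae_eq_on lborel (I \<times> \<Omega>) (fst (snd x)) (fst (snd y))"
    "e \<in> mesh_edges \<T> \<Longrightarrow> ae_eq_on (face_measure e) (I \<times> e) (snd (snd x)) (snd (snd y))"
proof -
  have X: "x \<in> X" "y \<in> X" using x y by (simp_all add: solution_iff)
  define d where "d = comb x (- 1) y"
  have d: "d \<in> X" unfolding d_def using X by (rule comb_X)
  have "\<forall>z\<in>X. form_B d z = 0"
    using x y X by (auto simp: solution_iff d_def form_B_add)
  then have null: "q_null d" "v_null d" "l_null d" using form_B_kernel[OF d] by blast+
  show "ae_eq_on lborel (I \<times> \<Omega>) (fst (snd x)) (fst (snd y))"
  proof (rule ae_eq_on_domain)
    fix K assume K: "K \<in> \<T>"
    have "rv d K z = 0" for z using null(2) K by (simp add: v_null_def)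
    then have eq: "rv x K z = rv y K z" for z using rv_comb[OF X K, of "- 1" z] by (simp add: d_def)
    have "ae_eq_on lborel (I \<times> interior K) (fst (snd x)) (rv x K)"
      "ae_eq_on lborel (I \<times> interior K) (fst (snd y)) (rv y K)"
      using X K by (auto simp: X_def mem_Times_iff intro!: elem_rep(2))
    then show "ae_eq_on lborel (I \<times> interior K) (fst (snd x)) (fst (snd y))"
      unfolding ae_eq_on_def by eventually_elim (auto simp: eq)
  qed
  show "ae_eq_on lborel (I \<times> \<Omega>) (fst x) (fst y)"
  proof (rule ae_eq_on_domain)
    fix K assume K: "K \<in> \<T>"
    have "rq d K z = 0" for z using null(1) K by (simp add: q_null_def)
    then have eq: "rq x K z = rq y K z" for z using rq_comb(1)[OF X K, of "- 1" z] by (simp add: d_def)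
    have "ae_eq_on lborel (I \<times> interior K) (\<lambda>z. fst (fst u z)) (\<lambda>z. fst (rq u K z))"
      "ae_eq_on lborel (I \<times> interior K) (\<lambda>z. snd (fst u z)) (\<lambda>z. snd (rq u K z))" if "u \<in> X" for u
      using elem_rep(2)[of "\<lambda>z. fst (fst u z)" K] elem_rep(2)[of "\<lambda>z. snd (fst u z)" K] that K
      by (auto simp: X_def mem_Times_iff V_space_def vec_space_def elem_rep_vec_def)
    note X[THEN this(1)] X[THEN this(2)]
    then show "ae_eq_on lborel (I \<times> interior K) (fst x) (fst y)"
      unfolding ae_eq_on_def by eventually_elim (auto simp: eq prod_eq_iff)
  qed
  show "ae_eq_on (face_measure e) (I \<times> e) (snd (snd x)) (snd (snd y))" if e: "e \<in> mesh_edges \<T>"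
  proof -
    have eq: "rl x e (t, s) = rl y e (t, s)" if "s \<in> e" for t s
      using rl_comb(1)[OF X e, of "(t, s)" "- 1"] null(3) e that by (simp add: l_null_def d_def)
    have "ae_eq_on (face_measure e) (I \<times> e) (snd (snd x)) (rl x e)"
      "ae_eq_on (face_measure e) (I \<times> e) (snd (snd y)) (rl y e)"
      using X e by (auto simp: X_def mem_Times_iff intro!: face_rep(2))
    then show ?thesis unfolding ae_eq_on_def by eventually_elim (auto simp: eq)
  qed
qed

end

theorem theorem3p1:
  fixes L R H \<alpha> \<Delta>t T :: real and b :: "real \<Rightarrow> real" and \<Omega> :: "plane set"
    and \<T> :: "plane set set" and t :: "nat \<Rightarrow> real" and N n p :: nat
    and \<tau> :: "plane set \<Rightarrow> real" and q0 :: "plane \<Rightarrow> plane" and l0 :: "plane \<Rightarrow> real"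
  assumes "L < R" and "piecewise_linear_on L R b" and "\<forall>x\<in>{L..R}. 0 < b x \<and> b x < H" and "b L = b R"
    and "\<Omega> = water_domain L R H b"
    and "periodic_mesh L R \<Omega> \<T>"
    and "t 0 = 0" and "t N = T" and "0 < \<Delta>t" and "\<forall>m<N. t (Suc m) - t m = \<Delta>t" and "n < N"
    and "0 < \<alpha>"
    and "q0 \<in> vec_space (L2_on lborel \<Omega>)"
    and "l0 \<in> L2_on (arc_length (closure (free_surface L R))) (free_surface L R)"
    and "\<forall>K\<in>\<T>. 0 < \<tau> K"
  shows "(\<exists>q v l. hdg_solution p L R \<Omega> \<T> (t n) (t (Suc n)) \<alpha> \<tau> q0 l0 q v l) \<and>
         (\<forall>q v l q' v' l'.
            hdg_solution p L R \<Omega> \<T> (t n) (t (Suc n)) \<alpha> \<tau> q0 l0 q v l \<and>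
            hdg_solution p L R \<Omega> \<T> (t n) (t (Suc n)) \<alpha> \<tau> q0 l0 q' v' l' \<longrightarrow>
            ae_eq_on lborel ({t n<..<t (Suc n)} \<times> \<Omega>) q q' \<and>
            ae_eq_on lborel ({t n<..<t (Suc n)} \<times> \<Omega>) v v' \<and>
            (\<forall>e\<in>mesh_edges \<T>. ae_eq_on (face_measure e) ({t n<..<t (Suc n)} \<times> e) l l'))"
proof -
  have "t (Suc n) - t n = \<Delta>t" using assms(10,11) by blast
  then have "t n < t (Suc n)" using assms(9) by linarith
  then interpret hdg_slab L R H b \<Omega> \<T> "t n" "t (Suc n)" \<alpha> p \<tau> q0 l0
    using assms by unfold_locales auto
  obtain x where "solution x" using form_B_solvable solution_iff by blast
  then have "\<exists>q v l. hdg_solution p L R \<Omega> \<T> (t n) (t (Suc n)) \<alpha> \<tau> q0 l0 q v l" by blast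
  moreover have "ae_eq_on lborel ({t n<..<t (Suc n)} \<times> \<Omega>) q q' \<and>
      ae_eq_on lborel ({t n<..<t (Suc n)} \<times> \<Omega>) v v' \<and>
      (\<forall>e\<in>mesh_edges \<T>. ae_eq_on (face_measure e) ({t n<..<t (Suc n)} \<times> e) l l')"
    if "hdg_solution p L R \<Omega> \<T> (t n) (t (Suc n)) \<alpha> \<tau> q0 l0 q v l"
      "hdg_solution p L R \<Omega> \<T> (t n) (t (Suc n)) \<alpha> \<tau> q0 l0 q' v' l'" for q v l q' v' l'
    using solution_unique[of "(q, v, l)" "(q', v', l')"] that by simp
  ultimately show ?thesis by blast
qed

end
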